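(* Assume that $J$ and $f$ satisfy the standing assumptions listed in the context, and let $u(t,x)$ and $X(t)$ be the transition front and the function described in the context. Let $\beta_0>0$. Suppose $t_0\in\mathbb{R}$ and $u_0\in C^b_{\rm unif}(\mathbb{R},\mathbb{R})$ satisfy $u_0:\mathbb{R}\to[0,1]$, $u_0(-\infty)=1$, and there is a constant $C>0$ with $|u_0(x)-u(t_0,x)|\le Ce^{-\beta_0(x-X(t_0))}$ for all $x\in\mathbb{R}$. Then there exist $C=C(u_0)>0$, $\zeta_*=\zeta_*(u_0)\in\mathbb{R}$ and $r=r(\beta_0)>0$ such that $$\sup_{x\in\mathbb{R}}|u(t,x;t_0,u_0)-u(t,x-\zeta_* )|\le Ce^{-r(t-t_0)}$$ for all $t\ge t_0$.
   Context: Equation. Consider $u_t=J*u-u+f(t,u)$, $(t,x)\in\mathbb{R}\times\mathbb{R}$, where $[J*u](t,x)=\int_{\mathbb{R}}J(x-y)u(t,y)\,dy$. Assumptions on $J$: $J\not\equiv 0$, $J\in C^1(\mathbb{R})$, $J(x)=J(-x)\ge 0$ for all $x$, $\int_{\mathbb{R}}J(x)dx=1$, $\int_{\mathbb{R}}|J'(x)|dx<\infty$, and $\int_{\mathbb{R}}J(x)e^{\lambda x}dx<\infty$ for all $\lambda>0$. Assumptions on $f$: $f:\mathbb{R}\times[0,\infty)\to\mathbb{R}$ is continuously differentiable and (a) there are $\theta\in(0,1)$, $f_{\min}\in C^{1,\gamma}([0,1])$ (for some Hölder exponent $\gamma$) and a Lipschitz function $f_{\max}:[0,1]\to\mathbb{R}$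 with $f_{\min}(w)=f_{\max}(w)=0$ for $w\in[0,\theta]\cup\{1\}$, $0<f_{\min}(w)\le f_{\max}(w)$ for $w\in(\theta,1)$, $f_{\min}'(1)<0$, such that $f_{\min}(w)\le f(t,w)\le f_{\max}(w)$ for $(t,w)\in\mathbb{R}\times[0,1]$; (b) $f(t,w)<0$ for $(t,w)\in\mathbb{R}\times(1,\infty)$; (c) $\sup_{\mathbb{R}\times[0,1]}|f_t|<\infty$ and $\sup_{\mathbb{R}\times[0,\infty)}|f_u|<\infty$; (d) there are $\tilde\theta\in(\theta,1)$ and $\tilde\beta>0$ with $f_u(t,w)\le -\tilde\beta$ for all $(t,w)\in\mathbb{R}\times[\tilde\theta,2]$; moreover $f$ is extended by $f(t,w)=0$ for $(t,w)\in\mathbb{R}\times(-\infty,0)$; (e) $f(t,u)$ is twice continuously differentiable in $u$ and $\sup_{\mathbb{R}\times[0,1]}|f_{uu}|<\infty$. Approximating solutions (known facts). There are a unique $c^*_{\min}>0$ and a unique $C^1$ function $\phi_{\min}:\mathbb{R}\to(0,1)$ with $J*\phi_{\min}-\phi_{\min}+c^*_{\min}\phi_{\min}'+f_{\min}(\phi_{\min})=0$, $\phi_{\min}'<0$, $\phi_{\min}(0)=\theta$, $\phi_{\min}(-\infty)=1$, $\phi_{\min}(\infty)=0$. For each $s<0$ there is a unique $y_s\in\mathbb{R}$ (with $y_s\to-\infty$ as $s\to-\infty$) such that the classical solution $u(t,x;s)$, $t\ge s$, of the equation with $u(s,x;s)=\phi_{\min}(x-y_s)$ satisfies $u(0,0;s)=\theta$.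 Each $u(t,x;s)$ is strictly decreasing in $x$ with $u(t,-\infty;s)=1$, $u(t,\infty;s)=0$; for $\lambda\in(0,1)$ let $X_\lambda(t;s)$ be the point with $u(t,X_\lambda(t;s);s)=\lambda$. There are positive constants $c_{\min},c_{\max},c_\pm,h_\pm$ (independent of $s$) and twice continuously differentiable functions $X(\cdot;s):[s,\infty)\to\mathbb{R}$ such that, for all $s<0$, $t\ge s$: $c_{\min}\le\dot X(t;s)\le c_{\max}$; $\sup_{s<0,t\ge s}|\ddot X(t;s)|<\infty$; $\sup_{s<0,t\ge s}|X(t;s)-X_\lambda(t;s)|<\infty$ for every $\lambda\in(0,1)$; $u(t,x;s)\ge 1-e^{c_-(x-X(t;s)+h_-)}$ for $x\le X(t;s)-h_-$; $u(t,x;s)\le e^{-c_+(x-X(t;s)-h_+)}$ for $x\ge X(t;s)+h_+$. Moreover $u(t,x;s)$ is Lipschitz in $x$ uniformly in $s<0$, $t\ge s$. The transition front. A transition front is an entire solution $u$ with $u(t,-\infty)=1$, $u(t,\infty)=0$ for all $t$ and $\sup_{t\in\mathbb{R}}\mathrm{diam}\{x:\epsilon\le u(t,x)\le 1-\epsilon\}<\infty$ for every $\epsilon\in(0,1)$. Throughout, $u(t,x)$ is the transition front and $X:\mathbb{R}\to\mathbb{R}$ the continuously differentiable function obtained as limits: $X(t;s)\to X(t)$, $u(t,x;s)\to u(t,x)$, $u_t(t,x;s)\to u_t(t,x)$ locally uniformly in $(t,x)\in\mathbb{R}\times\mathbb{R}$ as $s\to-\infty$ along some subsequence. It is known that $u$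 is strictly decreasing in $x$ and Lipschitz in $x$ uniformly in $t$, that $\dot X(t)\in[c_{\min},c_{\max}]$ for all $t\in\mathbb{R}$, and that, for all $t\in\mathbb{R}$, $u(t,x)\ge 1-e^{c_-(x-X(t)+h_-)}$ for $x\le X(t)-h_-$ and $u(t,x)\le e^{-c_+(x-X(t)-h_+)}$ for $x\ge X(t)+h_+$. Further notation. $C^b_{\rm unif}(\mathbb{R},\mathbb{R})$ is the space of bounded uniformly continuous functions on $\mathbb{R}$. For $u_0\in C^b_{\rm unif}(\mathbb{R},\mathbb{R})$, $u(t,x;t_0,u_0)$, $t\ge t_0$, is the unique solution of the equation with $u(t_0,\cdot;t_0,u_0)=u_0$. Here $u_0(-\infty)=\lim_{x\to-\infty}u_0(x)$. The notation $C(u_0)$, $\zeta_*(u_0)$, $r(\beta_0)$ indicates the quantities on which these numbers depend; the constant $C(u_0)$ in the conclusion need not be the constant $C$ in the hypothesis. *)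

theory Defs
  imports "HOL-Analysis.Analysis"
begin

subsection \<open>Standing assumptions\<close>

definition dispersal_kernel :: "(real \<Rightarrow> real) \<Rightarrow> bool" where
  "dispersal_kernel J \<longleftrightarrow>
     (\<exists>x. J x \<noteq> 0) \<and>
     J C1_differentiable_on UNIV \<and>
     (\<forall>x. J x = J (- x) \<and> 0 \<le> J x) \<and>
     has_bochner_integral lborel J 1 \<and>
     integrable lborel (deriv J) \<and>
     (\<forall>\<mu>>0. integrable lborel (\<lambda>x. J x * exp (\<mu> * x)))"

definition C1_holder_on :: "real \<Rightarrow> real set \<Rightarrow> (real \<Rightarrow> real) \<Rightarrow> bool" where
  "C1_holder_on \<gamma> S g \<longleftrightarrow>
     (\<exists>g' L. (\<forall>x\<in>S. (g has_real_derivative g' x) (at x within S)) \<and>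
             (\<forall>x\<in>S. \<forall>y\<in>S. \<bar>g' x - g' y\<bar> \<le> L * \<bar>x - y\<bar> powr \<gamma>))"

text \<open>
  The functions \<open>ft\<close>, \<open>fu\<close>, \<open>fuu\<close> are the derivatives of \<open>f\<close> on \<open>\<real> \<times> [0,\<infinity>)\<close>, one-sided in the
  second variable at \<open>0\<close>. The second derivative is only required to be continuous in \<open>u\<close>, for each
  fixed \<open>t\<close>. The values of \<open>fmin\<close> and \<open>fmax\<close> outside \<open>[0,1]\<close> are irrelevant.
\<close>

definition ignition_nonlinearity ::
  "(real \<Rightarrow> real \<Rightarrow> real) \<Rightarrow> real \<Rightarrow> (real \<Rightarrow> real) \<Rightarrow> bool" where
  "ignition_nonlinearity f \<theta> fmin \<longleftrightarrow>
     0 < \<theta> \<and> \<theta> < 1 \<and>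
     (\<exists>\<gamma>. 0 < \<gamma> \<and> \<gamma> \<le> 1 \<and> C1_holder_on \<gamma> {0..1} fmin) \<and>
     (\<exists>d<0. (fmin has_real_derivative d) (at 1 within {0..1})) \<and>
     (\<exists>fmax L. L-lipschitz_on {0..1} fmax \<and>
        (\<forall>w\<in>{0..\<theta>} \<union> {1}. fmin w = 0 \<and> fmax w = 0) \<and>
        (\<forall>w\<in>{\<theta><..<1}. 0 < fmin w \<and> fmin w \<le> fmax w) \<and>
        (\<forall>t. \<forall>w\<in>{0..1}. fmin w \<le> f t w \<and> f t w \<le> fmax w)) \<and>
     (\<forall>t. \<forall>w>1. f t w < 0) \<and>
     (\<forall>t. \<forall>w<0. f t w = 0) \<and>
     (\<exists>ft fu fuu.
        (\<forall>t. \<forall>w\<ge>0. ((\<lambda>(t, w). f t w) has_derivative (\<lambda>(h, k). ft t w * h + fu t w * k))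
                         (at (t, w) within UNIV \<times> {0..})) \<and>
        continuous_on (UNIV \<times> {0..}) (\<lambda>(t, w). ft t w) \<and>
        continuous_on (UNIV \<times> {0..}) (\<lambda>(t, w). fu t w) \<and>
        bdd_above ((\<lambda>(t, w). \<bar>ft t w\<bar>) ` (UNIV \<times> {0..1})) \<and>
        bdd_above ((\<lambda>(t, w). \<bar>fu t w\<bar>) ` (UNIV \<times> {0..})) \<and>
        (\<exists>\<theta>' \<beta>'. \<theta> < \<theta>' \<and> \<theta>' < 1 \<and> 0 < \<beta>' \<and> (\<forall>t. \<forall>w\<in>{\<theta>'..2}. fu t w \<le> - \<beta>')) \<and>
        (\<forall>t. \<forall>w\<ge>0. (fu t has_real_derivative fuu t w) (at w within {0..})) \<and>
        (\<forall>t. continuous_on {0..} (fuu t)) \<and>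
        bdd_above ((\<lambda>(t, w). \<bar>fuu t w\<bar>) ` (UNIV \<times> {0..1})))"


subsection \<open>The equation and its solutions\<close>

definition conv :: "(real \<Rightarrow> real) \<Rightarrow> (real \<Rightarrow> real) \<Rightarrow> real \<Rightarrow> real" where
  "conv J g x = (\<integral>y. J (x - y) * g y \<partial>lborel)"

definition Cb_unif :: "(real \<Rightarrow> real) set" where
  "Cb_unif = {g. bounded (range g) \<and> uniformly_continuous_on UNIV g}"

text \<open>
  Solutions on a time interval \<open>I\<close> are continuous curves in the space \<open>Cb_unif\<close> with its sup norm
  (continuity being convergence uniform in \<open>x\<close>) that satisfy the equation pointwise. Since the
  right-hand side is then again a continuous curve in \<open>Cb_unif\<close>, such curves are automatically
  \<open>C\<^sup>1\<close> with values in \<open>Cb_unif\<close>. At an endpoint of \<open>I\<close> the time derivative is one-sided.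
\<close>

definition solution_on ::
  "(real \<Rightarrow> real) \<Rightarrow> (real \<Rightarrow> real \<Rightarrow> real) \<Rightarrow> real set \<Rightarrow> (real \<Rightarrow> real \<Rightarrow> real) \<Rightarrow> bool" where
  "solution_on J f I v \<longleftrightarrow>
     (\<forall>t\<in>I. v t \<in> Cb_unif \<and>
        uniform_limit UNIV v (v t) (at t within I) \<and>
        (\<forall>x. ((\<lambda>\<tau>. v \<tau> x) has_real_derivative (conv J (v t) x - v t x + f t (v t x)))
               (at t within I)))"

definition cauchy_solution ::
  "(real \<Rightarrow> real) \<Rightarrow> (real \<Rightarrow> real \<Rightarrow> real) \<Rightarrow> real \<Rightarrow> (real \<Rightarrow> real) \<Rightarrow> (real \<Rightarrow> real \<Rightarrow> real) \<Rightarrow> bool" where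
  "cauchy_solution J f t0 u0 v \<longleftrightarrow> solution_on J f {t0..} v \<and> v t0 = u0"

text \<open>Boundedness is required explicitly because \<open>diameter\<close> is \<open>0\<close> on unbounded sets.\<close>

definition transition_front ::
  "(real \<Rightarrow> real) \<Rightarrow> (real \<Rightarrow> real \<Rightarrow> real) \<Rightarrow> (real \<Rightarrow> real \<Rightarrow> real) \<Rightarrow> bool" where
  "transition_front J f u \<longleftrightarrow>
     solution_on J f UNIV u \<and>
     (\<forall>t. (u t \<longlongrightarrow> 1) at_bot \<and> (u t \<longlongrightarrow> 0) at_top) \<and>
     (\<forall>\<epsilon>\<in>{0<..<1}.
        (\<forall>t. bounded {x. \<epsilon> \<le> u t x \<and> u t x \<le> 1 - \<epsilon>}) \<and>
        bdd_above (range (\<lambda>t. diameter {x. \<epsilon> \<le> u t x \<and> u t x \<le> 1 - \<epsilon>})))"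


subsection \<open>Approximating solutions and the front constructed from them\<close>

definition minimal_wave ::
  "(real \<Rightarrow> real) \<Rightarrow> (real \<Rightarrow> real) \<Rightarrow> real \<Rightarrow> real \<Rightarrow> (real \<Rightarrow> real) \<Rightarrow> bool" where
  "minimal_wave J fmin \<theta> c \<phi> \<longleftrightarrow>
     0 < c \<and>
     \<phi> C1_differentiable_on UNIV \<and>
     range \<phi> \<subseteq> {0<..<1} \<and>
     (\<forall>x. conv J \<phi> x - \<phi> x + c * deriv \<phi> x + fmin (\<phi> x) = 0) \<and>
     (\<forall>x. deriv \<phi> x < 0) \<and>
     \<phi> 0 = \<theta> \<and> (\<phi> \<longlongrightarrow> 1) at_bot \<and> (\<phi> \<longlongrightarrow> 0) at_top"

definition level_point :: "(real \<Rightarrow> real) \<Rightarrow> real \<Rightarrow> real" where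
  "level_point g \<mu> = (THE x. g x = \<mu>)"

definition front_bounds :: "real \<Rightarrow> real \<Rightarrow> real \<Rightarrow> real \<Rightarrow> (real \<Rightarrow> real) \<Rightarrow> real \<Rightarrow> bool" where
  "front_bounds cm cp hm hp g \<xi> \<longleftrightarrow>
     (\<forall>x. x \<le> \<xi> - hm \<longrightarrow> g x \<ge> 1 - exp (cm * (x - \<xi> + hm))) \<and>
     (\<forall>x. x \<ge> \<xi> + hp \<longrightarrow> g x \<le> exp (- cp * (x - \<xi> - hp)))"

text \<open>
  \<open>us s t x\<close> is \<open>u(t,x;s)\<close> and \<open>Xs s t\<close> is \<open>X(t;s)\<close>; only their values for \<open>s < 0\<close> and \<open>t \<ge> s\<close> matter.
  The parameters \<open>cm\<close>, \<open>cp\<close>, \<open>hm\<close>, \<open>hp\<close> stand for \<open>c\<^sub>-\<close>, \<open>c\<^sub>+\<close>, \<open>h\<^sub>-\<close>, \<open>h\<^sub>+\<close>.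
\<close>

definition approximating_solutions ::
  "(real \<Rightarrow> real) \<Rightarrow> (real \<Rightarrow> real \<Rightarrow> real) \<Rightarrow> real \<Rightarrow> (real \<Rightarrow> real) \<Rightarrow>
   real \<Rightarrow> real \<Rightarrow> real \<Rightarrow> real \<Rightarrow> real \<Rightarrow> real \<Rightarrow>
   (real \<Rightarrow> real \<Rightarrow> real \<Rightarrow> real) \<Rightarrow> (real \<Rightarrow> real \<Rightarrow> real) \<Rightarrow> bool" where
  "approximating_solutions J f \<theta> \<phi> cmin cmax cm cp hm hp us Xs \<longleftrightarrow>
     (\<exists>y. filterlim y at_bot at_bot \<and>
          (\<forall>s<0. cauchy_solution J f s (\<lambda>x. \<phi> (x - y s)) (us s) \<and> us s 0 0 = \<theta>)) \<and>
     (\<forall>s<0. \<forall>t\<ge>s. (\<forall>x x'. x < x' \<longrightarrow> us s t x' < us s t x) \<and>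
                    (us s t \<longlongrightarrow> 1) at_bot \<and> (us s t \<longlongrightarrow> 0) at_top) \<and>
     (\<exists>L. \<forall>s<0. \<forall>t\<ge>s. L-lipschitz_on UNIV (us s t)) \<and>
     0 < cmin \<and> 0 < cmax \<and> 0 < cm \<and> 0 < cp \<and> 0 < hm \<and> 0 < hp \<and>
     (\<exists>dX ddX.
        (\<forall>s<0. continuous_on {s..} (ddX s) \<and>
           (\<forall>t\<ge>s. (Xs s has_real_derivative dX s t) (at t within {s..}) \<and>
                   (dX s has_real_derivative ddX s t) (at t within {s..}) \<and>
                   cmin \<le> dX s t \<and> dX s t \<le> cmax)) \<and>
        bdd_above {\<bar>ddX s t\<bar> |s t. s < 0 \<and> s \<le> t}) \<and>
     (\<forall>\<mu>\<in>{0<..<1}. bdd_above {\<bar>Xs s t - level_point (us s t) \<mu>\<bar> |s t. s < 0 \<and> s \<le> t}) \<and>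
     (\<forall>s<0. \<forall>t\<ge>s. front_bounds cm cp hm hp (us s t) (Xs s t))"

text \<open>
  The pair \<open>(u, X)\<close> is a locally uniform limit of \<open>u(\<cdot>,\<cdot>;s)\<close> and \<open>X(\<cdot>;s)\<close> along a sequence \<open>\<sigma>\<close> of
  starting times tending to \<open>-\<infinity>\<close>, together with the properties it inherits.
\<close>

definition constructed_front ::
  "(real \<Rightarrow> real) \<Rightarrow> (real \<Rightarrow> real \<Rightarrow> real) \<Rightarrow> real \<Rightarrow> (real \<Rightarrow> real) \<Rightarrow>
   (real \<Rightarrow> real \<Rightarrow> real) \<Rightarrow> (real \<Rightarrow> real) \<Rightarrow> bool" where
  "constructed_front J f \<theta> fmin u X \<longleftrightarrow>
     (\<exists>c \<phi> cmin cmax cm cp hm hp us Xs \<sigma>.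
        minimal_wave J fmin \<theta> c \<phi> \<and>
        approximating_solutions J f \<theta> \<phi> cmin cmax cm cp hm hp us Xs \<and>
        (\<forall>n::nat. \<sigma> n < 0) \<and> filterlim \<sigma> at_bot sequentially \<and>
        (\<forall>K. compact K \<longrightarrow> uniform_limit K (\<lambda>n. Xs (\<sigma> n)) X sequentially) \<and>
        (\<forall>K. compact K \<longrightarrow>
           uniform_limit K (\<lambda>n (t, x). us (\<sigma> n) t x) (\<lambda>(t, x). u t x) sequentially) \<and>
        (\<forall>K. compact K \<longrightarrow>
           uniform_limit K (\<lambda>n (t, x). deriv (\<lambda>\<tau>. us (\<sigma> n) \<tau> x) t)
             (\<lambda>(t, x). deriv (\<lambda>\<tau>. u \<tau> x) t) sequentially) \<and>
        transition_front J f u \<and>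
        (\<forall>t x x'. x < x' \<longrightarrow> u t x' < u t x) \<and>
        (\<exists>L. \<forall>t. L-lipschitz_on UNIV (u t)) \<and>
        X C1_differentiable_on UNIV \<and>
        (\<forall>t. deriv X t \<in> {cmin..cmax}) \<and>
        (\<forall>t. front_bounds cm cp hm hp (u t) (X t)))"

end

theory Submission
  imports Defs
begin

text \<open>
  Shifts \<open>u(t, x - b)\<close> of the front are again solutions, and up to a small error any solution starting
  close to the front stays between two of them. The proof shows that the distance between these two
  shifts contracts geometrically.

  The bounds have the form \<open>u(t, x - b) \<plusminus> q exp (- \<omega> t) \<Gamma>(x - X t - b)\<close> with the weight
  \<open>\<Gamma>(y) = min 1 (exp (- \<beta> y))\<close>. Far behind the front the error decays because \<open>f\<close> is strictly decreasing
  near \<open>1\<close>. Far ahead of it \<open>f\<close> vanishes, and the error decays because the front moves with speed at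
  least \<open>cmin\<close> through an exponential profile which dispersal, its kernel being symmetric, broadens
  only to second order in \<open>\<beta>\<close>. In the transition zone nothing decays; there the error is paid for by
  letting \<open>b\<close> drift, by at most \<open>A q\<close> altogether. This works because the front is uniformly steep in
  every window of bounded width around \<open>X t\<close> (\<open>front_steepness\<close>), and gives \<open>margin_supersol\<close>.

  For the contraction, let the solution lie between the shifts by \<open>a \<le> b\<close>. Near \<open>X t + a\<close> the two
  bounds differ by a multiple of \<open>b - a\<close>, so one of them is that far from the solution on average. By
  positivity of the nonlocal diffusion this average turns, after a fixed time, into a pointwise gap on
  an arbitrarily large window (\<open>spreading_radius_exists\<close>), so this bound can be shifted inwards by some
  \<open>\<delta> (b - a)\<close> there. Outside the window the shift costs little, because increments of the front decay
  like \<open>exp (- \<eta> \<bar>x - X t\<bar>)\<close> with \<open>\<eta> = 2 \<beta>\<close> (\<open>front_increment_decay\<close>): on a large window the cost is a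
  small fraction of \<open>\<delta> (b - a)\<close> times the weight, which is absorbed into \<open>q\<close>. Hence
  \<open>b - a + 8 A q\<close> shrinks by a fixed factor (\<open>squeeze_step\<close>), and the intervals nest.

  The contraction factor depends only on an upper bound for \<open>b - a\<close>. A first stage, whose length depends on the
  initial datum, brings the gap below \<open>1\<close>; from then on the rate is determined by \<open>\<beta>0\<close> and the data of
  the equation and the front.

  Since the front is only known to be Lipschitz in \<open>x\<close>, the moving bounds are not differentiable in time.
  All differential inequalities are therefore stated with the lower right Dini derivative.
\<close>

section \<open>Lower right Dini derivatives\<close>

definition dini_ge :: "(real \<Rightarrow> real) \<Rightarrow> real \<Rightarrow> real \<Rightarrow> bool" where
  "dini_ge g t c \<longleftrightarrow> (\<forall>e>0. \<forall>\<^sub>F s in at_right t. g s - g t \<ge> (c - e) * (s - t))"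

lemma dini_ge_mono: "dini_ge g t c \<Longrightarrow> c' \<le> c \<Longrightarrow> dini_ge g t c'"
  unfolding dini_ge_def
proof (intro allI impI)
  fix e :: real
  assume a: "\<forall>e>0. \<forall>\<^sub>F s in at_right t. (c - e) * (s - t) \<le> g s - g t" "c' \<le> c" "0 < e"
  have "\<forall>\<^sub>F s in at_right t. s > t" by (simp add: eventually_at_right_less)
  with a(1)[rule_format, OF a(3)]
  show "\<forall>\<^sub>F s in at_right t. (c' - e) * (s - t) \<le> g s - g t"
  proof eventually_elim
    case (elim s)
    have "(c' - e) * (s - t) \<le> (c - e) * (s - t)" using elim(2) a(2) by (intro mult_right_mono) auto
    then show ?case using elim(1) by linarith
  qed
qed

lemma dini_ge_add:
  assumes "dini_ge g t c" "dini_ge k t d"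
  shows "dini_ge (\<lambda>s. g s + k s) t (c + d)"
  unfolding dini_ge_def
proof (intro allI impI)
  fix e :: real assume "0 < e"
  then have "\<forall>\<^sub>F s in at_right t. g s - g t \<ge> (c - e/2) * (s - t)"
    "\<forall>\<^sub>F s in at_right t. k s - k t \<ge> (d - e/2) * (s - t)"
    using assms unfolding dini_ge_def by (meson half_gt_zero)+
  then show "\<forall>\<^sub>F s in at_right t. (c + d - e) * (s - t) \<le> g s + k s - (g t + k t)"
  proof eventually_elim
    case (elim s)
    have "(c + d - e) * (s - t) = (c - e/2) * (s - t) + (d - e/2) * (s - t)" by algebra
    then show ?case using elim by linarith
  qed
qed

lemma dini_ge_scale:
  assumes "dini_ge g t c" "0 \<le> k" shows "dini_ge (\<lambda>s. k * g s) t (k * c)"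
  unfolding dini_ge_def
proof (intro allI impI)
  fix e :: real assume e: "0 < e"
  have "\<forall>\<^sub>F s in at_right t. s > t" by (simp add: eventually_at_right_less)
  moreover have "\<forall>\<^sub>F s in at_right t. g s - g t \<ge> (c - e / (k + 1)) * (s - t)"
    using assms e unfolding dini_ge_def by (auto simp: add_nonneg_pos)
  ultimately show "\<forall>\<^sub>F s in at_right t. (k * c - e) * (s - t) \<le> k * g s - k * g t"
  proof eventually_elim
    case (elim s)
    have "k * (e / (k + 1)) \<le> e" using assms(2) e by (simp add: field_simps)
    then have "(k * c - e) * (s - t) \<le> (k * c - k * (e / (k + 1))) * (s - t)"
      using elim(1) by (intro mult_right_mono) auto
    also have "\<dots> = k * ((c - e / (k + 1)) * (s - t))" by (simp add: algebra_simps)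
    also have "\<dots> \<le> k * (g s - g t)" using elim(2) assms(2) by (rule mult_left_mono)
    finally show ?case by (simp add: right_diff_distrib)
  qed
qed

text \<open>Turns monotonicity of the front along a moving shift, where no derivative exists, into a Dini bound.\<close>

lemma dini_ge_increment_mono:
  assumes "dini_ge k t c" "\<forall>\<^sub>F s in at_right t. g s - g t \<ge> k s - k t"
  shows "dini_ge g t c"
  unfolding dini_ge_def
proof (intro allI impI)
  fix e :: real assume "0 < e"
  then have "\<forall>\<^sub>F s in at_right t. k s - k t \<ge> (c - e) * (s - t)"
    using assms(1) unfolding dini_ge_def by blast
  with assms(2) show "\<forall>\<^sub>F s in at_right t. g s - g t \<ge> (c - e) * (s - t)"
    by eventually_elim auto
qed

lemma dini_ge_derivative:
  assumes "(g has_real_derivative c) (at t within {a..})" "a \<le> t"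
  shows "dini_ge g t c"
  unfolding dini_ge_def
proof (intro allI impI)
  fix e :: real assume e: "0 < e"
  have "at_right t \<le> at t within {a..}" using assms(2) by (intro at_le) auto
  then have "((\<lambda>s. (g s - g t) / (s - t)) \<longlongrightarrow> c) (at_right t)"
    using assms(1) unfolding has_field_derivative_iff by (rule tendsto_mono)
  then have "\<forall>\<^sub>F s in at_right t. (g s - g t) / (s - t) > c - e"
    using e by (intro order_tendstoD(1)) auto
  moreover have "\<forall>\<^sub>F s in at_right t. s > t" by (simp add: eventually_at_right_less)
  ultimately show "\<forall>\<^sub>F s in at_right t. (c - e) * (s - t) \<le> g s - g t"
    by eventually_elim (auto simp: field_simps)
qed

text \<open>
  The mean value inequality. With a slightly smaller slope, the last time at which the claimed linear
  lower bound holds would have later such times right after it.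
\<close>

lemma dini_ge_growth:
  assumes cont: "continuous_on {a..b} g" and "a \<le> b"
    and D: "\<And>t. a \<le> t \<Longrightarrow> t < b \<Longrightarrow> dini_ge g t c"
  shows "g a + c * (b - a) \<le> g b"
proof (rule ccontr)
  assume neg: "\<not> ?thesis"
  then have "a < b" using \<open>a \<le> b\<close> by (cases "a = b") auto
  define e where "e = (g a + c * (b - a) - g b) / (2 * (b - a))"
  have e: "e > 0" using neg \<open>a < b\<close> by (simp add: e_def)
  define k where "k s = g s - g a - (c - e) * (s - a)" for s
  have contk: "continuous_on {a..b} k" unfolding k_def by (intro continuous_intros cont)
  have "e * (b - a) = (g a + c * (b - a) - g b) / 2" using \<open>a < b\<close> by (simp add: e_def field_simps)
  then have kb: "k b < 0" using neg by (simp add: k_def algebra_simps)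
  define S where "S = {t \<in> {a..b}. 0 \<le> k t}"
  have "closed S" unfolding S_def
    by (intro continuous_on_closed_Collect_le continuous_intros contk closed_atLeastAtMost)
  moreover have "S \<noteq> {}" "bdd_above S" using \<open>a \<le> b\<close> by (auto simp: S_def k_def intro!: bdd_aboveI[of _ b] exI[of _ a])
  ultimately have tS: "Sup S \<in> S" by (intro closed_contains_Sup)
  define t where "t = Sup S"
  have t: "a \<le> t" "t \<le> b" "0 \<le> k t" using tS by (auto simp: S_def t_def)
  then have "t < b" using kb by (cases "t = b") auto
  have "\<forall>\<^sub>F s in at_right t. g s - g t \<ge> (c - e) * (s - t)"
    using D[OF t(1) \<open>t < b\<close>] e unfolding dini_ge_def by blast
  moreover have "\<forall>\<^sub>F s in at_right t. s \<in> {t<..<b}" using \<open>t < b\<close> by (rule eventually_at_right_real)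
  ultimately have "\<forall>\<^sub>F s in at_right t. s \<in> S \<and> s > t"
    by eventually_elim (use t in \<open>auto simp: S_def k_def algebra_simps\<close>)
  then obtain s where "s \<in> S" "s > t"
    using eventually_happens trivial_limit_at_right_real by blast
  then show False using cSup_upper[OF _ \<open>bdd_above S\<close>, of s] by (auto simp: t_def)
qed

text \<open>
  The truncation \<open>min g 0\<close> satisfies the derivative bound at all times, since it is locally constant
  wherever \<open>g > 0\<close>. Having to control \<open>g\<close> only where it is nonpositive is what lets barriers be
  compared outside a window in which they dominate trivially.
\<close>

lemma dini_ge_lower_bound:
  assumes cont: "continuous_on {a..b} g" and "a \<le> b" "0 \<le> g a" "0 \<le> c"
    and D: "\<And>t. a \<le> t \<Longrightarrow> t < b \<Longrightarrow> g t \<le> 0 \<Longrightarrow> dini_ge g t (- c)"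
  shows "- c * (b - a) \<le> g b"
proof -
  have "dini_ge (\<lambda>s. min (g s) 0) t (- c)" if t: "a \<le> t" "t < b" for t
  proof (cases "g t \<le> 0")
    case True
    show ?thesis unfolding dini_ge_def
    proof (intro allI impI)
      fix e :: real assume e: "0 < e"
      have "\<forall>\<^sub>F s in at_right t. g s - g t \<ge> (- c - e) * (s - t)"
        using D[OF t True] e unfolding dini_ge_def by blast
      moreover have "\<forall>\<^sub>F s in at_right t. s > t" by (simp add: eventually_at_right_less)
      ultimately show "\<forall>\<^sub>F s in at_right t. (- c - e) * (s - t) \<le> min (g s) 0 - min (g t) 0"
      proof eventually_elim
        case (elim s)
        have "(- c - e) * (s - t) \<le> 0" using elim(2) \<open>0 \<le> c\<close> e by (intro mult_nonpos_nonneg) auto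
        then show ?case using elim(1) True by (auto simp: min_def)
      qed
    qed
  next
    case False
    have "(g \<longlongrightarrow> g t) (at_right t)"
    proof -
      have "(g \<longlongrightarrow> g t) (at t within {a..b})" using cont t by (auto simp: continuous_on_def)
      then have "(g \<longlongrightarrow> g t) (at t within {t..b})" by (rule tendsto_within_subset) (use t in auto)
      then show ?thesis using \<open>t < b\<close> by (simp add: at_within_Icc_at_right)
    qed
    then have "\<forall>\<^sub>F s in at_right t. g s > 0" using False by (intro order_tendstoD(1)) auto
    then have *: "\<forall>\<^sub>F s in at_right t. min (g s) 0 - min (g t) 0 \<ge> (\<lambda>_. 0) s - (\<lambda>_. 0::real) t"
      by eventually_elim (use False in auto)
    have "dini_ge (\<lambda>_. 0) t 0" by (intro dini_ge_derivative[of _ _ _ t]) auto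
    then show ?thesis using dini_ge_increment_mono[OF _ *] dini_ge_mono \<open>0 \<le> c\<close> by fastforce
  qed
  then have "min (g a) 0 + (- c) * (b - a) \<le> min (g b) 0"
    using \<open>a \<le> b\<close> by (intro dini_ge_growth) (auto intro!: continuous_intros cont)
  then show ?thesis using \<open>0 \<le> g a\<close> by auto
qed

section \<open>The dispersal kernel\<close>

text \<open>A form of Taylor's bound that is integrable against the kernel.\<close>

lemma exp_second_order: "exp s - 1 - s \<le> s\<^sup>2 * exp \<bar>s\<bar>" for s :: real
proof -
  obtain t where t: "\<bar>t\<bar> \<le> \<bar>s\<bar>" "exp s = (\<Sum>m<2. s ^ m / fact m) + exp t / fact 2 * s ^ 2"
    using Maclaurin_exp_le[of s 2] by auto
  have "exp t / fact 2 * s ^ 2 \<le> exp \<bar>s\<bar> * s\<^sup>2"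
  proof (intro mult_right_mono)
    have "exp t \<le> exp \<bar>s\<bar>" using t(1) by auto
    then show "exp t / fact 2 \<le> exp \<bar>s\<bar>" using exp_ge_zero[of "\<bar>s\<bar>"] unfolding fact_2 by linarith
  qed auto
  then show ?thesis using t(2) by (simp add: numeral_2_eq_2 mult.commute)
qed

locale kernel =
  fixes J :: "real \<Rightarrow> real"
  assumes J_cont: "continuous_on UNIV J"
    and J_nonneg: "0 \<le> J x"
    and J_sym: "J (- x) = J x"
    and J_mass: "has_bochner_integral lborel J 1"
    and J_exp: "0 < \<mu> \<Longrightarrow> integrable lborel (\<lambda>x. J x * exp (\<mu> * x))"
begin

text \<open>Bounded continuous functions: continuity gives measurability, boundedness integrability against \<open>J\<close>.\<close>

definition bcont :: "(real \<Rightarrow> real) \<Rightarrow> bool" where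
  "bcont g \<longleftrightarrow> continuous_on UNIV g \<and> bounded (range g)"

lemma bcontI: "continuous_on UNIV g \<Longrightarrow> (\<And>x. \<bar>g x\<bar> \<le> B) \<Longrightarrow> bcont g"
  unfolding bcont_def by (auto intro!: boundedI[of _ B])

lemma bcont_const: "bcont (\<lambda>x. c)"
  by (rule bcontI[of _ "\<bar>c\<bar>"]) auto

lemma bcont_add: "bcont g \<Longrightarrow> bcont h \<Longrightarrow> bcont (\<lambda>x. g x + h x)"
  unfolding bcont_def by (auto intro!: continuous_intros bounded_plus_comp)

lemma bcont_diff: "bcont g \<Longrightarrow> bcont h \<Longrightarrow> bcont (\<lambda>x. g x - h x)"
  unfolding bcont_def by (auto intro!: continuous_intros bounded_minus_comp)

lemma bcont_scale: "bcont g \<Longrightarrow> bcont (\<lambda>x. c * g x)"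
  unfolding bcont_def bounded_iff
  by (auto intro!: continuous_intros simp: abs_mult) (metis abs_ge_zero mult_left_mono)

lemma bcont_shift: "bcont g \<Longrightarrow> bcont (\<lambda>x. g (x + a))"
  unfolding bcont_def
  by (auto intro!: continuous_on_compose2[of UNIV g] continuous_intros elim: bounded_subset)

lemma J_integrable: "integrable lborel J"
  using J_mass by (simp add: has_bochner_integral_iff)

lemma J_integral: "(\<integral>w. J w \<partial>lborel) = 1"
  using J_mass by (simp add: has_bochner_integral_iff)

lemma conv_alt: "conv J g x = (\<integral>w. J w * g (x - w) \<partial>lborel)"
  unfolding conv_def
  by (subst lborel_integral_real_affine[where c="-1" and t=x]) auto

lemma conv_shift: "conv J (\<lambda>x. g (x + a)) x = conv J g (x + a)"
  unfolding conv_alt by (simp add: algebra_simps)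

lemma J_bcont_integrable:
  assumes "bcont g" shows "integrable lborel (\<lambda>w. J w * g (x - w))"
proof -
  obtain B where B: "\<And>y. \<bar>g y\<bar> \<le> B" using assms by (auto simp: bcont_def bounded_iff)
  have "continuous_on UNIV (\<lambda>w. g (x - w))" using assms
    by (auto simp: bcont_def intro!: continuous_on_compose2[of UNIV g] continuous_intros)
  then have m: "(\<lambda>w. g (x - w)) \<in> borel_measurable lborel"
    using borel_measurable_continuous_onI by simp
  show ?thesis
  proof (rule Bochner_Integration.integrable_bound)
    show "integrable lborel (\<lambda>w. B * J w)" using J_integrable by simp
    show "(\<lambda>w. J w * g (x - w)) \<in> borel_measurable lborel"
      using m J_integrable by (intro borel_measurable_times) auto
    show "AE w in lborel. norm (J w * g (x - w)) \<le> norm (B * J w)"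
    proof (intro AE_I2)
      fix w
      have "B \<ge> 0" using B[of 0] by linarith
      then show "norm (J w * g (x - w)) \<le> norm (B * J w)"
        using mult_left_mono[OF B[of "x - w"] J_nonneg[of w]] J_nonneg[of w]
        by (simp add: abs_mult mult.commute)
    qed
  qed
qed

lemma conv_add: "bcont g \<Longrightarrow> bcont h \<Longrightarrow> conv J (\<lambda>x. g x + h x) x = conv J g x + conv J h x"
  unfolding conv_alt
  by (subst Bochner_Integration.integral_add[symmetric])
    (auto intro: J_bcont_integrable simp: algebra_simps)

lemma conv_diff: "bcont g \<Longrightarrow> bcont h \<Longrightarrow> conv J (\<lambda>x. g x - h x) x = conv J g x - conv J h x"
  unfolding conv_alt
  by (subst Bochner_Integration.integral_diff[symmetric])
    (auto intro: J_bcont_integrable simp: algebra_simps)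

lemma conv_scale: "conv J (\<lambda>x. c * g x) x = c * conv J g x"
proof -
  have "conv J (\<lambda>x. c * g x) x = (\<integral>w. c * (J w * g (x - w)) \<partial>lborel)"
    unfolding conv_alt by (simp add: mult_ac)
  then show ?thesis unfolding conv_alt by simp
qed

lemma conv_ge_const:
  assumes "bcont g" "\<And>y. c \<le> g y" shows "c \<le> conv J g x"
proof -
  have "(\<integral>w. J w * c \<partial>lborel) \<le> conv J g x" unfolding conv_alt
    using J_integrable
    by (intro integral_mono J_bcont_integrable assms(1) mult_left_mono assms(2) J_nonneg bcont_const)
  then show ?thesis using J_integral by simp
qed

lemma conv_le_const:
  assumes "bcont g" "\<And>y. g y \<le> c" shows "conv J g x \<le> c"
proof -
  have "(\<integral>w. J w * c \<partial>lborel) \<ge> conv J g x" unfolding conv_alt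
    using J_integrable
    by (intro integral_mono J_bcont_integrable assms(1) mult_left_mono assms(2) J_nonneg bcont_const)
  then show ?thesis using J_integral by simp
qed

lemma J_exp': "integrable lborel (\<lambda>x. J x * exp (\<mu> * x))"
proof -
  consider "\<mu> > 0" | "\<mu> = 0" | "\<mu> < 0" by linarith
  then show ?thesis
  proof cases
    case 1 then show ?thesis by (rule J_exp)
  next
    case 2 then show ?thesis using J_integrable by simp
  next
    case 3
    then have "integrable lborel (\<lambda>x. J (0 + (-1) * x) * exp (- \<mu> * (0 + (-1) * x)))"
      using lborel_integrable_real_affine[OF J_exp[of "- \<mu>"], of "-1" 0] by simp
    then show ?thesis by (simp add: J_sym)
  qed
qed

definition laplace :: "real \<Rightarrow> real" where
  "laplace \<mu> = (\<integral>w. J w * exp (\<mu> * w) \<partial>lborel)"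

lemma laplace_minus: "laplace (- \<mu>) = laplace \<mu>"
  unfolding laplace_def
  by (subst lborel_integral_real_affine[where c="-1" and t=0]) (auto simp: J_sym)

lemma conv_le_exp:
  assumes "bcont g" "\<And>y. g y \<le> exp (\<mu> * (y - p))" shows "conv J g x \<le> laplace \<mu> * exp (\<mu> * (x - p))"
proof -
  have eq: "J w * exp (\<mu> * (x - w - p)) = exp (\<mu> * (x - p)) * (J w * exp (- \<mu> * w))" for w
    by (simp add: exp_add[symmetric] mult_ac) (simp add: algebra_simps exp_add[symmetric])
  have "conv J g x \<le> (\<integral>w. J w * exp (\<mu> * (x - w - p)) \<partial>lborel)" unfolding conv_alt
  proof (rule integral_mono)
    show "integrable lborel (\<lambda>w. J w * g (x - w))" by (rule J_bcont_integrable[OF assms(1)])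
    show "integrable lborel (\<lambda>w. J w * exp (\<mu> * (x - w - p)))"
      unfolding eq using J_exp'[of "- \<mu>"] by simp
  qed (auto intro!: mult_left_mono assms J_nonneg)
  also have "\<dots> = exp (\<mu> * (x - p)) * laplace (- \<mu>)" unfolding eq laplace_def by simp
  finally show ?thesis by (simp add: laplace_minus mult.commute)
qed

text \<open>
  By symmetry the first-order term of the Laplace transform at \<open>0\<close> vanishes, so for small \<open>\<mu>\<close> dispersal
  broadens the profile \<open>exp (- \<mu> x)\<close> by less than its translation with positive speed raises it.
\<close>

lemma laplace_quadratic: "\<exists>D\<ge>0. \<forall>\<mu>. 0 \<le> \<mu> \<longrightarrow> \<mu> \<le> 1 \<longrightarrow> laplace \<mu> \<le> 1 + D * \<mu>\<^sup>2"
proof -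
  define H where "H w = 2 * (J w * exp (2 * w) + J w * exp (- 2 * w))" for w
  have Hi: "integrable lborel H" unfolding H_def
    using J_exp'[of 2] J_exp'[of "-2"] by auto
  define D where "D = (\<integral>w. H w \<partial>lborel)"
  have D0: "D \<ge> 0" unfolding D_def H_def by (intro integral_nonneg_AE) (auto simp: J_nonneg)
  have bd: "(\<mu> * w)\<^sup>2 * exp \<bar>\<mu> * w\<bar> \<le> \<mu>\<^sup>2 * (2 * (exp (2 * w) + exp (- 2 * w)))"
    if "0 \<le> \<mu>" "\<mu> \<le> 1" for \<mu> w :: real
  proof -
    have "1 + \<bar>w\<bar> + \<bar>w\<bar>\<^sup>2 / 2 \<le> exp \<bar>w\<bar>" by (rule exp_lower_Taylor_quadratic) auto
    then have "w\<^sup>2 \<le> 2 * exp \<bar>w\<bar>" by simp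
    moreover have "exp \<bar>\<mu> * w\<bar> \<le> exp \<bar>w\<bar>" using that by (auto simp: abs_mult mult_left_le_one_le)
    ultimately have "w\<^sup>2 * exp \<bar>\<mu> * w\<bar> \<le> (2 * exp \<bar>w\<bar>) * exp \<bar>w\<bar>" by (intro mult_mono) auto
    also have "\<dots> = 2 * exp (2 * \<bar>w\<bar>)" by (simp add: exp_add[symmetric])
    also have "\<dots> \<le> 2 * (exp (2 * w) + exp (- 2 * w))" by (cases "w \<ge> 0") auto
    finally have "\<mu>\<^sup>2 * (w\<^sup>2 * exp \<bar>\<mu> * w\<bar>) \<le> \<mu>\<^sup>2 * (2 * (exp (2 * w) + exp (- 2 * w)))"
      by (intro mult_left_mono) auto
    then show ?thesis by (simp only: power_mult_distrib mult.assoc)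
  qed
  have "laplace \<mu> \<le> 1 + D * \<mu>\<^sup>2" if m: "0 \<le> \<mu>" "\<mu> \<le> 1" for \<mu>
  proof -
    have i: "integrable lborel (\<lambda>w. J w * exp (\<mu> * w))" "integrable lborel (\<lambda>w. J w * exp (- \<mu> * w))"
      using J_exp'[of \<mu>] J_exp'[of "- \<mu>"] by auto
    have "2 * laplace \<mu> = laplace \<mu> + laplace (- \<mu>)" by (simp add: laplace_minus)
    also have "\<dots> = (\<integral>w. J w * exp (\<mu> * w) + J w * exp (- \<mu> * w) \<partial>lborel)"
      unfolding laplace_def using i by simp
    also have "\<dots> \<le> (\<integral>w. 2 * J w + 2 * \<mu>\<^sup>2 * H w \<partial>lborel)"
    proof (rule integral_mono)
      show "integrable lborel (\<lambda>w. J w * exp (\<mu> * w) + J w * exp (- \<mu> * w))" using i by simp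
      show "integrable lborel (\<lambda>w. 2 * J w + 2 * \<mu>\<^sup>2 * H w)" using J_integrable Hi by simp
      fix w
      have "exp (\<mu> * w) \<le> 1 + \<mu> * w + \<mu>\<^sup>2 * (2 * (exp (2 * w) + exp (- 2 * w)))"
        using exp_second_order[of "\<mu> * w"] bd[OF m, of w] by linarith
      moreover have "exp (- \<mu> * w) \<le> 1 - \<mu> * w + \<mu>\<^sup>2 * (2 * (exp (2 * w) + exp (- 2 * w)))"
        using exp_second_order[of "- \<mu> * w"] bd[OF m, of "- w"] by (simp add: add.commute)
      ultimately have "exp (\<mu> * w) + exp (- \<mu> * w) \<le> 2 + 2 * \<mu>\<^sup>2 * (2 * (exp (2 * w) + exp (- 2 * w)))"
        by linarith
      then show "J w * exp (\<mu> * w) + J w * exp (- \<mu> * w) \<le> 2 * J w + 2 * \<mu>\<^sup>2 * H w"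
        using mult_left_mono[OF _ J_nonneg[of w]] by (fastforce simp: H_def algebra_simps)
    qed
    also have "\<dots> = 2 + 2 * \<mu>\<^sup>2 * D" using J_integrable Hi J_integral by (simp add: D_def)
    finally show ?thesis by (simp add: mult.commute)
  qed
  then show ?thesis using D0 by blast
qed

lemma J_bump: "\<exists>x0 \<rho> \<epsilon>. 0 < \<rho> \<and> 0 < \<epsilon> \<and> (\<forall>y. \<bar>y - x0\<bar> \<le> 2 * \<rho> \<longrightarrow> \<epsilon> \<le> J y)"
proof -
  obtain x0 where "J x0 \<noteq> 0"
    using J_integral by (metis (mono_tags, lifting) Bochner_Integration.integral_cong integral_zero zero_neq_one)
  then have p: "J x0 > 0" using J_nonneg[of x0] by simp
  have "isCont J x0" using J_cont by (simp add: continuous_on_eq_continuous_at)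
  then obtain d where d: "d > 0" "\<And>y. dist y x0 < d \<Longrightarrow> dist (J y) (J x0) < J x0 / 2"
    using p unfolding continuous_at_eps_delta by (metis half_gt_zero)
  show ?thesis
  proof (rule exI[of _ x0], rule exI[of _ "d/4"], rule exI[of _ "J x0 / 2"], intro conjI allI impI)
    fix y assume "\<bar>y - x0\<bar> \<le> 2 * (d / 4)"
    then have "dist (J y) (J x0) < J x0 / 2" using d by (intro d(2)) (auto simp: dist_real_def)
    then show "J x0 / 2 \<le> J y" unfolding dist_real_def by linarith
  qed (use d p in auto)
qed

end

section \<open>Comparison and spreading for the linear inequality\<close>

context kernel begin

text \<open>
  The regularity of a function on \<open>[a, b] \<times> \<real>\<close> under which comparison holds; the essential part is
  the bound uniform in \<open>x\<close>, since on the unbounded line no minimum need be attained.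
\<close>

definition strip :: "(real \<Rightarrow> real \<Rightarrow> real) \<Rightarrow> real \<Rightarrow> real \<Rightarrow> bool" where
  "strip z a b \<longleftrightarrow> (\<forall>t\<in>{a..b}. bcont (z t)) \<and> (\<forall>x. continuous_on {a..b} (\<lambda>t. z t x)) \<and>
     (\<exists>B. \<forall>t\<in>{a..b}. \<forall>x. \<bar>z t x\<bar> \<le> B)"

lemma stripI:
  "(\<And>t. a \<le> t \<Longrightarrow> t \<le> b \<Longrightarrow> bcont (z t)) \<Longrightarrow> (\<And>x. continuous_on {a..b} (\<lambda>t. z t x)) \<Longrightarrow>
    (\<And>t x. a \<le> t \<Longrightarrow> t \<le> b \<Longrightarrow> \<bar>z t x\<bar> \<le> B) \<Longrightarrow> strip z a b"
  unfolding strip_def by (meson atLeastAtMost_iff)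

lemma stripD:
  assumes "strip z a b"
  shows "\<And>t. a \<le> t \<Longrightarrow> t \<le> b \<Longrightarrow> bcont (z t)" "\<And>x. continuous_on {a..b} (\<lambda>t. z t x)"
    "\<exists>B. \<forall>t x. a \<le> t \<longrightarrow> t \<le> b \<longrightarrow> \<bar>z t x\<bar> \<le> B"
  using assms unfolding strip_def by (meson atLeastAtMost_iff)+

lemma strip_subset: "strip z a b \<Longrightarrow> a \<le> a' \<Longrightarrow> b' \<le> b \<Longrightarrow> strip z a' b'"
  unfolding strip_def by (fastforce intro: continuous_on_subset)

lemma strip_add:
  assumes "strip z a b" "strip w a b" shows "strip (\<lambda>t x. z t x + w t x) a b"
proof -
  obtain B C where "\<And>t x. a \<le> t \<Longrightarrow> t \<le> b \<Longrightarrow> \<bar>z t x\<bar> \<le> B"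
    "\<And>t x. a \<le> t \<Longrightarrow> t \<le> b \<Longrightarrow> \<bar>w t x\<bar> \<le> C"
    using stripD(3)[OF assms(1)] stripD(3)[OF assms(2)] by blast
  then have "\<bar>z t x + w t x\<bar> \<le> B + C" if "a \<le> t" "t \<le> b" for t x
    using that by (meson abs_triangle_ineq add_mono order_trans)
  then show ?thesis
    by (intro stripI[of _ _ _ "B + C"] bcont_add continuous_intros stripD(1,2)[OF assms(1)] stripD(1,2)[OF assms(2)])
qed

lemma strip_scale:
  assumes "strip z a b" shows "strip (\<lambda>t x. c * z t x) a b"
proof -
  obtain B where "\<And>t x. a \<le> t \<Longrightarrow> t \<le> b \<Longrightarrow> \<bar>z t x\<bar> \<le> B"
    using stripD(3)[OF assms(1)] by blast
  then have "\<bar>c * z t x\<bar> \<le> \<bar>c\<bar> * B" if "a \<le> t" "t \<le> b" for t x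
    using that by (auto simp: abs_mult intro: mult_left_mono)
  then show ?thesis
    by (intro stripI[of _ _ _ "\<bar>c\<bar> * B"] bcont_scale continuous_intros stripD(1,2)[OF assms])
qed

lemma strip_diff:
  assumes "strip z a b" "strip w a b" shows "strip (\<lambda>t x. z t x - w t x) a b"
  using strip_add[OF assms(1) strip_scale[OF assms(2), of "-1"]] by simp

text \<open>
  A lower bound \<open>- M\<close> on a short strip improves itself to \<open>- M / 2\<close>: where \<open>z \<le> 0\<close>, the right-hand side
  is at least \<open>- (1 + K) M\<close>, and this acts for a time of at most \<open>1 / (2 (1 + K))\<close>.
\<close>

lemma comparison_short_time:
  assumes S: "strip z a b" and "0 \<le> K" and short: "(1 + K) * (b - a) \<le> 1 / 2"
    and init: "\<And>x. 0 \<le> z a x"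
    and D: "\<And>t x. a \<le> t \<Longrightarrow> t < b \<Longrightarrow> z t x \<le> 0 \<Longrightarrow>
      dini_ge (\<lambda>s. z s x) t (conv J (z t) x - z t x - K * \<bar>z t x\<bar>)"
    and t: "a \<le> t" "t \<le> b"
  shows "0 \<le> z t x"
proof -
  obtain B where B: "\<And>t x. a \<le> t \<Longrightarrow> t \<le> b \<Longrightarrow> \<bar>z t x\<bar> \<le> B" using stripD(3)[OF S] by blast
  have "0 \<le> B" using B[OF t, of x] by linarith
  have bound: "- (B * (1/2) ^ n) \<le> z t x" if "a \<le> t" "t \<le> b" for n t x
    using that
  proof (induction n arbitrary: t x)
    case 0
    then show ?case using B[of t x] by (simp add: abs_le_iff)
  next
    case (Suc n)
    define M where "M = B * (1/2) ^ n"
    have "0 \<le> M" using \<open>0 \<le> B\<close> by (simp add: M_def)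
    have "- ((1 + K) * M) * (t - a) \<le> z t x"
    proof (rule dini_ge_lower_bound)
      show "continuous_on {a..t} (\<lambda>t. z t x)"
        using S Suc.prems unfolding strip_def by (auto intro: continuous_on_subset)
      fix s assume s: "a \<le> s" "s < t" "z s x \<le> 0"
      have "- M \<le> conv J (z s) x"
        using S s Suc.prems Suc.IH[of s] unfolding strip_def M_def by (intro conv_ge_const) auto
      moreover have "\<bar>z s x\<bar> \<le> M" using s Suc.IH[of s x] Suc.prems by (auto simp: M_def)
      then have "K * \<bar>z s x\<bar> \<le> K * M" using \<open>0 \<le> K\<close> by (rule mult_left_mono)
      ultimately have "- ((1 + K) * M) \<le> conv J (z s) x - z s x - K * \<bar>z s x\<bar>"
        using s(3) by (simp add: algebra_simps)
      moreover have "dini_ge (\<lambda>s. z s x) s (conv J (z s) x - z s x - K * \<bar>z s x\<bar>)"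
        using s Suc.prems by (intro D) auto
      ultimately show "dini_ge (\<lambda>s. z s x) s (- ((1 + K) * M))" by (rule dini_ge_mono[rotated])
    qed (use Suc.prems init \<open>0 \<le> K\<close> \<open>0 \<le> M\<close> in auto)
    moreover have "(1 + K) * M * (t - a) \<le> M / 2"
    proof -
      have "(1 + K) * (t - a) \<le> (1 + K) * (b - a)" using Suc.prems \<open>0 \<le> K\<close> by (intro mult_left_mono) auto
      then have "M * ((1 + K) * (t - a)) \<le> M * (1 / 2)" using short \<open>0 \<le> M\<close> by (intro mult_left_mono) auto
      then show ?thesis by (simp add: mult_ac)
    qed
    ultimately show ?case by (simp add: M_def)
  qed
  have "(\<lambda>n. - (B * (1/2) ^ n)) \<longlonglongrightarrow> - (B * 0)"
    by (intro tendsto_intros LIMSEQ_power_zero) auto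
  then show ?thesis using bound[OF t] by (intro LIMSEQ_le_const2[of _ "- (B * 0)" "z t x", simplified]) auto
qed

lemma comparison_principle:
  assumes S: "strip z a b" and "0 \<le> K" and init: "\<And>x. 0 \<le> z a x"
    and D: "\<And>t x. a \<le> t \<Longrightarrow> t < b \<Longrightarrow> z t x \<le> 0 \<Longrightarrow>
      dini_ge (\<lambda>s. z s x) t (conv J (z t) x - z t x - K * \<bar>z t x\<bar>)"
    and t: "a \<le> t" "t \<le> b"
  shows "0 \<le> z t x"
proof -
  define \<tau> where "\<tau> = 1 / (2 * (1 + K))"
  have \<tau>: "\<tau> > 0" "(1 + K) * \<tau> = 1 / 2" using \<open>0 \<le> K\<close> by (auto simp: \<tau>_def field_simps)
  have step: "0 \<le> z t x" if "a \<le> t" "t \<le> b" "t \<le> a + real n * \<tau>" for n t x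
    using that
  proof (induction n arbitrary: t x)
    case 0
    then show ?case using init by simp
  next
    case (Suc n)
    show ?case
    proof (cases "t \<le> a + real n * \<tau>")
      case True
      then show ?thesis using Suc by blast
    next
      case False
      define c where "c = a + real n * \<tau>"
      have c: "a \<le> c" "c \<le> t" "t - c \<le> \<tau>" using False Suc.prems \<tau> by (auto simp: c_def algebra_simps)
      show ?thesis
      proof (rule comparison_short_time[of z c t K])
        show "strip z c t" using S c Suc.prems by (auto intro: strip_subset)
        show "(1 + K) * (t - c) \<le> 1 / 2"
          using mult_left_mono[OF c(3), of "1 + K"] \<tau>(2) \<open>0 \<le> K\<close> by simp
        show "0 \<le> z c x" for x using Suc.IH[of c x] c Suc.prems by (auto simp: c_def)
      qed (use D c Suc.prems \<open>0 \<le> K\<close> in auto)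
    qed
  qed
  obtain n :: nat where "(t - a) / \<tau> \<le> real n" using real_arch_simple by blast
  then show ?thesis using step[OF t, of n] \<tau> by (simp add: field_simps)
qed

text \<open>
  The inequality satisfied by the difference of an upper and a lower solution of the nonlinear equation, after
  bounding the difference of the reaction terms by the Lipschitz constant \<open>K\<close>.
\<close>

definition supersol :: "real \<Rightarrow> (real \<Rightarrow> real \<Rightarrow> real) \<Rightarrow> real \<Rightarrow> real \<Rightarrow> bool" where
  "supersol K z a b \<longleftrightarrow> strip z a b \<and> (\<forall>t x. a \<le> t \<longrightarrow> t < b \<longrightarrow>
      dini_ge (\<lambda>s. z s x) t (conv J (z t) x - z t x - K * \<bar>z t x\<bar>))"

lemma supersol_subset: "supersol K z a b \<Longrightarrow> a \<le> a' \<Longrightarrow> b' \<le> b \<Longrightarrow> supersol K z a' b'"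
  unfolding supersol_def by (auto intro: strip_subset)

text \<open>
  A nonnegative \<open>z\<close> decays at most like \<open>exp (- (1 + K) t)\<close> and gains what dispersal brings in; it
  dominates the explicit subsolution \<open>y\<close> of the resulting scalar inequality.
\<close>

lemma supersol_growth:
  assumes S: "supersol K z a b" and "0 \<le> K" "a \<le> b" "0 \<le> k"
    and nn: "\<And>t. a \<le> t \<Longrightarrow> t \<le> b \<Longrightarrow> 0 \<le> z t x"
    and k: "\<And>t. a \<le> t \<Longrightarrow> t < b \<Longrightarrow> k \<le> conv J (z t) x"
  shows "exp (- (1 + K) * (b - a)) * (z a x + k * (b - a)) \<le> z b x"
proof -
  define y where "y s = exp (- (1 + K) * (s - a)) * (z a x + k * (s - a))" for s
  define y' where "y' s = - (1 + K) * y s + exp (- (1 + K) * (s - a)) * k" for s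
  have dy: "((\<lambda>s. - y s) has_real_derivative - y' s) (at s within A)" for s A
    unfolding y_def y'_def by (rule derivative_eq_intros refl | simp add: algebra_simps)+
  have "- 0 * (b - a) \<le> z b x - y b"
  proof (rule dini_ge_lower_bound)
    have "continuous_on {a..b} (\<lambda>s. z s x)" using S by (auto simp: supersol_def strip_def)
    then show "continuous_on {a..b} (\<lambda>s. z s x - y s)" unfolding y_def by (intro continuous_intros)
    fix t assume t: "a \<le> t" "t < b" and neg: "z t x - y t \<le> 0"
    have "dini_ge (\<lambda>s. z s x) t (conv J (z t) x - z t x - K * \<bar>z t x\<bar>)"
      using S t by (simp add: supersol_def)
    then have "dini_ge (\<lambda>s. z s x + - y s) t (conv J (z t) x - z t x - K * \<bar>z t x\<bar> + - y' t)"
      using dini_ge_derivative[OF dy t(1)] by (rule dini_ge_add)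
    then have d: "dini_ge (\<lambda>s. z s x - y s) t (conv J (z t) x - z t x - K * \<bar>z t x\<bar> - y' t)" by simp
    have "exp (- (1 + K) * (t - a)) * k \<le> 1 * k"
      using \<open>0 \<le> k\<close> \<open>0 \<le> K\<close> t by (intro mult_right_mono) (auto intro: mult_nonpos_nonneg)
    then have "exp (- (1 + K) * (t - a)) * k \<le> conv J (z t) x" using k[OF t] by simp
    moreover have "0 \<le> (1 + K) * (y t - z t x)" using neg \<open>0 \<le> K\<close> by simp
    ultimately have "0 \<le> conv J (z t) x - z t x - K * z t x - y' t"
      unfolding y'_def by (simp add: algebra_simps)
    then have "- 0 \<le> conv J (z t) x - z t x - K * \<bar>z t x\<bar> - y' t" using nn[of t] t by simp
    with d show "dini_ge (\<lambda>s. z s x - y s) t (- 0)" by (rule dini_ge_mono)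
  qed (use assms in \<open>auto simp: y_def\<close>)
  then show ?thesis by (simp add: y_def)
qed

lemma conv_ge_interval:
  assumes g: "bcont g" "\<And>y. 0 \<le> g y" and "0 \<le> k" "0 \<le> \<epsilon>" "0 \<le> r"
    and w: "\<And>w. l \<le> w \<Longrightarrow> w \<le> l + r \<Longrightarrow> \<epsilon> \<le> J w \<and> k \<le> g (x - w)"
  shows "\<epsilon> * k * r \<le> conv J g x"
proof -
  have "(\<integral>w. \<epsilon> * k * indicator {l..l + r} w \<partial>lborel) \<le> conv J g x" unfolding conv_alt
  proof (rule integral_mono)
    show "integrable lborel (\<lambda>w. J w * g (x - w))" by (rule J_bcont_integrable[OF g(1)])
    fix w
    show "\<epsilon> * k * indicator {l..l + r} w \<le> J w * g (x - w)"
    proof (cases "w \<in> {l..l + r}")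
      case True
      then show ?thesis using w[of w] assms(3,4) J_nonneg[of w] by (auto intro!: mult_mono)
    qed (use g(2) J_nonneg in auto)
    have "integrable lborel (indicator {l..l + r} :: real \<Rightarrow> real)"
      using \<open>0 \<le> r\<close> by (intro integrable_real_indicator) auto
    then show "integrable lborel (\<lambda>w. \<epsilon> * k * indicator {l..l + r} w)" by simp
  qed
  then show ?thesis using \<open>0 \<le> r\<close> by simp
qed

lemma conv_ge_window:
  assumes g: "bcont g" "\<And>y. 0 \<le> g y" and "0 \<le> \<epsilon>"
    and w: "\<And>y. l \<le> y \<Longrightarrow> y \<le> r \<Longrightarrow> \<epsilon> \<le> J (x - y)"
  shows "\<epsilon> * integral {l..r} g \<le> conv J g x"
proof -
  have "continuous_on {l..r} g" using g(1) unfolding bcont_def by (auto intro: continuous_on_subset)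
  then have si: "set_integrable lborel {l..r} g" by (rule borel_integrable_atLeastAtMost')
  have "\<epsilon> * integral {l..r} g = \<epsilon> * (LINT y:{l..r}|lborel. g y)"
    using set_borel_integral_eq_integral(2)[OF si] by simp
  also have "\<dots> = (\<integral>y. \<epsilon> * (indicator {l..r} y * g y) \<partial>lborel)"
    by (simp add: set_lebesgue_integral_def)
  also have "\<dots> \<le> conv J g x" unfolding conv_def
  proof (rule integral_mono)
    show "integrable lborel (\<lambda>y. \<epsilon> * (indicator {l..r} y * g y))"
      using si by (simp add: set_integrable_def)
    have "integrable lborel (\<lambda>w. J (x + (-1) * w) * g (x - (x + (-1) * w)))"
      by (rule lborel_integrable_real_affine[OF J_bcont_integrable[OF g(1)]]) simp
    then show "integrable lborel (\<lambda>y. J (x - y) * g y)" by simp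
    fix y
    show "\<epsilon> * (indicator {l..r} y * g y) \<le> J (x - y) * g y"
    proof (cases "y \<in> {l..r}")
      case True
      then show ?thesis using w[of y] g(2) by (auto intro!: mult_right_mono)
    qed (use g(2) J_nonneg in auto)
  qed
  finally show ?thesis .
qed

lemma supersol_decay:
  assumes S: "supersol K z a b" and "0 \<le> K" "a \<le> t" "t \<le> b"
    and nn: "\<And>t x. a \<le> t \<Longrightarrow> t \<le> b \<Longrightarrow> 0 \<le> z t x"
  shows "exp (- (1 + K) * (b - a)) * z a x \<le> z t x"
proof -
  have "exp (- (1 + K) * (t - a)) * (z a x + 0 * (t - a)) \<le> z t x"
  proof (rule supersol_growth)
    show "supersol K z a t" using S assms by (auto intro: supersol_subset)
    fix s assume s: "a \<le> s" "s < t"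
    show "0 \<le> conv J (z s) x"
      using S s assms by (intro conv_ge_const) (auto simp: supersol_def strip_def)
  qed (use assms in auto)
  moreover have "exp (- (1 + K) * (b - a)) * z a x \<le> exp (- (1 + K) * (t - a)) * z a x"
  proof (intro mult_right_mono)
    have "(1 + K) * (t - a) \<le> (1 + K) * (b - a)" using assms by (intro mult_left_mono) auto
    then show "exp (- (1 + K) * (b - a)) \<le> exp (- (1 + K) * (t - a))" by (simp add: algebra_simps)
  qed (use nn[of a x] assms in auto)
  ultimately show ?thesis by simp
qed

text \<open>
  Where \<open>J\<close> is bounded below near \<open>c\<close>, a lower bound on a ball around \<open>p\<close> is carried to the translate
  by \<open>c\<close>, on a ball that is larger by \<open>\<rho>\<close>.
\<close>

lemma supersol_spread:
  assumes S: "supersol K z a b" and "0 \<le> K" "a \<le> b" "0 \<le> k" "0 < \<rho>" "0 < \<epsilon>" "\<rho> \<le> r"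
    and nn: "\<And>t x. a \<le> t \<Longrightarrow> t \<le> b \<Longrightarrow> 0 \<le> z t x"
    and J: "\<And>y. \<bar>y - c\<bar> \<le> 2 * \<rho> \<Longrightarrow> \<epsilon> \<le> J y"
    and k: "\<And>x. \<bar>x - p\<bar> \<le> r \<Longrightarrow> k \<le> z a x"
    and x: "\<bar>x - (p + c)\<bar> \<le> r + \<rho>"
  defines "E \<equiv> exp (- (1 + K) * (b - a))"
  shows "E * E * \<epsilon> * \<rho> * (b - a) * k \<le> z b x"
proof -
  have "E > 0" by (simp add: E_def)
  have "E * (z a x + \<epsilon> * (E * k) * \<rho> * (b - a)) \<le> z b x"
    unfolding E_def
  proof (rule supersol_growth[OF S \<open>0 \<le> K\<close> \<open>a \<le> b\<close>])
    fix t assume t: "a \<le> t" "t < b"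
    have lo: "E * k \<le> z t y" if "\<bar>y - p\<bar> \<le> r" for y
    proof -
      have "E * k \<le> E * z a y" using k[OF that] \<open>E > 0\<close> by simp
      also have "\<dots> \<le> z t y" unfolding E_def
        using t by (intro supersol_decay[OF S \<open>0 \<le> K\<close>]) (auto intro: nn)
      finally show ?thesis .
    qed
    define d where "d = x - p - c"
    \<comment> \<open>Left end of an interval of length \<open>\<rho>\<close> of jumps \<open>w\<close> that are within \<open>2 \<rho>\<close> of \<open>c\<close> and start in the ball.\<close>
    define l where "l = (if 0 \<le> d then c + d - min d r else c + d + min (- d) r - \<rho>)"
    have "\<epsilon> * (E * k) * \<rho> \<le> conv J (z t) x"
    proof (rule conv_ge_interval[where l=l])
      show "bcont (z t)" using S t by (auto simp: supersol_def strip_def)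
      fix w assume w: "l \<le> w" "w \<le> l + \<rho>"
      have d: "\<bar>d\<bar> \<le> r + \<rho>" using x by (simp add: d_def)
      have "\<bar>w - c\<bar> \<le> 2 * \<rho>" "\<bar>x - w - p\<bar> \<le> r"
        using w d \<open>\<rho> \<le> r\<close> \<open>0 < \<rho>\<close> unfolding l_def d_def by (auto split: if_splits simp: min_def)
      then show "\<epsilon> \<le> J w \<and> E * k \<le> z t (x - w)" using J lo by blast
    qed (use nn t \<open>E > 0\<close> assms in auto)
    then show "\<epsilon> * (exp (- (1 + K) * (b - a)) * k) * \<rho> \<le> conv J (z t) x" by (simp add: E_def)
  qed (use assms in auto)
  moreover have "0 \<le> E * z a x" using nn[of a x] assms \<open>E > 0\<close> by simp
  ultimately show ?thesis by (simp add: algebra_simps)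
qed

text \<open>The first jump turns a lower bound on the mean over a window into a pointwise one.\<close>

lemma supersol_spread_window:
  assumes S: "supersol K z a b" and "0 \<le> K" "a \<le> b" "0 \<le> m" "0 < \<rho>" "0 < \<epsilon>"
    and nn: "\<And>t x. a \<le> t \<Longrightarrow> t \<le> b \<Longrightarrow> 0 \<le> z t x"
    and J: "\<And>y. \<bar>y - c\<bar> \<le> 2 * \<rho> \<Longrightarrow> \<epsilon> \<le> J y"
    and m: "m \<le> integral {p - \<rho>..p + \<rho>} (z a)"
    and x: "\<bar>x - (p + c)\<bar> \<le> \<rho>"
  defines "E \<equiv> exp (- (1 + K) * (b - a))"
  shows "E * E * \<epsilon> * (b - a) * m \<le> z b x"
proof -
  have "E > 0" by (simp add: E_def)
  have cont: "continuous_on {p - \<rho>..p + \<rho>} (z t)" if "a \<le> t" "t \<le> b" for t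
  proof -
    have "continuous_on UNIV (z t)" using S that by (auto simp: supersol_def strip_def bcont_def)
    then show ?thesis by (rule continuous_on_subset) simp
  qed
  have "E * (z a x + \<epsilon> * (E * m) * (b - a)) \<le> z b x"
    unfolding E_def
  proof (rule supersol_growth[OF S \<open>0 \<le> K\<close> \<open>a \<le> b\<close>])
    fix t assume t: "a \<le> t" "t < b"
    have "E * m \<le> E * integral {p - \<rho>..p + \<rho>} (z a)" using m \<open>E > 0\<close> by simp
    also have "\<dots> = integral {p - \<rho>..p + \<rho>} (\<lambda>y. E * z a y)" by simp
    also have "\<dots> \<le> integral {p - \<rho>..p + \<rho>} (z t)"
    proof (rule integral_le)
      show "(\<lambda>y. E * z a y) integrable_on {p - \<rho>..p + \<rho>}" "z t integrable_on {p - \<rho>..p + \<rho>}"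
        using cont[of a] cont[of t] t by (auto intro!: integrable_continuous_interval continuous_intros)
      show "E * z a y \<le> z t y" for y
        unfolding E_def using t by (intro supersol_decay[OF S \<open>0 \<le> K\<close>]) (auto intro: nn)
    qed
    finally have "\<epsilon> * (E * m) \<le> \<epsilon> * integral {p - \<rho>..p + \<rho>} (z t)" using \<open>0 < \<epsilon>\<close> by simp
    also have "\<dots> \<le> conv J (z t) x"
    proof (rule conv_ge_window)
      show "bcont (z t)" using S t by (auto simp: supersol_def strip_def)
      fix y assume "p - \<rho> \<le> y" "y \<le> p + \<rho>"
      then show "\<epsilon> \<le> J (x - y)" using x by (intro J) auto
    qed (use nn t \<open>0 < \<epsilon>\<close> in auto)
    finally show "\<epsilon> * (exp (- (1 + K) * (b - a)) * m) \<le> conv J (z t) x" by (simp add: E_def)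
  qed (use assms in auto)
  moreover have "0 \<le> E * z a x" using nn[of a x] assms \<open>E > 0\<close> by simp
  ultimately show ?thesis by (simp add: algebra_simps)
qed

text \<open>
  By symmetry \<open>J\<close> is bounded below near \<open>- c\<close> as well; pairs of opposite jumps enlarge the ball by \<open>2 \<rho>\<close>
  and leave its centre fixed.
\<close>

lemma supersol_spread_iterated:
  assumes "0 \<le> K" "0 < \<tau>" "0 \<le> k" "0 < \<rho>" "0 < \<epsilon>" "\<rho> \<le> r"
    and J: "\<And>y. \<bar>y - c\<bar> \<le> 2 * \<rho> \<Longrightarrow> \<epsilon> \<le> J y"
    and k: "\<And>x. \<bar>x - p\<bar> \<le> r \<Longrightarrow> k \<le> z a x"
  defines "D \<equiv> exp (- (1 + K) * \<tau>) * exp (- (1 + K) * \<tau>) * \<epsilon> * \<rho> * \<tau>"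
  shows "supersol K z a (a + 2 * real n * \<tau>) \<Longrightarrow>
    (\<And>t x. a \<le> t \<Longrightarrow> t \<le> a + 2 * real n * \<tau> \<Longrightarrow> 0 \<le> z t x) \<Longrightarrow>
    \<bar>x - p\<bar> \<le> r + 2 * real n * \<rho> \<Longrightarrow> D ^ (2 * n) * k \<le> z (a + 2 * real n * \<tau>) x"
proof (induction n arbitrary: x)
  case 0
  then show ?case using k by simp
next
  case (Suc n)
  have "D > 0" unfolding D_def using assms by simp
  define b where "b = a + 2 * real n * \<tau>"
  have b: "a \<le> b" "a + 2 * real (Suc n) * \<tau> = b + \<tau> + \<tau>"
    using \<open>0 < \<tau>\<close> by (auto simp: b_def algebra_simps)
  have r: "\<rho> \<le> r + 2 * real n * \<rho>" using assms by (simp add: add_increasing2)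
  have S: "supersol K z b (b + \<tau>)" "supersol K z (b + \<tau>) (b + \<tau> + \<tau>)" "supersol K z a b"
    using Suc.prems(1) b \<open>0 < \<tau>\<close> by (auto intro: supersol_subset)
  have nn: "0 \<le> z t x" if "a \<le> t" "t \<le> b + \<tau> + \<tau>" for t x using Suc.prems(2) that b by auto
  have 0: "D ^ (2 * n) * k \<le> z b x" if "\<bar>x - p\<bar> \<le> r + 2 * real n * \<rho>" for x
    using Suc.IH[OF _ _ that] S(3) nn \<open>0 < \<tau>\<close> by (auto simp: b_def)
  have 1: "D * (D ^ (2 * n) * k) \<le> z (b + \<tau>) x" if "\<bar>x - (p + c)\<bar> \<le> r + 2 * real n * \<rho> + \<rho>" for x
    using supersol_spread[OF S(1) _ _ _ _ _ r _ J 0 that] nn b assms(1-5) \<open>D > 0\<close>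
    by (simp add: D_def)
  have J': "\<epsilon> \<le> J y" if "\<bar>y - (- c)\<bar> \<le> 2 * \<rho>" for y
    using J[of "- y"] that J_sym[of y] by (simp add: abs_minus_commute)
  have r': "\<rho> \<le> r + 2 * real n * \<rho> + \<rho>" using r assms by linarith
  have x: "\<bar>x - (p + c + - c)\<bar> \<le> r + 2 * real n * \<rho> + \<rho> + \<rho>"
    using Suc.prems(3) by (simp add: algebra_simps)
  have "D * (D * (D ^ (2 * n) * k)) \<le> z (b + \<tau> + \<tau>) x"
    using supersol_spread[OF S(2) _ _ _ _ _ r' _ J' 1 x] nn b assms(1-5) \<open>D > 0\<close>
    by (simp add: D_def)
  then show ?case using b(2) by (simp add: mult_ac)
qed

text \<open>
  Half the width of a window for which a quantitative strong maximum principle holds: the mean of \<open>z\<close> over one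
  window controls \<open>z\<close> from below after any given time on any given larger interval.
\<close>

definition spreading_radius :: "real \<Rightarrow> bool" where
  "spreading_radius \<rho> \<longleftrightarrow> 0 < \<rho> \<and> (\<forall>K\<ge>0. \<forall>T>0. \<forall>R. \<exists>c>0. \<forall>z s p m.
     supersol K z s (s + T) \<longrightarrow> (\<forall>t\<in>{s..s + T}. \<forall>x. 0 \<le> z t x) \<longrightarrow>
     0 \<le> m \<longrightarrow> m \<le> integral {p - \<rho>..p + \<rho>} (z s) \<longrightarrow>
     (\<forall>x. \<bar>x - p\<bar> \<le> R \<longrightarrow> c * m \<le> z (s + T) x))"

lemma spreading_radius_exists: "\<exists>\<rho>. spreading_radius \<rho>"
proof -
  obtain x0 \<rho> \<epsilon> where b: "0 < \<rho>" "0 < \<epsilon>" and J: "\<And>y. \<bar>y - x0\<bar> \<le> 2 * \<rho> \<Longrightarrow> \<epsilon> \<le> J y"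
    using J_bump by blast
  have "\<exists>c>0. \<forall>z s p m. supersol K z s (s + T) \<longrightarrow> (\<forall>t\<in>{s..s + T}. \<forall>x. 0 \<le> z t x) \<longrightarrow>
     0 \<le> m \<longrightarrow> m \<le> integral {p - \<rho>..p + \<rho>} (z s) \<longrightarrow>
     (\<forall>x. \<bar>x - p\<bar> \<le> R \<longrightarrow> c * m \<le> z (s + T) x)"
    if "0 \<le> K" "0 < T" for K T R :: real
  proof -
    obtain n :: nat where n: "(R + \<bar>x0\<bar>) / (2 * \<rho>) \<le> real n" using real_arch_simple by blast
    then have n': "R + \<bar>x0\<bar> \<le> 2 * real n * \<rho>" using b by (simp add: field_simps)
    define \<tau> where "\<tau> = T / (2 * real n + 1)"
    have \<tau>: "0 < \<tau>" "T = \<tau> + 2 * real n * \<tau>"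
    proof -
      have pos: "0 < 2 * real n + 1" by simp
      then show "0 < \<tau>" using \<open>0 < T\<close> by (simp add: \<tau>_def)
      have "T = (2 * real n + 1) * \<tau>" using pos by (simp add: \<tau>_def)
      then show "T = \<tau> + 2 * real n * \<tau>" by algebra
    qed
    define E where "E = exp (- (1 + K) * \<tau>)"
    define c where "c = (E * E * \<epsilon> * \<rho> * \<tau>) ^ (2 * n) * (E * E * \<epsilon> * \<tau>)"
    have "c > 0" using b \<tau> by (simp add: c_def E_def)
    moreover have "c * m \<le> z (s + T) x"
      if S: "supersol K z s (s + T)" and nn: "\<forall>t\<in>{s..s + T}. \<forall>x. 0 \<le> z t x"
        and m: "0 \<le> m" "m \<le> integral {p - \<rho>..p + \<rho>} (z s)" and x: "\<bar>x - p\<bar> \<le> R" for z s p m x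
    proof -
      have n\<tau>: "0 \<le> 2 * real n * \<tau>" using \<tau> by simp
      have S': "supersol K z s (s + \<tau>)" "supersol K z (s + \<tau>) (s + \<tau> + 2 * real n * \<tau>)"
        using S \<tau> n\<tau> by (auto intro!: supersol_subset[OF S])
      have 1: "E * E * \<epsilon> * \<tau> * m \<le> z (s + \<tau>) y" if "\<bar>y - (p + x0)\<bar> \<le> \<rho>" for y
        using supersol_spread_window[OF S'(1) _ _ m(1) b _ J m(2) that] nn \<tau> n\<tau> \<open>0 \<le> K\<close>
        by (simp add: E_def)
      have k: "0 \<le> E * E * \<epsilon> * \<tau> * m" using b \<tau> m by (simp add: E_def)
      have "(E * E * \<epsilon> * \<rho> * \<tau>) ^ (2 * n) * (E * E * \<epsilon> * \<tau> * m) \<le> z (s + \<tau> + 2 * real n * \<tau>) x"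
        unfolding E_def
      proof (rule supersol_spread_iterated[where z=z and a="s + \<tau>" and n=n and x=x and c=x0 and r=\<rho>])
        show "0 \<le> z t x" if "s + \<tau> \<le> t" "t \<le> s + \<tau> + 2 * real n * \<tau>" for t x
          using nn that \<tau> by auto
        show "\<bar>x - (p + x0)\<bar> \<le> \<rho> + 2 * real n * \<rho>" using x n' b by linarith
      qed (use 1 k S' b \<tau> \<open>0 \<le> K\<close> J in \<open>auto simp: E_def\<close>)
      then show ?thesis using \<tau>(2) by (simp add: c_def mult_ac add_ac)
    qed
    ultimately show ?thesis by blast
  qed
  then show ?thesis using b unfolding spreading_radius_def by blast
qed

end


section \<open>Steepness of the front\<close>

text \<open>
  The integral telescopes to the difference of the integrals of \<open>g\<close> over \<open>[a, a + h]\<close> and \<open>[b, b + h]\<close>.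
  It is linear in \<open>h\<close>, without any differentiability of \<open>g\<close>.
\<close>

lemma integral_decrement_ge:
  fixes g :: "real \<Rightarrow> real"
  assumes cont: "continuous_on UNIV g" and anti: "\<And>x y. x \<le> y \<Longrightarrow> g y \<le> g x"
    and h: "0 \<le> h" "a + h \<le> b"
  shows "h * (g (a + h) - g b) \<le> integral {a..b} (\<lambda>x. g x - g (x + h))"
proof -
  have int: "g integrable_on {l..r}" for l r
    using cont by (intro integrable_continuous_interval) (rule continuous_on_subset, auto)
  have ch: "continuous_on A (\<lambda>x. g (x + h))" for A
    by (rule continuous_on_compose2[OF cont]) (auto intro!: continuous_intros)
  have "integral {a..b} (\<lambda>x. g x - g (x + h)) = integral {a..b} g - integral {a..b} (\<lambda>x. g (x + h))"
    using ch by (intro Henstock_Kurzweil_Integration.integral_diff int integrable_continuous_interval)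
  also have "integral {a..b} (\<lambda>x. g (x + h)) = integral {a + h..b + h} g"
    using integral_shift[of a h b g] cont by (simp add: o_def continuous_on_subset)
  also have "integral {a + h..b + h} g = integral {a + h..b} g + integral {b..b + h} g"
    using h by (intro Henstock_Kurzweil_Integration.integral_combine[symmetric] int) auto
  also have "integral {a..b} g = integral {a..a + h} g + integral {a + h..b} g"
    using h by (intro Henstock_Kurzweil_Integration.integral_combine[symmetric] int) auto
  finally have eq: "integral {a..b} (\<lambda>x. g x - g (x + h)) = integral {a..a + h} g - integral {b..b + h} g"
    by simp
  have "integral {a..a + h} (\<lambda>_. g (a + h)) \<le> integral {a..a + h} g"
    by (intro integral_le int anti) auto
  moreover have "integral {b..b + h} g \<le> integral {b..b + h} (\<lambda>_. g b)"
    by (intro integral_le int anti) auto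
  ultimately show ?thesis unfolding eq using h by (simp add: algebra_simps)
qed

text \<open>
  What the argument uses about the equation and the front. The assumptions on \<open>f\<close> are bounds on
  differences of its values, since solutions are compared by subtracting them.
\<close>

locale front = kernel J for J :: "real \<Rightarrow> real" +
  fixes f u :: "real \<Rightarrow> real \<Rightarrow> real" and X :: "real \<Rightarrow> real"
    and K L \<theta> \<theta>\<^sub>1 \<kappa> cmin cmax cm cp hm hp \<rho> :: real
  assumes K_pos: "0 < K"
    and f_lipschitz: "\<bar>f t w - f t w'\<bar> \<le> K * \<bar>w - w'\<bar>"
    and f_ignition: "w \<le> \<theta> \<Longrightarrow> f t w = 0"
    and f_decreasing: "\<theta>\<^sub>1 \<le> w' \<Longrightarrow> w' \<le> w \<Longrightarrow> w \<le> 2 \<Longrightarrow> f t w - f t w' \<le> - \<kappa> * (w - w')"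
    and \<theta>_pos: "0 < \<theta>" and \<theta>\<^sub>1_less: "\<theta>\<^sub>1 < 1" and \<kappa>_pos: "0 < \<kappa>"
    and u_bcont: "bcont (u t)"
    and u_deriv: "((\<lambda>s. u s x) has_real_derivative conv J (u t) x - u t x + f t (u t x)) (at t)"
    and u_decreasing: "x < y \<Longrightarrow> u t y < u t x"
    and u_range: "0 < u t x" "u t x < 1"
    and L_pos: "0 < L" and u_lipschitz: "\<bar>u t x - u t y\<bar> \<le> L * \<bar>x - y\<bar>"
    and X_deriv: "(X has_real_derivative deriv X t) (at t)"
    and X_speed: "cmin \<le> deriv X t" "deriv X t \<le> cmax"
    and cmin_pos: "0 < cmin" and decay_pos: "0 < cm" "0 < cp" "0 < hm" "0 < hp"
    and u_bounds: "front_bounds cm cp hm hp (u t) (X t)"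
    and radius: "spreading_radius \<rho>"
begin

lemma \<rho>_pos: "0 < \<rho>" using radius by (simp add: spreading_radius_def)

lemma cmax_pos: "0 < cmax" using cmin_pos X_speed[of 0] by linarith

lemma u_antimono: "x \<le> y \<Longrightarrow> u t y \<le> u t x"
  using u_decreasing[of x y t] by (cases "x = y") auto

lemma X_cont: "continuous_on A X"
  using X_deriv by (intro continuous_at_imp_continuous_on ballI) (rule DERIV_isCont)

lemma X_increment:
  assumes "s \<le> t" shows "cmin * (t - s) \<le> X t - X s" "X t - X s \<le> cmax * (t - s)"
proof -
  have "cmin * (t - s) \<le> X t - X s \<and> X t - X s \<le> cmax * (t - s)"
  proof (cases "s = t")
    case False
    then have "s < t" using assms by simp
    then obtain z where "X t - X s = (t - s) * deriv X z"
      using MVT2[of s t X "deriv X"] X_deriv by blast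
    then show ?thesis using X_speed[of z] assms
      by (auto simp: mult.commute[of "t - s"] intro!: mult_right_mono)
  qed auto
  then show "cmin * (t - s) \<le> X t - X s" "X t - X s \<le> cmax * (t - s)" by auto
qed

lemma X_mono: "s \<le> t \<Longrightarrow> X s \<le> X t"
  using X_increment(1)[of s t] cmin_pos by (smt (verit) mult_nonneg_nonneg)

lemma front_limits:
  assumes "0 < \<epsilon>"
  shows "\<exists>M>0. \<forall>t x. (M \<le> x - X t \<longrightarrow> u t x \<le> \<epsilon>) \<and> (x - X t \<le> - M \<longrightarrow> 1 - \<epsilon> \<le> u t x)"
proof -
  define R where "R = \<bar>ln \<epsilon>\<bar> / cp + \<bar>ln \<epsilon>\<bar> / cm"
  have R0: "0 \<le> R" using decay_pos by (simp add: R_def)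
  have R: "\<bar>ln \<epsilon>\<bar> \<le> cp * R" "\<bar>ln \<epsilon>\<bar> \<le> cm * R" using decay_pos by (auto simp: R_def field_simps)
  define M where "M = hp + hm + R"
  have small: "exp w \<le> \<epsilon>" if "w \<le> ln \<epsilon>" for w
    using that \<open>0 < \<epsilon>\<close> by (metis exp_le_cancel_iff exp_ln)
  show ?thesis
  proof (intro exI[of _ M] conjI allI impI)
    show "0 < M" using decay_pos R0 by (simp add: M_def)
    fix t x
    {
      assume x: "M \<le> x - X t"
      have "x \<ge> X t + hp" using x decay_pos R0 by (simp add: M_def)
      then have "u t x \<le> exp (- cp * (x - X t - hp))" using u_bounds by (simp add: front_bounds_def)
      moreover have "cp * R \<le> cp * (x - X t - hp)"
        using x decay_pos by (intro mult_left_mono) (auto simp: M_def)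
      then have "- cp * (x - X t - hp) \<le> ln \<epsilon>" using R(1) by linarith
      ultimately show "u t x \<le> \<epsilon>" using small by fastforce
    }
    {
      assume x: "x - X t \<le> - M"
      have "x \<le> X t - hm" using x decay_pos R0 by (simp add: M_def)
      then have "u t x \<ge> 1 - exp (cm * (x - X t + hm))" using u_bounds by (simp add: front_bounds_def)
      moreover have "cm * (x - X t + hm) \<le> cm * (- R)"
        using x decay_pos by (intro mult_left_mono) (auto simp: M_def)
      then have "cm * (x - X t + hm) \<le> ln \<epsilon>" using R(2) by simp
      ultimately show "1 - \<epsilon> \<le> u t x" using small by fastforce
    }
  qed
qed

definition sol :: "(real \<Rightarrow> real \<Rightarrow> real) \<Rightarrow> real \<Rightarrow> bool" where
  "sol v a \<longleftrightarrow> (\<forall>b. strip v a b) \<and> (\<forall>t\<ge>a. \<forall>x.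
     ((\<lambda>s. v s x) has_real_derivative conv J (v t) x - v t x + f t (v t x)) (at t within {a..}))"

lemma sol_later: "sol v a \<Longrightarrow> a \<le> a' \<Longrightarrow> sol v a'"
  unfolding sol_def by (meson DERIV_subset atLeast_subset_iff order.refl order_trans strip_subset)

lemma u_strip: "strip (\<lambda>t x. u t (x + a)) s t"
proof (rule stripI[of _ _ _ 1])
  show "bcont (\<lambda>x. u t (x + a))" for t by (rule bcont_shift[OF u_bcont])
  show "continuous_on {s..t} (\<lambda>t. u t (x + a))" for x
    using u_deriv by (intro continuous_at_imp_continuous_on ballI) (rule DERIV_isCont)
  show "\<bar>u t (x + a)\<bar> \<le> 1" for t x using u_range[of t "x + a"] by simp
qed

lemma u_increment_supersol:
  shows "supersol K (\<lambda>t x. u t x - u t (x + h)) s t"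
  unfolding supersol_def
proof (intro conjI allI impI)
  show "strip (\<lambda>t x. u t x - u t (x + h)) s t"
    using strip_diff[OF u_strip[of 0] u_strip[of h]] by simp
  fix t x
  define d where "d = u t x - u t (x + h)"
  have c: "conv J (\<lambda>x. u t x - u t (x + h)) x = conv J (u t) x - conv J (u t) (x + h)"
    by (subst conv_diff) (auto intro: u_bcont bcont_shift simp: conv_shift)
  have "((\<lambda>s. u s x - u s (x + h)) has_real_derivative
      (conv J (u t) x - u t x + f t (u t x)) -
      (conv J (u t) (x + h) - u t (x + h) + f t (u t (x + h)))) (at t within {t..})"
    by (intro derivative_intros DERIV_subset[OF u_deriv]) auto
  then have D: "dini_ge (\<lambda>s. u s x - u s (x + h)) t ((conv J (u t) x - u t x + f t (u t x)) -
      (conv J (u t) (x + h) - u t (x + h) + f t (u t (x + h))))"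
    by (rule dini_ge_derivative) simp
  have "- (K * \<bar>d\<bar>) \<le> f t (u t x) - f t (u t (x + h))"
    using f_lipschitz[of t "u t x" "u t (x + h)"] by (simp add: d_def)
  then show "dini_ge (\<lambda>s. u s x - u s (x + h)) t (conv J (\<lambda>x. u t x - u t (x + h)) x
      - (u t x - u t (x + h)) - K * \<bar>u t x - u t (x + h)\<bar>)"
    unfolding c d_def[symmetric] by (intro dini_ge_mono[OF D]) (simp add: d_def)
qed

text \<open>
  The front drops by at least \<open>1/2\<close> over a bounded interval around \<open>X s\<close>. Cutting that interval into pieces of
  length \<open>\<rho>\<close>, some piece carries a fixed share of the drop.
\<close>

lemma front_mass:
  "\<exists>R m. 0 < m \<and> (\<forall>s h. 0 \<le> h \<longrightarrow> h \<le> \<rho> \<longrightarrow>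
     (\<exists>p. \<bar>p - X s\<bar> \<le> R \<and> h * m \<le> integral {p - \<rho>..p + \<rho>} (\<lambda>x. u s x - u s (x + h))))"
proof -
  obtain M where M: "0 < M" "\<And>t x. M \<le> x - X t \<Longrightarrow> u t x \<le> 1/4" "\<And>t x. x - X t \<le> - M \<Longrightarrow> 1 - 1/4 \<le> u t x"
    using front_limits[of "1/4"] by auto
  obtain N :: nat where "2 * M / \<rho> \<le> real N" using real_arch_simple by blast
  then have N: "2 * M \<le> real N * \<rho>" using \<rho>_pos by (simp add: field_simps)
  then have Npos: "0 < N" using M(1) \<rho>_pos by (cases N) auto
  define m where "m = 1 / (2 * real N)"
  have "\<exists>p. \<bar>p - X s\<bar> \<le> M + real N * \<rho> \<and> h * m \<le> integral {p - \<rho>..p + \<rho>} (\<lambda>x. u s x - u s (x + h))"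
    if h: "0 \<le> h" "h \<le> \<rho>" for s h
  proof -
    define g where "g i = X s - M + real i * \<rho>" for i
    have "\<exists>i<N. m \<le> u s (g i) - u s (g (Suc i))"
    proof (rule ccontr)
      assume "\<not> ?thesis"
      then have "(\<Sum>i<N. u s (g i) - u s (g (Suc i))) < (\<Sum>i<N. m)"
        using Npos by (intro sum_strict_mono) auto
      then have "u s (g 0) - u s (g N) < 1 / 2"
        using Npos unfolding sum_lessThan_telescope'[of "\<lambda>i. u s (g i)"] by (simp add: m_def)
      moreover have "1 - 1/4 \<le> u s (g 0)" by (rule M(3)) (simp add: g_def)
      moreover have "u s (g N) \<le> 1/4" using N by (intro M(2)) (simp add: g_def)
      ultimately show False by simp
    qed
    then obtain i where i: "i < N" "m \<le> u s (g i) - u s (g (Suc i))" by blast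
    define p where "p = g i"
    have "u s p \<le> u s (p - \<rho> + h)" using h by (intro u_antimono) auto
    then have "m \<le> u s (p - \<rho> + h) - u s (p + \<rho>)"
      using i(2) by (simp add: p_def g_def algebra_simps)
    then have "h * m \<le> h * (u s (p - \<rho> + h) - u s (p + \<rho>))" using h by (intro mult_left_mono) auto
    also have "\<dots> \<le> integral {p - \<rho>..p + \<rho>} (\<lambda>x. u s x - u s (x + h))"
      using u_bcont[of s] h by (intro integral_decrement_ge u_antimono) (auto simp: bcont_def)
    finally have "h * m \<le> integral {p - \<rho>..p + \<rho>} (\<lambda>x. u s x - u s (x + h))" .
    moreover have "0 \<le> real i * \<rho>" "real i * \<rho> \<le> real N * \<rho>" using i(1) \<rho>_pos by (auto intro: mult_right_mono)
    then have "\<bar>p - X s\<bar> \<le> M + real N * \<rho>" using M(1) by (simp add: p_def g_def abs_le_iff)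
    ultimately show ?thesis by blast
  qed
  moreover have "0 < m" using Npos by (simp add: m_def)
  ultimately show ?thesis by blast
qed

text \<open>
  Increments \<open>u(t, x) - u(t, x + h)\<close> solve the linear inequality. One time unit earlier they had mass of order \<open>h\<close> in
  some window near the front, and in the meantime this mass has spread over \<open>[X t - M, X t + M]\<close>. As \<open>f\<close>
  enters only through \<open>K\<close>, the constants are uniform in \<open>t\<close>.
\<close>

lemma front_steepness:
  "\<exists>\<alpha>>0. \<forall>t x h. \<bar>x - X t\<bar> \<le> M \<longrightarrow> 0 \<le> h \<longrightarrow> h \<le> \<rho> \<longrightarrow> \<alpha> * h \<le> u t x - u t (x + h)"
proof -
  obtain R m where m: "0 < m" and mass: "\<And>s h. 0 \<le> h \<Longrightarrow> h \<le> \<rho> \<Longrightarrow>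
     (\<exists>p. \<bar>p - X s\<bar> \<le> R \<and> h * m \<le> integral {p - \<rho>..p + \<rho>} (\<lambda>x. u s x - u s (x + h)))"
    using front_mass by blast
  obtain c where c: "0 < c" and spread: "\<And>z s p m x. supersol K z s (s + 1) \<Longrightarrow>
      (\<forall>t\<in>{s..s + 1}. \<forall>x. 0 \<le> z t x) \<Longrightarrow> 0 \<le> m \<Longrightarrow> m \<le> integral {p - \<rho>..p + \<rho>} (z s) \<Longrightarrow>
      \<bar>x - p\<bar> \<le> M + cmax + R \<Longrightarrow> c * m \<le> z (s + 1) x"
    using radius[unfolded spreading_radius_def, THEN conjunct2, rule_format, OF less_imp_le[OF K_pos] zero_less_one,
        of "M + cmax + R"] by auto
  show ?thesis
  proof (intro exI[of _ "c * m"] conjI allI impI)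
    show "0 < c * m" using c m by simp
    fix t x h assume x: "\<bar>x - X t\<bar> \<le> M" and h: "0 \<le> h" "h \<le> \<rho>"
    obtain p where p: "\<bar>p - X (t - 1)\<bar> \<le> R"
        "h * m \<le> integral {p - \<rho>..p + \<rho>} (\<lambda>x. u (t - 1) x - u (t - 1) (x + h))"
      using mass[OF h] by blast
    have "\<bar>X t - X (t - 1)\<bar> \<le> cmax" using X_increment[of "t - 1" t] X_mono[of "t - 1" t] by simp
    then have "\<bar>x - p\<bar> \<le> M + cmax + R" using x p(1) by linarith
    then have "c * (h * m) \<le> u (t - 1 + 1) x - u (t - 1 + 1) (x + h)"
      using p(2) h m
      by (intro spread[where z="\<lambda>t x. u t x - u t (x + h)" and p=p and s="t - 1"] u_increment_supersol)
        (auto intro: u_antimono)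
    then show "c * m * h \<le> u t x - u t (x + h)" by (simp add: mult_ac)
  qed
qed

end


section \<open>Exponential weights and the decay of front increments\<close>

text \<open>
  All conditions hold for small \<open>\<eta>\<close>: the Laplace transform exceeds \<open>1\<close> by \<open>O(\<eta>\<^sup>2)\<close> only, which is dominated by
  \<open>\<eta> cmin\<close>, and \<open>\<eta> cmax\<close> is dominated by \<open>\<kappa>\<close>.
\<close>

lemma (in front) weights_exist:
  assumes "0 < \<beta>0"
  shows "\<exists>\<eta> \<omega>. 0 < \<eta> \<and> \<eta> \<le> 1/4 \<and> \<eta> \<le> cp \<and> \<eta> / 2 \<le> \<beta>0 \<and> 0 < \<omega> \<and> \<omega> \<le> \<kappa> \<and>
    laplace \<eta> - 1 \<le> \<eta> * cmin \<and> laplace (\<eta> / 2) - 1 + \<omega> \<le> \<eta> / 2 * cmin \<and> laplace \<eta> - 1 + \<eta> * cmax \<le> \<kappa>"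
proof -
  obtain D where D: "0 \<le> D" "\<And>\<mu>. 0 \<le> \<mu> \<Longrightarrow> \<mu> \<le> 1 \<Longrightarrow> laplace \<mu> \<le> 1 + D * \<mu>\<^sup>2"
    using laplace_quadratic by blast
  define \<eta> where "\<eta> = min (min (1/4) cp) (min \<beta>0 (min (cmin / (D + 1)) (\<kappa> / (D + cmax))))"
  define \<omega> where "\<omega> = min \<kappa> (\<eta> * cmin / 4)"
  have \<eta>: "0 < \<eta>" "\<eta> \<le> 1/4" "\<eta> \<le> cp" "\<eta> \<le> \<beta>0" "\<eta> \<le> cmin / (D + 1)" "\<eta> \<le> \<kappa> / (D + cmax)"
    using D(1) assms cmin_pos cmax_pos \<kappa>_pos decay_pos unfolding \<eta>_def by (simp_all add: min_le_iff_disj del: divide_le_eq_numeral1 le_divide_eq_numeral1)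
  have \<omega>: "0 < \<omega>" "\<omega> \<le> \<kappa>" "\<omega> \<le> \<eta> * cmin / 4"
    using \<kappa>_pos \<eta>(1) cmin_pos by (auto simp: \<omega>_def)
  have "\<eta> * (D + 1) \<le> cmin" using \<eta>(5) D(1) by (simp add: field_simps)
  then have 1: "D * \<eta> \<le> cmin" using \<eta>(1) by (simp add: algebra_simps)
  have 2: "\<eta> * (D + cmax) \<le> \<kappa>" using \<eta>(6) D(1) cmax_pos by (simp add: field_simps)
  have l: "laplace \<eta> - 1 \<le> D * \<eta> * \<eta>" "laplace (\<eta> / 2) - 1 \<le> (D * \<eta>) * \<eta> / 4"
    using D(2)[of \<eta>] D(2)[of "\<eta> / 2"] \<eta>(1,2) by (auto simp: power2_eq_square mult_ac)
  have "D * \<eta> * \<eta> \<le> \<eta> * cmin" using mult_left_mono[OF 1, of \<eta>] \<eta>(1) by (simp add: mult_ac)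
  then have "laplace \<eta> - 1 \<le> \<eta> * cmin" "laplace (\<eta> / 2) - 1 + \<omega> \<le> \<eta> / 2 * cmin" using l \<omega>(3) by simp_all
  moreover have "D * \<eta> * \<eta> \<le> \<eta> * D" using \<eta> D(1) mult_left_mono[of \<eta> 1 "D * \<eta>"] by (simp add: mult_ac)
  then have "laplace \<eta> - 1 + \<eta> * cmax \<le> \<kappa>" using l(1) 2 by (simp add: algebra_simps)
  ultimately have "0 < \<eta> \<and> \<eta> \<le> 1/4 \<and> \<eta> \<le> cp \<and> \<eta> / 2 \<le> \<beta>0 \<and> 0 < \<omega> \<and> \<omega> \<le> \<kappa> \<and>
    laplace \<eta> - 1 \<le> \<eta> * cmin \<and> laplace (\<eta> / 2) - 1 + \<omega> \<le> \<eta> / 2 * cmin \<and> laplace \<eta> - 1 + \<eta> * cmax \<le> \<kappa>"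
    using \<eta> \<omega> l(1) by auto
  then show ?thesis by blast
qed

text \<open>
  The conditions \<open>\<eta>_ahead\<close> and \<open>\<beta>_ahead\<close> say that decaying exponentials moving with the front are supersolutions ahead of
  it, where \<open>f = 0\<close>; \<open>\<eta>_behind\<close> says the same for growing ones behind it, where \<open>f\<close> contributes \<open>- \<kappa>\<close>. The bound
  \<open>\<eta> \<le> 1/4\<close> only serves to keep the factor for recentring the weight by \<open>2\<close> below \<open>2\<close>.
\<close>

locale weighted_front = front +
  fixes \<eta> \<beta> \<omega> :: real
  assumes \<eta>_pos: "0 < \<eta>" and \<eta>_small: "\<eta> \<le> 1/4" and \<beta>_def: "\<beta> = \<eta> / 2" and \<eta>_cp: "\<eta> \<le> cp"
    and \<omega>_pos: "0 < \<omega>" and \<omega>_\<kappa>: "\<omega> \<le> \<kappa>"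
    and \<eta>_ahead: "laplace \<eta> - 1 \<le> \<eta> * cmin"
    and \<beta>_ahead: "laplace \<beta> - 1 + \<omega> \<le> \<beta> * cmin"
    and \<eta>_behind: "laplace \<eta> - 1 + \<eta> * cmax \<le> \<kappa>"
begin

lemma \<beta>_pos: "0 < \<beta>" using \<eta>_pos \<beta>_def by simp

lemma \<beta>_cp: "\<beta> \<le> cp" using \<eta>_cp \<eta>_pos \<beta>_def by simp

text \<open>
  The weight \<open>\<Gamma>\<close> of the error terms. It does not decay behind the front, where the reaction controls the
  error. At its corner it is a minimum of two supersolutions and hence again one.
\<close>

definition weight :: "real \<Rightarrow> real" where "weight y = min 1 (exp (- \<beta> * y))"

definition peak :: "real \<Rightarrow> real" where "peak y = exp (- \<eta> * \<bar>y\<bar>)"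

lemma weight_pos: "0 < weight y" and weight_le_1: "weight y \<le> 1"
  by (auto simp: weight_def)

lemma weight_neg: "y \<le> 0 \<Longrightarrow> weight y = 1"
  using \<beta>_pos by (simp add: weight_def min_def mult_nonneg_nonpos)

lemma weight_nonneg: "0 \<le> y \<Longrightarrow> weight y = exp (- \<beta> * y)"
  using \<beta>_pos unfolding weight_def by (intro min_absorb2) simp

lemma weight_antimono: "x \<le> y \<Longrightarrow> weight y \<le> weight x"
  using \<beta>_pos unfolding weight_def by (intro min.mono) auto

lemma weight_shift: "weight y \<le> exp (\<beta> * \<bar>a\<bar>) * weight (y + a)"
proof -
  have "weight y \<le> exp (\<beta> * \<bar>a\<bar>) * 1" using weight_le_1[of y] \<beta>_pos by (intro order.trans[OF weight_le_1]) simp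
  moreover have "weight y \<le> exp (\<beta> * \<bar>a\<bar>) * exp (- \<beta> * (y + a))"
  proof -
    have "\<beta> * a \<le> \<beta> * \<bar>a\<bar>" using \<beta>_pos by (intro mult_left_mono) auto
    then have "exp (- \<beta> * y) \<le> exp (\<beta> * \<bar>a\<bar>) * exp (- \<beta> * (y + a))"
      by (simp add: exp_add[symmetric] algebra_simps)
    then show ?thesis by (simp add: weight_def min.coboundedI2)
  qed
  ultimately show ?thesis by (auto simp: weight_def min_def)
qed

lemma weight_bcont: "bcont (\<lambda>x. weight (x - a - b))"
  by (rule bcontI[of _ 1]) (auto simp: weight_def intro!: continuous_intros)

lemma peak_bcont: "bcont (\<lambda>x. peak (x - p))"
  using \<eta>_pos by (intro bcontI[of _ 1]) (auto simp: peak_def intro!: continuous_intros)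

lemma conv_weight:
  fixes x a b :: real
  defines "y \<equiv> x - a - b"
  shows "conv J (\<lambda>x. weight (x - a - b)) x - weight y \<le> (if 0 < y then (\<beta> * cmin - \<omega>) * weight y else 0)"
proof (cases "0 < y")
  case True
  have "conv J (\<lambda>x. weight (x - a - b)) x \<le> laplace (- \<beta>) * exp (- \<beta> * (x - (a + b)))"
    by (intro conv_le_exp weight_bcont) (simp add: weight_def algebra_simps)
  also have "\<dots> = laplace \<beta> * weight y" using True by (simp add: y_def weight_nonneg laplace_minus diff_diff_eq)
  also have "\<dots> \<le> (1 + (\<beta> * cmin - \<omega>)) * weight y"
    using \<beta>_ahead weight_pos[of y] by (intro mult_right_mono) auto
  finally show ?thesis using True by (simp add: algebra_simps)
next
  case False
  have "conv J (\<lambda>x. weight (x - a - b)) x \<le> 1" by (intro conv_le_const weight_bcont weight_le_1)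
  then show ?thesis using False weight_neg[of y] by simp
qed

lemma conv_peak: "conv J (\<lambda>x. peak (x - p)) x \<le> laplace \<eta> * peak (x - p)"
proof (cases "0 \<le> x - p")
  case True
  have "peak (y - p) \<le> exp (- \<eta> * (y - p))" for y
    using mult_left_mono[of "y - p" "\<bar>y - p\<bar>" \<eta>] \<eta>_pos by (simp add: peak_def)
  then have "conv J (\<lambda>x. peak (x - p)) x \<le> laplace (- \<eta>) * exp (- \<eta> * (x - p))"
    by (intro conv_le_exp peak_bcont)
  then show ?thesis using True by (simp add: peak_def laplace_minus)
next
  case False
  have "peak (y - p) \<le> exp (\<eta> * (y - p))" for y
    using mult_left_mono[of "- (y - p)" "\<bar>y - p\<bar>" \<eta>] \<eta>_pos by (simp add: peak_def algebra_simps)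
  then have "conv J (\<lambda>x. peak (x - p)) x \<le> laplace \<eta> * exp (\<eta> * (x - p))"
    by (intro conv_le_exp peak_bcont)
  moreover have "\<bar>x - p\<bar> = - (x - p)" using False by simp
  ultimately show ?thesis by (simp add: peak_def algebra_simps)
qed

text \<open>Since \<open>\<eta> = 2 \<beta>\<close>, the increments of the front are small relative to the weight outside a large window.\<close>

lemma peak_le_weight: "M \<le> \<bar>y\<bar> \<Longrightarrow> peak y \<le> exp (- \<beta> * M) * weight y"
proof -
  assume M: "M \<le> \<bar>y\<bar>"
  have "peak y = exp (- \<beta> * \<bar>y\<bar>) * exp (- \<beta> * \<bar>y\<bar>)"
    by (simp add: peak_def \<beta>_def exp_add[symmetric])
  also have "\<dots> \<le> exp (- \<beta> * M) * weight y"
    using M \<beta>_pos by (intro mult_mono) (auto simp: weight_def abs_le_iff)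
  finally show ?thesis .
qed

lemma u_le_weight: "u t x \<le> exp (\<beta> * hp) * weight (x - X t)"
proof (cases "X t + hp \<le> x")
  case True
  then have "u t x \<le> exp (- cp * (x - X t - hp))" using u_bounds by (simp add: front_bounds_def)
  also have "\<dots> \<le> exp (- \<beta> * (x - X t - hp))"
    using True \<beta>_cp by (auto intro: mult_right_mono)
  also have "\<dots> = exp (\<beta> * hp) * weight (x - X t)"
    using True decay_pos by (simp add: weight_nonneg exp_add[symmetric] algebra_simps)
  finally show ?thesis .
next
  case False
  have "u t x \<le> 1" using u_range[of t x] by simp
  also have "1 = exp (\<beta> * hp) * weight hp" using decay_pos by (simp add: weight_nonneg exp_add[symmetric])
  also have "\<dots> \<le> exp (\<beta> * hp) * weight (x - X t)" using False by (auto intro!: weight_antimono)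
  finally show ?thesis .
qed

lemma eventually_X_near:
  assumes "X t < c" shows "\<forall>\<^sub>F s in at_right t. X s < c"
proof -
  have "(X \<longlongrightarrow> X t) (at_right t)"
    using DERIV_isCont[OF X_deriv[of t]] by (auto simp: isCont_def intro: tendsto_mono at_le)
  then show ?thesis using assms by (rule order_tendstoD)
qed

text \<open>
  The decaying weight is a supersolution of the pure dispersal equation ahead of the front, and up to
  the term with \<open>\<omega>\<close> behind it, where the reaction has to compensate. At the corner \<open>\<Gamma>\<close> is constant to the
  right in time, because \<open>X\<close> increases.
\<close>

lemma dini_weight:
  fixes t1 q :: real
  assumes "0 \<le> q"
  defines "Q \<equiv> \<lambda>s. q * exp (- \<omega> * (s - t1))"
  shows "dini_ge (\<lambda>s. Q s * weight (x - X s - b)) t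
    (Q t * (conv J (\<lambda>x. weight (x - X t - b)) x - weight (x - X t - b)) -
      (if 0 < x - X t - b then 0 else \<omega> * Q t * weight (x - X t - b)))"
proof -
  have Q: "0 \<le> Q t" using assms by simp
  have cg: "conv J (\<lambda>x. weight (x - X t - b)) x - weight (x - X t - b) \<le>
      (if 0 < x - X t - b then (\<beta> * cmin - \<omega>) * weight (x - X t - b) else 0)"
    by (rule conv_weight)
  have dQ: "(Q has_real_derivative - \<omega> * Q t) (at t within {t..})"
    unfolding Q_def by (rule derivative_eq_intros refl | simp)+
  show ?thesis
  proof (cases "0 < x - X t - b")
    case True
    have "((\<lambda>s. Q s * exp (- \<beta> * (x - X s - b))) has_real_derivative
        Q t * exp (- \<beta> * (x - X t - b)) * (\<beta> * deriv X t - \<omega>)) (at t within {t..})"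
      by (rule derivative_eq_intros dQ DERIV_subset[OF X_deriv] subset_UNIV refl | simp add: algebra_simps)+
    then have D: "dini_ge (\<lambda>s. Q s * exp (- \<beta> * (x - X s - b))) t
        (Q t * exp (- \<beta> * (x - X t - b)) * (\<beta> * deriv X t - \<omega>))"
      by (rule dini_ge_derivative) simp
    have "\<forall>\<^sub>F s in at_right t. X s < x - b" using True by (intro eventually_X_near) simp
    then have "\<forall>\<^sub>F s in at_right t. Q s * weight (x - X s - b) - Q t * weight (x - X t - b) \<ge>
        Q s * exp (- \<beta> * (x - X s - b)) - Q t * exp (- \<beta> * (x - X t - b))"
      by eventually_elim (use True in \<open>simp add: weight_nonneg\<close>)
    then have "dini_ge (\<lambda>s. Q s * weight (x - X s - b)) t
        (Q t * exp (- \<beta> * (x - X t - b)) * (\<beta> * deriv X t - \<omega>))"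
      by (rule dini_ge_increment_mono[OF D])
    then show ?thesis
    proof (rule dini_ge_mono)
      have "\<beta> * cmin - \<omega> \<le> \<beta> * deriv X t - \<omega>" using X_speed \<beta>_pos by simp
      then have "weight (x - X t - b) * (\<beta> * cmin - \<omega>) \<le> weight (x - X t - b) * (\<beta> * deriv X t - \<omega>)"
        using weight_pos[of "x - X t - b"] by (intro mult_left_mono) auto
      then have "conv J (\<lambda>x. weight (x - X t - b)) x - weight (x - X t - b) \<le>
          weight (x - X t - b) * (\<beta> * deriv X t - \<omega>)"
        using cg True by (simp add: mult.commute)
      then have "Q t * (conv J (\<lambda>x. weight (x - X t - b)) x - weight (x - X t - b)) \<le>
          Q t * (weight (x - X t - b) * (\<beta> * deriv X t - \<omega>))" using Q by (intro mult_left_mono)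
      then show "Q t * (conv J (\<lambda>x. weight (x - X t - b)) x - weight (x - X t - b)) -
          (if 0 < x - X t - b then 0 else \<omega> * Q t * weight (x - X t - b)) \<le>
          Q t * exp (- \<beta> * (x - X t - b)) * (\<beta> * deriv X t - \<omega>)"
        using True by (simp add: weight_nonneg mult.assoc)
    qed
  next
    case False
    have D: "dini_ge Q t (- \<omega> * Q t)" using dQ by (rule dini_ge_derivative) simp
    have "\<forall>\<^sub>F s in at_right t. s > t" by (simp add: eventually_at_right_less)
    then have "\<forall>\<^sub>F s in at_right t. Q s * weight (x - X s - b) - Q t * weight (x - X t - b) \<ge> Q s - Q t"
    proof eventually_elim
      case (elim s)
      then show ?case using False X_mono[of t s] by (simp add: weight_neg)
    qed
    then have "dini_ge (\<lambda>s. Q s * weight (x - X s - b)) t (- \<omega> * Q t)"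
      by (rule dini_ge_increment_mono[OF D])
    then show ?thesis
    proof (rule dini_ge_mono)
      have "Q t * (conv J (\<lambda>x. weight (x - X t - b)) x - weight (x - X t - b)) \<le> 0"
        using cg False Q by (intro mult_nonneg_nonpos) auto
      then show "Q t * (conv J (\<lambda>x. weight (x - X t - b)) x - weight (x - X t - b)) -
          (if 0 < x - X t - b then 0 else \<omega> * Q t * weight (x - X t - b)) \<le> - \<omega> * Q t"
        using False by (simp add: weight_neg)
    qed
  qed
qed

lemma weight_strip:
  fixes t1 q :: real
  assumes "0 \<le> q" "t1 \<le> a"
  shows "strip (\<lambda>s x. q * exp (- \<omega> * (s - t1)) * weight (x - X s - b)) a c"
proof (rule stripI[of _ _ _ q])
  fix t x assume t: "a \<le> t"
  show "bcont (\<lambda>x. q * exp (- \<omega> * (t - t1)) * weight (x - X t - b))"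
    by (intro bcont_scale weight_bcont)
  have "exp (- \<omega> * (t - t1)) * weight (x - X t - b) \<le> 1 * 1"
    using t assms \<omega>_pos weight_pos[of "x - X t - b"]
    by (intro mult_mono weight_le_1) (auto simp: mult_nonneg_nonneg)
  then show "\<bar>q * exp (- \<omega> * (t - t1)) * weight (x - X t - b)\<bar> \<le> q"
    using assms weight_pos[of "x - X t - b"] by (simp add: abs_mult mult.assoc mult_left_le)
next
  show "continuous_on {a..c} (\<lambda>s. q * exp (- \<omega> * (s - t1)) * weight (x - X s - b))" for x
    unfolding weight_def by (intro continuous_intros X_cont)
qed

lemma peak_strip: "strip (\<lambda>s x. peak (x - X s)) a c"
proof (rule stripI[of _ _ _ 1])
  show "bcont (\<lambda>x. peak (x - X t))" for t by (rule peak_bcont)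
  show "\<bar>peak (x - X t)\<bar> \<le> 1" for t x using \<eta>_pos by (simp add: peak_def)
  show "continuous_on {a..c} (\<lambda>s. peak (x - X s))" for x
    unfolding peak_def by (intro continuous_intros X_cont)
qed

lemma dini_peak_ahead:
  assumes "0 < x - X t"
  shows "dini_ge (\<lambda>s. peak (x - X s)) t (conv J (\<lambda>x. peak (x - X t)) x - peak (x - X t))"
proof -
  have "((\<lambda>s. exp (- \<eta> * (x - X s))) has_real_derivative
      exp (- \<eta> * (x - X t)) * (\<eta> * deriv X t)) (at t within {t..})"
    by (rule derivative_eq_intros DERIV_subset[OF X_deriv] subset_UNIV refl | simp)+
  then have D: "dini_ge (\<lambda>s. exp (- \<eta> * (x - X s))) t (exp (- \<eta> * (x - X t)) * (\<eta> * deriv X t))"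
    by (rule dini_ge_derivative) simp
  have "\<forall>\<^sub>F s in at_right t. X s < x" using assms by (intro eventually_X_near) simp
  then have "\<forall>\<^sub>F s in at_right t. peak (x - X s) - peak (x - X t) \<ge>
      exp (- \<eta> * (x - X s)) - exp (- \<eta> * (x - X t))"
    by eventually_elim (use assms in \<open>simp add: peak_def\<close>)
  then have "dini_ge (\<lambda>s. peak (x - X s)) t (exp (- \<eta> * (x - X t)) * (\<eta> * deriv X t))"
    by (rule dini_ge_increment_mono[OF D])
  then show ?thesis
  proof (rule dini_ge_mono)
    have "laplace \<eta> - 1 \<le> \<eta> * deriv X t" using \<eta>_ahead X_speed[of t] \<eta>_pos by (smt (verit) mult_left_mono)
    then have "peak (x - X t) * (laplace \<eta> - 1) \<le> peak (x - X t) * (\<eta> * deriv X t)"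
      by (intro mult_left_mono) (auto simp: peak_def)
    moreover have "peak (x - X t) = exp (- \<eta> * (x - X t))" using assms by (simp add: peak_def)
    ultimately show "conv J (\<lambda>x. peak (x - X t)) x - peak (x - X t) \<le> exp (- \<eta> * (x - X t)) * (\<eta> * deriv X t)"
      using conv_peak[of "X t" x] by (simp add: algebra_simps)
  qed
qed

lemma dini_peak_behind:
  assumes "x - X t < 0"
  shows "dini_ge (\<lambda>s. peak (x - X s)) t
    (conv J (\<lambda>x. peak (x - X t)) x - peak (x - X t) - \<kappa> * peak (x - X t))"
proof -
  have "((\<lambda>s. exp (\<eta> * (x - X s))) has_real_derivative
      exp (\<eta> * (x - X t)) * (- \<eta> * deriv X t)) (at t within {t..})"
    by (rule derivative_eq_intros DERIV_subset[OF X_deriv] subset_UNIV refl | simp)+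
  then have D: "dini_ge (\<lambda>s. exp (\<eta> * (x - X s))) t (exp (\<eta> * (x - X t)) * (- \<eta> * deriv X t))"
    by (rule dini_ge_derivative) simp
  have "\<forall>\<^sub>F s in at_right t. s > t" by (simp add: eventually_at_right_less)
  then have "\<forall>\<^sub>F s in at_right t. peak (x - X s) - peak (x - X t) \<ge>
      exp (\<eta> * (x - X s)) - exp (\<eta> * (x - X t))"
  proof eventually_elim
    case (elim s)
    then have "\<bar>x - X s\<bar> = - (x - X s)" "\<bar>x - X t\<bar> = - (x - X t)" using X_mono[of t s] assms by auto
    then show ?case by (simp add: peak_def algebra_simps)
  qed
  then have "dini_ge (\<lambda>s. peak (x - X s)) t (exp (\<eta> * (x - X t)) * (- \<eta> * deriv X t))"
    by (rule dini_ge_increment_mono[OF D])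
  then show ?thesis
  proof (rule dini_ge_mono)
    have "\<eta> * deriv X t \<le> \<eta> * cmax" using X_speed[of t] \<eta>_pos by simp
    then have "laplace \<eta> - 1 - \<kappa> \<le> - \<eta> * deriv X t" using \<eta>_behind by simp
    then have "peak (x - X t) * (laplace \<eta> - 1 - \<kappa>) \<le> peak (x - X t) * (- \<eta> * deriv X t)"
      by (intro mult_left_mono) (auto simp: peak_def)
    moreover have "\<bar>x - X t\<bar> = - (x - X t)" using assms by simp
    then have "peak (x - X t) = exp (\<eta> * (x - X t))" by (simp add: peak_def algebra_simps)
    ultimately show "conv J (\<lambda>x. peak (x - X t)) x - peak (x - X t) - \<kappa> * peak (x - X t)
        \<le> exp (\<eta> * (x - X t)) * (- \<eta> * deriv X t)"
      using conv_peak[of "X t" x] by (simp add: algebra_simps)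
  qed
qed

text \<open>
  Comparison of the increment with \<open>h C exp (- \<eta> \<bar>x - X t\<bar>)\<close>. Within distance \<open>M + 1\<close> of the front
  this dominates because of the Lipschitz bound, so the differential inequality matters only outside,
  where \<open>f\<close> vanishes or is decreasing. The second term dominates the increment at the starting time \<open>s0\<close>.
\<close>

lemma front_increment_barrier:
  assumes regimes: "\<And>t x. M \<le> x - X t \<Longrightarrow> u t x \<le> \<theta>" "\<And>t x. x - X t \<le> - M \<Longrightarrow> \<theta>\<^sub>1 \<le> u t x"
    and "0 < M" and h: "0 \<le> h" "h \<le> 1" and "s0 \<le> t"
  shows "u t x - u t (x + h) \<le> h * (L * exp (\<eta> * (M + 1))) * peak (x - X t) +
    exp (\<beta> * hp) * exp (- \<omega> * (t - s0)) * weight (x - X t - 0)"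
proof -
  define C where "C = L * exp (\<eta> * (M + 1))"
  have C: "0 < C" using L_pos by (simp add: C_def)
  define Q where "Q s = exp (\<beta> * hp) * exp (- \<omega> * (s - s0))" for s
  have Q: "0 < Q s" for s by (simp add: Q_def)
  define z where "z s y = h * C * peak (y - X s) + Q s * weight (y - X s - 0) - (u s y - u s (y + h))" for s y
  have ubc: "bcont (\<lambda>y. u s y - u s (y + h))" for s by (intro bcont_diff u_bcont bcont_shift)
  have "0 \<le> z t x"
  proof (rule comparison_principle[where z=z and a=s0 and b=t and K=K and t=t and x=x])
    show "strip z s0 t"
      unfolding z_def Q_def
      by (intro strip_diff strip_add strip_scale peak_strip weight_strip u_strip u_strip[of 0, simplified]) auto
    show "0 \<le> z s0 y" for y
    proof -
      have "u s0 y \<le> Q s0 * weight (y - X s0 - 0)" using u_le_weight[of s0 y] by (simp add: Q_def)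
      moreover have "0 \<le> h * C * peak (y - X s0)" using h C by (simp add: peak_def)
      ultimately show ?thesis using u_range[of s0 "y + h"] by (simp add: z_def)
    qed
  next
    fix s y assume s: "s0 \<le> s" "s < t" and neg: "z s y \<le> 0"
    define d where "d = u s y - u s (y + h)"
    define F where "F = f s (u s y) - f s (u s (y + h))"
    define cu where "cu = conv J (\<lambda>y. u s y - u s (y + h)) y"
    define cg where "cg = conv J (\<lambda>y. weight (y - X s - 0)) y"
    define cp where "cp = conv J (\<lambda>y. peak (y - X s)) y"
    have "0 < Q s * weight (y - X s - 0)" using Q weight_pos by simp
    then have dpos: "h * C * peak (y - X s) < d" using neg by (simp add: z_def d_def)
    have "d \<le> L * h" using u_lipschitz[of s y "y + h"] h by (simp add: d_def)
    then have hC: "h * (C * peak (y - X s)) < h * L" using dpos by (simp add: mult_ac)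
    then have "C * peak (y - X s) < L" using h by (simp add: mult_less_cancel_left)
    then have "exp (\<eta> * (M + 1) + - \<eta> * \<bar>y - X s\<bar>) < 1"
      using L_pos by (simp add: C_def peak_def exp_add[symmetric])
    then have "\<eta> * (M + 1) < \<eta> * \<bar>y - X s\<bar>" by simp
    then have far: "M + 1 < \<bar>y - X s\<bar>" using \<eta>_pos by simp
    have cz: "conv J (z s) y = h * C * cp + Q s * cg - cu"
      unfolding z_def cu_def cg_def cp_def
      by (subst conv_diff conv_add, (intro bcont_add bcont_scale peak_bcont weight_bcont ubc)+)+ (simp only: conv_scale)
    have du: "dini_ge (\<lambda>s. - (u s y - u s (y + h))) s (- (cu - d + F))"
    proof (rule dini_ge_derivative)
      have cc: "cu = conv J (u s) y - conv J (u s) (y + h)" unfolding cu_def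
        by (subst conv_diff) (auto intro: u_bcont bcont_shift simp: conv_shift)
      have "((\<lambda>s. - (u s y - u s (y + h))) has_real_derivative - ((conv J (u s) y - u s y + f s (u s y)) -
          (conv J (u s) (y + h) - u s (y + h) + f s (u s (y + h))))) (at s within {s..})"
        by (intro derivative_intros DERIV_subset[OF u_deriv]) auto
      then show "((\<lambda>s. - (u s y - u s (y + h))) has_real_derivative - (cu - d + F)) (at s within {s..})"
        by (simp add: cc d_def F_def algebra_simps)
    qed simp
    have dg: "dini_ge (\<lambda>s. Q s * weight (y - X s - 0)) s (Q s * (cg - weight (y - X s - 0)) -
        (if 0 < y - X s - 0 then 0 else \<omega> * Q s * weight (y - X s - 0)))"
      unfolding Q_def cg_def by (rule dini_weight) simp
    have zge: "dini_ge (\<lambda>s. z s y) s (conv J (z s) y - z s y)"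
    proof (cases "0 < y - X s")
      case True
      have "u s y \<le> \<theta>" "u s (y + h) \<le> \<theta>" using True far h by (auto intro!: regimes(1))
      then have "F = 0" by (simp add: F_def f_ignition)
      have "dini_ge (\<lambda>s. peak (y - X s)) s (cp - peak (y - X s))"
        unfolding cp_def using True by (rule dini_peak_ahead)
      then have "dini_ge (\<lambda>s. h * C * peak (y - X s)) s (h * C * (cp - peak (y - X s)))"
        using h C by (intro dini_ge_scale) auto
      from dini_ge_add[OF dini_ge_add[OF this dg] du] show ?thesis
        unfolding cz using True \<open>F = 0\<close> by (simp add: z_def d_def algebra_simps)
    next
      case False
      then have behind: "y - X s < - M - 1" using far by simp
      have "\<theta>\<^sub>1 \<le> u s (y + h)" using behind h by (intro regimes(2)) auto
      then have F: "F \<le> - \<kappa> * d"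
        unfolding F_def d_def using h u_range[of s y] by (intro f_decreasing u_antimono) auto
      have "dini_ge (\<lambda>s. peak (y - X s)) s (cp - peak (y - X s) - \<kappa> * peak (y - X s))"
        unfolding cp_def using behind \<open>0 < M\<close> by (intro dini_peak_behind) auto
      then have "dini_ge (\<lambda>s. h * C * peak (y - X s)) s (h * C * (cp - peak (y - X s) - \<kappa> * peak (y - X s)))"
        using h C by (intro dini_ge_scale) auto
      note D = dini_ge_add[OF dini_ge_add[OF this dg] du]
      have "\<omega> * (Q s * weight (y - X s - 0)) \<le> \<kappa> * (Q s * weight (y - X s - 0))"
        using \<omega>_\<kappa> Q[of s] weight_pos[of "y - X s - 0"] by (intro mult_right_mono) auto
      moreover have "0 \<le> - \<kappa> * z s y" using neg \<kappa>_pos by (simp add: mult_nonneg_nonpos)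
      then have "0 \<le> \<kappa> * d - \<kappa> * (h * C * peak (y - X s)) - \<kappa> * (Q s * weight (y - X s - 0))"
        by (simp add: z_def d_def algebra_simps)
      ultimately have "conv J (z s) y - z s y \<le>
          h * C * (cp - peak (y - X s) - \<kappa> * peak (y - X s)) +
          (Q s * (cg - weight (y - X s - 0)) - \<omega> * Q s * weight (y - X s - 0)) + - (cu - d + F)"
        unfolding cz using F by (simp add: z_def d_def algebra_simps)
      moreover have "(\<lambda>s. z s y) = (\<lambda>s. h * C * peak (y - X s) + Q s * weight (y - X s - 0) + - (u s y - u s (y + h)))"
        by (intro ext) (simp add: z_def)
      ultimately show ?thesis using dini_ge_mono[OF D, of "conv J (z s) y - z s y"] False by simp
    qed
    moreover have "0 \<le> K * \<bar>z s y\<bar>" using K_pos by simp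
    ultimately show "dini_ge (\<lambda>s. z s y) s (conv J (z s) y - z s y - K * \<bar>z s y\<bar>)"
      by (elim dini_ge_mono) simp
  qed (use K_pos \<open>s0 \<le> t\<close> in auto)
  then show ?thesis by (simp add: z_def C_def Q_def)
qed

text \<open>The front is an entire solution, so the barrier's second term disappears as \<open>s0 \<rightarrow> - \<infinity>\<close>.\<close>

lemma front_increment_decay:
  "\<exists>C>0. \<forall>t x h. 0 \<le> h \<longrightarrow> h \<le> 1 \<longrightarrow> u t x - u t (x + h) \<le> C * h * peak (x - X t)"
proof -
  obtain M where M: "0 < M" "\<And>t x. M \<le> x - X t \<Longrightarrow> u t x \<le> min \<theta> (1 - \<theta>\<^sub>1)"
      "\<And>t x. x - X t \<le> - M \<Longrightarrow> 1 - min \<theta> (1 - \<theta>\<^sub>1) \<le> u t x"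
    using front_limits[of "min \<theta> (1 - \<theta>\<^sub>1)"] \<theta>_pos \<theta>\<^sub>1_less by auto
  define C where "C = L * exp (\<eta> * (M + 1))"
  have "u t x - u t (x + h) \<le> C * h * peak (x - X t)" if h: "0 \<le> h" "h \<le> 1" for t x h
  proof (rule LIMSEQ_le_const)
    define B where "B = exp (\<beta> * hp) * weight (x - X t - 0)"
    have "(\<lambda>n. C * h * peak (x - X t) + B * exp (- \<omega>) ^ n) \<longlonglongrightarrow> C * h * peak (x - X t) + B * 0"
      using \<omega>_pos by (intro tendsto_intros LIMSEQ_power_zero) auto
    then show "(\<lambda>n. C * h * peak (x - X t) + B * exp (- \<omega>) ^ n) \<longlonglongrightarrow> C * h * peak (x - X t)" by simp
    have "u t x - u t (x + h) \<le> C * h * peak (x - X t) + B * exp (- \<omega>) ^ n" for n :: nat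
    proof -
      have "u t x - u t (x + h) \<le> h * (L * exp (\<eta> * (M + 1))) * peak (x - X t) +
          exp (\<beta> * hp) * exp (- \<omega> * (t - (t - real n))) * weight (x - X t - 0)"
      proof (rule front_increment_barrier[OF _ _ M(1) h])
        show "u t x \<le> \<theta>" if "M \<le> x - X t" for t x using M(2)[OF that] by simp
        show "\<theta>\<^sub>1 \<le> u t x" if "x - X t \<le> - M" for t x using M(3)[OF that] by linarith
      qed simp
      then show ?thesis by (simp add: B_def C_def exp_of_nat_mult[symmetric] mult_ac)
    qed
    then show "\<exists>N. \<forall>n\<ge>N. u t x - u t (x + h) \<le> C * h * peak (x - X t) + B * exp (- \<omega>) ^ n" by blast
  qed
  moreover have "0 < C" using L_pos by (simp add: C_def)
  ultimately show ?thesis by blast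
qed

end


section \<open>Trapping between shifted fronts\<close>

context weighted_front begin

text \<open>
  The sign \<open>\<sigma>\<close> treats upper (\<open>\<sigma> = 1\<close>) and lower (\<open>\<sigma> = - 1\<close>) bounds at once. The shift moves outwards
  from \<open>b\<close> by at most \<open>A q\<close>.
\<close>

definition moving_shift :: "real \<Rightarrow> real \<Rightarrow> real \<Rightarrow> real \<Rightarrow> real \<Rightarrow> real \<Rightarrow> real" where
  "moving_shift A \<sigma> b q t1 t = b + \<sigma> * (A * q * (1 - exp (- \<omega> * (t - t1))))"

text \<open>By how much the solution \<open>v\<close> respects the upper or lower bound; the weight stays centred at the initial shift \<open>b\<close>.\<close>

definition margin :: "real \<Rightarrow> real \<Rightarrow> real \<Rightarrow> real \<Rightarrow> real \<Rightarrow> (real \<Rightarrow> real \<Rightarrow> real) \<Rightarrow> real \<Rightarrow> real \<Rightarrow> real" where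
  "margin A \<sigma> b q t1 v t x = \<sigma> * (u t (x - moving_shift A \<sigma> b q t1 t) - v t x) +
     q * exp (- \<omega> * (t - t1)) * weight (x - X t - b)"

lemma u_along_shift_cont:
  assumes "continuous_on S \<zeta>" shows "continuous_on S (\<lambda>t. u t (x - \<zeta> t))"
  unfolding continuous_on_def
proof
  fix t assume t: "t \<in> S"
  have 1: "((\<lambda>s. u s (x - \<zeta> t)) \<longlongrightarrow> u t (x - \<zeta> t)) (at t within S)"
    using DERIV_isCont[OF u_deriv] by (auto simp: isCont_def intro: tendsto_within_subset)
  have "((\<lambda>s. L * \<bar>\<zeta> s - \<zeta> t\<bar>) \<longlongrightarrow> L * \<bar>\<zeta> t - \<zeta> t\<bar>) (at t within S)"
    using assms t by (intro tendsto_intros) (auto simp: continuous_on_def)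
  then have "((\<lambda>s. L * \<bar>\<zeta> s - \<zeta> t\<bar>) \<longlongrightarrow> 0) (at t within S)" by simp
  then have 2: "((\<lambda>s. u s (x - \<zeta> s) - u s (x - \<zeta> t)) \<longlongrightarrow> 0) (at t within S)"
  proof (rule Lim_null_comparison[rotated])
    show "\<forall>\<^sub>F s in at t within S. norm (u s (x - \<zeta> s) - u s (x - \<zeta> t)) \<le> L * \<bar>\<zeta> s - \<zeta> t\<bar>"
    proof (intro always_eventually allI)
      fix s
      show "norm (u s (x - \<zeta> s) - u s (x - \<zeta> t)) \<le> L * \<bar>\<zeta> s - \<zeta> t\<bar>"
        using u_lipschitz[of s "x - \<zeta> s" "x - \<zeta> t"] by (simp add: abs_minus_commute)
    qed
  qed
  show "((\<lambda>s. u s (x - \<zeta> s)) \<longlongrightarrow> u t (x - \<zeta> t)) (at t within S)"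
    using tendsto_add[OF 1 2] by simp
qed

lemma moving_shift_cont: "continuous_on S (moving_shift A \<sigma> b q t1)"
  unfolding moving_shift_def by (intro continuous_intros)

lemma margin_strip:
  assumes "sol v t1" "0 \<le> q" "t1 \<le> a"
  shows "strip (margin A \<sigma> b q t1 v) a c"
proof -
  have "strip (\<lambda>t x. u t (x - moving_shift A \<sigma> b q t1 t)) a c"
  proof (rule stripI[of _ _ _ 1])
    show "bcont (\<lambda>x. u t (x - moving_shift A \<sigma> b q t1 t))" for t
      using bcont_shift[OF u_bcont[of t], of "- moving_shift A \<sigma> b q t1 t"] by simp
    show "continuous_on {a..c} (\<lambda>t. u t (x - moving_shift A \<sigma> b q t1 t))" for x
      by (intro u_along_shift_cont moving_shift_cont)
    show "\<bar>u t (x - moving_shift A \<sigma> b q t1 t)\<bar> \<le> 1" for t x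
      using u_range[of t "x - moving_shift A \<sigma> b q t1 t"] by simp
  qed
  moreover have "strip v a c" using sol_later[OF assms(1,3)] by (simp add: sol_def)
  ultimately show ?thesis
    unfolding margin_def using assms(2,3) by (intro strip_add strip_scale strip_diff weight_strip) auto
qed

text \<open>In the transition zone, steepness converts the outward motion of the shift into a gain proportional to \<open>\<alpha>\<close>.\<close>

lemma shift_gain:
  assumes \<sigma>: "\<sigma> = 1 \<or> \<sigma> = - 1" and "0 \<le> A" "0 \<le> q" "t1 \<le> t"
    and mid: "\<bar>x - moving_shift A \<sigma> b q t1 t - X t\<bar> \<le> M"
    and steep: "\<And>t x h. \<bar>x - X t\<bar> \<le> M + 2 \<Longrightarrow> 0 \<le> h \<Longrightarrow> h \<le> \<rho> \<Longrightarrow> \<alpha> * h \<le> u t x - u t (x + h)"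
  shows "\<forall>\<^sub>F s in at_right t. \<sigma> * u s (x - moving_shift A \<sigma> b q t1 t) +
      \<alpha> * (A * q * (exp (- \<omega> * (t - t1)) - exp (- \<omega> * (s - t1)))) \<le> \<sigma> * u s (x - moving_shift A \<sigma> b q t1 s)"
proof -
  define y where "y = x - moving_shift A \<sigma> b q t1 t"
  define h where "h s = A * q * (exp (- \<omega> * (t - t1)) - exp (- \<omega> * (s - t1)))" for s
  have "((\<lambda>s. h s) \<longlongrightarrow> h t) (at_right t)" unfolding h_def by (intro tendsto_intros)
  then have "\<forall>\<^sub>F s in at_right t. h s < min 1 \<rho>"
    using \<rho>_pos by (intro order_tendstoD) (auto simp: h_def)
  moreover have "\<forall>\<^sub>F s in at_right t. X s < X t + 1" by (intro eventually_X_near) simp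
  moreover have "\<forall>\<^sub>F s in at_right t. s > t" by (simp add: eventually_at_right_less)
  ultimately show ?thesis
  proof eventually_elim
    case (elim s)
    have X: "X t \<le> X s" using X_mono elim(3) by simp
    have "\<omega> * (t - t1) \<le> \<omega> * (s - t1)" using elim(3) \<omega>_pos by simp
    then have h0: "0 \<le> h s" unfolding h_def using assms by (intro mult_nonneg_nonneg) auto
    have shift: "x - moving_shift A \<sigma> b q t1 s = y - \<sigma> * h s"
      by (simp add: y_def moving_shift_def h_def algebra_simps)
    show ?case using \<sigma>
    proof
      assume "\<sigma> = 1"
      have "\<alpha> * h s \<le> u s (y - h s) - u s (y - h s + h s)"
        using mid elim X h0 by (intro steep) (auto simp: y_def[symmetric] abs_le_iff)
      then show ?thesis unfolding shift h_def[symmetric] y_def[symmetric] using \<open>\<sigma> = 1\<close> by simp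
    next
      assume "\<sigma> = - 1"
      have "\<alpha> * h s \<le> u s y - u s (y + h s)"
        using mid elim X h0 by (intro steep) (auto simp: y_def[symmetric] abs_le_iff)
      then show ?thesis unfolding shift h_def[symmetric] y_def[symmetric] using \<open>\<sigma> = - 1\<close> by simp
    qed
  qed
qed

lemma shift_no_loss:
  assumes \<sigma>: "\<sigma> = 1 \<or> \<sigma> = - 1" and "0 \<le> A" "0 \<le> q" "s \<le> t"
  shows "\<sigma> * u \<tau> (x - moving_shift A \<sigma> b q t1 s) \<le> \<sigma> * u \<tau> (x - moving_shift A \<sigma> b q t1 t)"
proof -
  have "\<omega> * (s - t1) \<le> \<omega> * (t - t1)" using assms \<omega>_pos by simp
  then have "A * q * (1 - exp (- \<omega> * (s - t1))) \<le> A * q * (1 - exp (- \<omega> * (t - t1)))"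
    using assms by (intro mult_left_mono) auto
  then show ?thesis using \<sigma> by (auto simp: moving_shift_def intro!: u_antimono)
qed

text \<open>
  The reaction terms are compared through \<open>W = u \<plusminus> q exp (- \<omega> t) \<Gamma>\<close>. Passing from \<open>W\<close> to \<open>v\<close> costs \<open>K \<bar>z\<bar>\<close>, which the inequality
  allows. Passing from \<open>u\<close> to \<open>W\<close> costs nothing ahead of the front, helps behind it, and is paid for by
  the moving shift in between.
\<close>

lemma margin_supersol:
  assumes \<sigma>: "\<sigma> = 1 \<or> \<sigma> = - 1" and v: "sol v t1" and A: "0 < A" and q: "0 \<le> q" "A * q \<le> 1"
      "q \<le> \<theta> / 2" "q \<le> (1 - \<theta>\<^sub>1) / 2" "q \<le> 1"
    and M: "1 < M" "\<And>t x. M \<le> x - X t \<Longrightarrow> u t x \<le> \<theta> / 2" "\<And>t x. x - X t \<le> - M \<Longrightarrow> (1 + \<theta>\<^sub>1) / 2 \<le> u t x"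
    and steep: "\<And>t x h. \<bar>x - X t\<bar> \<le> M + 2 \<Longrightarrow> 0 \<le> h \<Longrightarrow> h \<le> \<rho> \<Longrightarrow> \<alpha> * h \<le> u t x - u t (x + h)"
    and \<alpha>: "K + \<omega> \<le> \<alpha> * A * \<omega>"
  shows "supersol K (margin A \<sigma> b q t1 v) t1 t2"
  unfolding supersol_def
proof (intro conjI allI impI)
  show "strip (margin A \<sigma> b q t1 v) t1 t2" using v q by (intro margin_strip) auto
  fix t x assume t: "t1 \<le> t" "t < t2"
  define \<zeta> where "\<zeta> = moving_shift A \<sigma> b q t1"
  define e where "e s = exp (- \<omega> * (s - t1))" for s
  define y where "y = x - \<zeta> t"
  define \<xi> where "\<xi> = x - X t - b"
  define U where "U = u t y"
  define V where "V = v t x"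
  define Q where "Q = q * e t"
  define g where "g = Q * weight \<xi>"
  define cg where "cg = conv J (\<lambda>x. weight (x - X t - b)) x"
  define z where "z = margin A \<sigma> b q t1 v t x"
  define B where "B = (if \<bar>y - X t\<bar> \<le> M then \<alpha> * A else 0)"
  have e: "0 < e s" "t1 \<le> s \<Longrightarrow> e s \<le> 1" for s using \<omega>_pos by (auto simp: e_def)
  have Q: "0 \<le> Q" "Q \<le> q" using q e[of t] t by (auto simp: Q_def mult_left_le)
  have g: "0 \<le> g" "g \<le> Q" using Q weight_pos[of \<xi>] weight_le_1[of \<xi>] by (auto simp: g_def mult_left_le)
  have zeq: "z = \<sigma> * (U - V) + g"
    by (simp add: z_def margin_def U_def V_def g_def Q_def e_def \<xi>_def y_def \<zeta>_def)
  have cz: "conv J (margin A \<sigma> b q t1 v t) x = \<sigma> * (conv J (u t) y - conv J (v t) x) + Q * cg"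
  proof -
    have bu: "bcont (\<lambda>x. u t (x - \<zeta> t))" using bcont_shift[OF u_bcont[of t], of "- \<zeta> t"] by simp
    have bv: "bcont (v t)" using v t stripD(1)[of v t1 t t] by (auto simp: sol_def)
    have "margin A \<sigma> b q t1 v t = (\<lambda>x. \<sigma> * (u t (x - \<zeta> t) - v t x) + Q * weight (x - X t - b))"
      by (intro ext) (simp add: margin_def \<zeta>_def Q_def e_def)
    then have "conv J (margin A \<sigma> b q t1 v t) x =
        \<sigma> * (conv J (\<lambda>x. u t (x - \<zeta> t)) x - conv J (v t) x) + Q * cg"
      using bu bv by (simp only: conv_add bcont_scale bcont_diff weight_bcont conv_scale conv_diff cg_def)
    then show ?thesis using conv_shift[of "u t" "- \<zeta> t" x] by (simp add: y_def)
  qed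
  \<comment> \<open>The part of the margin with the shift frozen at time \<open>t\<close>, plus the gain from moving it; differentiable in time.\<close>
  define R where "R s = \<sigma> * (u s y - v s x) - B * (q * e s)" for s
  have "((\<lambda>s. R s) has_real_derivative \<sigma> * ((conv J (u t) y - U + f t U) -
      (conv J (v t) x - V + f t V)) - B * (q * (- \<omega> * e t))) (at t within {t1..})"
  proof -
    have "((\<lambda>s. v s x) has_real_derivative conv J (v t) x - V + f t V) (at t within {t1..})"
      using v t by (auto simp: sol_def V_def)
    moreover have "((\<lambda>s. u s y) has_real_derivative conv J (u t) y - U + f t U) (at t within {t1..})"
      unfolding U_def by (rule DERIV_subset[OF u_deriv]) simp
    moreover have "(e has_real_derivative - \<omega> * e t) (at t within {t1..})"
      unfolding e_def by (rule derivative_eq_intros refl | simp)+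
    ultimately show ?thesis unfolding R_def by (intro DERIV_diff DERIV_cmult)
  qed
  then have dR: "dini_ge R t (\<sigma> * ((conv J (u t) y - U + f t U) - (conv J (v t) x - V + f t V)) + B * \<omega> * Q)"
    using t(1) by (auto simp: Q_def algebra_simps dest!: dini_ge_derivative)
  have dg: "dini_ge (\<lambda>s. q * e s * weight (x - X s - b)) t (Q * (cg - weight \<xi>) - (if 0 < \<xi> then 0 else \<omega> * g))"
    using dini_weight[OF q(1), of t1 x b t] unfolding Q_def e_def cg_def \<xi>_def g_def
    by (simp only: mult.assoc)
  have meq: "margin A \<sigma> b q t1 v s x = \<sigma> * (u s (x - \<zeta> s) - v s x) + q * e s * weight (x - X s - b)" for s
    by (simp add: margin_def \<zeta>_def e_def)
  have "\<forall>\<^sub>F s in at_right t. margin A \<sigma> b q t1 v s x - margin A \<sigma> b q t1 v t x \<ge>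
      (R s + q * e s * weight (x - X s - b)) - (R t + q * e t * weight (x - X t - b))"
  proof (cases "\<bar>y - X t\<bar> \<le> M")
    case True
    have "\<forall>\<^sub>F s in at_right t. \<sigma> * u s y + \<alpha> * (A * q * (e t - e s)) \<le> \<sigma> * u s (x - \<zeta> s)"
      unfolding y_def \<zeta>_def e_def
      using True \<sigma> A q t steep by (intro shift_gain[where M=M]) (auto simp: y_def \<zeta>_def)
    then show ?thesis
      unfolding meq by eventually_elim (use True in \<open>simp add: R_def B_def y_def[symmetric] algebra_simps\<close>)
  next
    case False
    have "\<forall>\<^sub>F s in at_right t. s > t" by (simp add: eventually_at_right_less)
    then show ?thesis
      unfolding meq
    proof eventually_elim
      case (elim s)
      have "\<sigma> * u s y \<le> \<sigma> * u s (x - \<zeta> s)"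
        unfolding y_def \<zeta>_def using \<sigma> A q elim by (intro shift_no_loss) auto
      then show ?case using False by (simp add: R_def B_def y_def[symmetric] algebra_simps)
    qed
  qed
  then have D: "dini_ge (\<lambda>s. margin A \<sigma> b q t1 v s x) t
      (\<sigma> * ((conv J (u t) y - U + f t U) - (conv J (v t) x - V + f t V)) + B * \<omega> * Q +
       (Q * (cg - weight \<xi>) - (if 0 < \<xi> then 0 else \<omega> * g)))"
    by (rule dini_ge_increment_mono[OF dini_ge_add[OF dR dg]])
  define W where "W = U + \<sigma> * g"
  have zW: "\<bar>z\<bar> = \<bar>W - V\<bar>" using \<sigma> unfolding zeq W_def by auto
  have fWV: "- (K * \<bar>z\<bar>) \<le> \<sigma> * (f t W - f t V)"
    using f_lipschitz[of t W V] \<sigma> unfolding zW by auto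
  have key: "0 \<le> \<sigma> * (f t U - f t W) + B * \<omega> * Q - (if 0 < \<xi> then 0 else \<omega> * g)"
  proof -
    consider "M < y - X t" | "y - X t < - M" | "\<bar>y - X t\<bar> \<le> M" by linarith
    then show ?thesis
    proof cases
      case 1
      have "U \<le> \<theta> / 2" unfolding U_def using 1 by (intro M(2)) auto
      then have "f t U = 0" "f t W = 0" using g Q q \<theta>_pos \<sigma> by (auto simp: W_def intro!: f_ignition)
      moreover have "\<bar>\<zeta> t - b\<bar> \<le> 1"
      proof -
        have "\<bar>\<zeta> t - b\<bar> = A * q * (1 - e t)"
          using \<sigma> A q e[of t] t by (auto simp: \<zeta>_def moving_shift_def e_def abs_mult)
        also have "\<dots> \<le> A * q" using A q e[of t] by (auto intro!: mult_left_le)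
        finally show ?thesis using q by simp
      qed
      then have "0 < \<xi>" using 1 M(1) by (simp add: \<xi>_def y_def)
      ultimately show ?thesis using 1 by (simp add: B_def)
    next
      case 2
      have U: "(1 + \<theta>\<^sub>1) / 2 \<le> U" unfolding U_def using 2 by (intro M(3)) auto
      have U1: "U \<le> 1" unfolding U_def using u_range[of t y] by simp
      have "\<kappa> * g \<le> \<sigma> * (f t U - f t W)" using \<sigma>
      proof
        assume s: "\<sigma> = 1"
        then have "f t W - f t U \<le> - \<kappa> * (W - U)"
          using U U1 g Q q \<theta>\<^sub>1_less by (intro f_decreasing) (auto simp: W_def)
        then show ?thesis using s by (simp add: W_def)
      next
        assume s: "\<sigma> = - 1"
        then have "f t U - f t W \<le> - \<kappa> * (U - W)"
          using U U1 g Q q by (intro f_decreasing) (auto simp: W_def field_simps)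
        then show ?thesis using s by (simp add: W_def)
      qed
      moreover have "\<omega> * g \<le> \<kappa> * g" using \<omega>_\<kappa> g by (intro mult_right_mono) auto
      moreover have "0 \<le> \<omega> * g" using \<omega>_pos g by simp
      ultimately show ?thesis using 2 M(1) by (auto simp: B_def)
    next
      case 3
      have "- (K * g) \<le> \<sigma> * (f t U - f t W)"
        using f_lipschitz[of t U W] \<sigma> g by (auto simp: W_def)
      moreover have "K * g + \<omega> * g \<le> (K + \<omega>) * Q" using mult_left_mono[OF g(2), of "K + \<omega>"] K_pos \<omega>_pos
        by (simp add: algebra_simps)
      moreover have "(K + \<omega>) * Q \<le> \<alpha> * A * \<omega> * Q" using \<alpha> Q by (intro mult_right_mono) auto
      moreover have "0 \<le> \<omega> * g" using \<omega>_pos g by simp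
      ultimately show ?thesis using 3 by (auto simp: B_def)
    qed
  qed
  show "dini_ge (\<lambda>s. margin A \<sigma> b q t1 v s x) t (conv J (margin A \<sigma> b q t1 v t) x - margin A \<sigma> b q t1 v t x -
      K * \<bar>margin A \<sigma> b q t1 v t x\<bar>)"
  proof (rule dini_ge_mono[OF D])
    have "\<sigma> * ((conv J (u t) y - U + f t U) - (conv J (v t) x - V + f t V)) + B * \<omega> * Q +
       (Q * (cg - weight \<xi>) - (if 0 < \<xi> then 0 else \<omega> * g)) =
       (conv J (margin A \<sigma> b q t1 v t) x - z) + \<sigma> * (f t W - f t V) +
       (\<sigma> * (f t U - f t W) + B * \<omega> * Q - (if 0 < \<xi> then 0 else \<omega> * g))"
      unfolding cz zeq g_def by (simp add: algebra_simps)
    then show "conv J (margin A \<sigma> b q t1 v t) x - margin A \<sigma> b q t1 v t x - K * \<bar>margin A \<sigma> b q t1 v t x\<bar> \<le>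
       \<sigma> * ((conv J (u t) y - U + f t U) - (conv J (v t) x - V + f t V)) + B * \<omega> * Q +
       (Q * (cg - weight \<xi>) - (if 0 < \<xi> then 0 else \<omega> * g))"
      using fWV key unfolding z_def[symmetric] by linarith
  qed
qed

definition barrier_constants :: "real \<Rightarrow> real \<Rightarrow> bool" where
  "barrier_constants A q0 \<longleftrightarrow> 0 < A \<and> 0 < q0 \<and> q0 \<le> 1 \<and> A * q0 \<le> 1 \<and>
     (\<forall>\<sigma> v b q t1 t2. (\<sigma> = 1 \<or> \<sigma> = - 1) \<longrightarrow> sol v t1 \<longrightarrow> 0 \<le> q \<longrightarrow> q \<le> q0 \<longrightarrow>
        supersol K (margin A \<sigma> b q t1 v) t1 t2)"

lemma barrier_constants_exist: "\<exists>A q0. barrier_constants A q0"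
proof -
  define \<epsilon> where "\<epsilon> = min (\<theta> / 2) ((1 - \<theta>\<^sub>1) / 2)"
  have \<epsilon>: "0 < \<epsilon>" using \<theta>_pos \<theta>\<^sub>1_less by (simp add: \<epsilon>_def)
  obtain M0 where M0: "\<And>t x. M0 \<le> x - X t \<Longrightarrow> u t x \<le> \<epsilon>" "\<And>t x. x - X t \<le> - M0 \<Longrightarrow> 1 - \<epsilon> \<le> u t x"
    using front_limits[OF \<epsilon>] by blast
  define M where "M = max M0 2"
  obtain \<alpha> where \<alpha>: "0 < \<alpha>" "\<And>t x h. \<bar>x - X t\<bar> \<le> M + 2 \<Longrightarrow> 0 \<le> h \<Longrightarrow> h \<le> \<rho> \<Longrightarrow> \<alpha> * h \<le> u t x - u t (x + h)"
    using front_steepness[of "M + 2"] by blast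
  define A where "A = (K + \<omega>) / (\<alpha> * \<omega>)"
  have A: "0 < A" "K + \<omega> \<le> \<alpha> * A * \<omega>" using \<alpha>(1) K_pos \<omega>_pos by (auto simp: A_def)
  define q0 where "q0 = min (min \<epsilon> 1) (1 / A)"
  have q0: "0 < q0" "q0 \<le> \<epsilon>" "q0 \<le> 1" "q0 \<le> 1 / A" using \<epsilon> A by (auto simp: q0_def)
  have q1: "A * q \<le> 1" if "q \<le> q0" for q using mult_left_mono[of q "1 / A" A] that q0(4) A(1) by simp
  have "supersol K (margin A \<sigma> b q t1 v) t1 t2"
    if "\<sigma> = 1 \<or> \<sigma> = - 1" "sol v t1" "0 \<le> q" "q \<le> q0" for \<sigma> v b q t1 t2
  proof (rule margin_supersol[where M=M and \<alpha>=\<alpha>])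
    show "q \<le> \<theta> / 2" "q \<le> (1 - \<theta>\<^sub>1) / 2" using that(4) q0(2) by (auto simp: \<epsilon>_def)
    show "u t x \<le> \<theta> / 2" if "M \<le> x - X t" for t x
    proof -
      have "u t x \<le> \<epsilon>" using that by (intro M0(1)) (simp add: M_def)
      then show ?thesis by (simp add: \<epsilon>_def)
    qed
    show "(1 + \<theta>\<^sub>1) / 2 \<le> u t x" if "x - X t \<le> - M" for t x
    proof -
      have "1 - \<epsilon> \<le> u t x" using that by (intro M0(2)) (simp add: M_def)
      moreover have "\<epsilon> \<le> (1 - \<theta>\<^sub>1) / 2" unfolding \<epsilon>_def by (rule min.cobounded2)
      ultimately show ?thesis by (simp add: field_simps)
    qed
  qed (use that q0 q1 A \<alpha> in \<open>auto simp: M_def\<close>)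
  then show ?thesis using A q0 q1[of q0] unfolding barrier_constants_def by blast
qed

text \<open>Centring the weight at the current shift, not at an earlier one, lets bounds at successive times be chained.\<close>

definition trapped :: "real \<Rightarrow> (real \<Rightarrow> real) \<Rightarrow> real \<Rightarrow> real \<Rightarrow> real \<Rightarrow> bool" where
  "trapped \<sigma> g t b q \<longleftrightarrow> (\<forall>x. 0 \<le> \<sigma> * (u t (x - b) - g x) + q * weight (x - X t - b))"

lemma trapped_mono: "trapped \<sigma> g t b q \<Longrightarrow> q \<le> q' \<Longrightarrow> trapped \<sigma> g t b q'"
  unfolding trapped_def by (meson add_left_mono weight_pos less_imp_le mult_right_mono order_trans)

lemma weight_recentre: "\<bar>b' - b\<bar> \<le> 2 \<Longrightarrow> weight (x - X t - b) \<le> 2 * weight (x - X t - b')"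
proof -
  assume b: "\<bar>b' - b\<bar> \<le> 2"
  have "\<beta> * \<bar>b - b'\<bar> \<le> \<beta> * 2" using b \<beta>_pos by (intro mult_left_mono) auto
  also have "\<dots> \<le> ln 2" using \<eta>_small ln2_ge_two_thirds by (simp add: \<beta>_def)
  finally have "exp (\<beta> * \<bar>b - b'\<bar>) \<le> exp (ln 2)" by (simp only: exp_le_cancel_iff)
  then have "exp (\<beta> * \<bar>b - b'\<bar>) \<le> 2" by simp
  then have "exp (\<beta> * \<bar>b - b'\<bar>) * weight (x - X t - b') \<le> 2 * weight (x - X t - b')"
    using weight_pos[of "x - X t - b'"] by (intro mult_right_mono) auto
  then show ?thesis using weight_shift[of "x - X t - b" "b - b'"] by (simp add: algebra_simps)
qed

end

text \<open>The number \<open>q0\<close> is the largest admissible error, \<open>A\<close> the total drift of the shift per unit of error.\<close>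

locale squeezed_front = weighted_front +
  fixes A q0 :: real
  assumes barrier: "barrier_constants A q0"
begin

lemma A_pos: "0 < A" and q0_pos: "0 < q0" and q0_le_1: "q0 \<le> 1" and Aq0: "A * q0 \<le> 1"
  using barrier by (auto simp: barrier_constants_def)

lemma Aq_le_1: "q \<le> q0 \<Longrightarrow> A * q \<le> 1"
  using A_pos Aq0 by (meson less_imp_le mult_left_mono order_trans)

lemma margin_preserved:
  assumes \<sigma>: "\<sigma> = 1 \<or> \<sigma> = - 1" and v: "sol v t1" and q: "0 \<le> q" "q \<le> q0"
    and T: "trapped \<sigma> (v t1) t1 b q" and t: "t1 \<le> t"
  shows "0 \<le> margin A \<sigma> b q t1 v t x"
proof (rule comparison_principle[where z="margin A \<sigma> b q t1 v" and a=t1 and b=t and K=K])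
  have S: "supersol K (margin A \<sigma> b q t1 v) t1 t"
    using barrier \<sigma> v q unfolding barrier_constants_def by blast
  then show "strip (margin A \<sigma> b q t1 v) t1 t" by (simp add: supersol_def)
  show "0 \<le> margin A \<sigma> b q t1 v t1 x" for x
    using T by (simp add: trapped_def margin_def moving_shift_def)
  show "dini_ge (\<lambda>s. margin A \<sigma> b q t1 v s x) s (conv J (margin A \<sigma> b q t1 v s) x -
      margin A \<sigma> b q t1 v s x - K * \<bar>margin A \<sigma> b q t1 v s x\<bar>)" if "t1 \<le> s" "s < t" for s x
    using S that by (simp add: supersol_def)
qed (use t K_pos in auto)

lemma moving_shift_limit:
  assumes \<sigma>: "\<sigma> = 1 \<or> \<sigma> = - 1" and q: "0 \<le> q"
  shows "\<sigma> * u t (x - moving_shift A \<sigma> b q t1 s) \<le> \<sigma> * u t (x - (b + \<sigma> * (A * q)))"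
proof -
  have "A * q * (1 - exp (- \<omega> * (s - t1))) \<le> A * q" using A_pos q by (intro mult_left_le) auto
  then show ?thesis using \<sigma> by (auto simp: moving_shift_def intro!: u_antimono)
qed

lemma trapped_propagates:
  assumes \<sigma>: "\<sigma> = 1 \<or> \<sigma> = - 1" and v: "sol v t1" and q: "0 \<le> q" "q \<le> q0"
    and T: "trapped \<sigma> (v t1) t1 b q" and t: "t1 \<le> t"
  shows "trapped \<sigma> (v t) t (b + \<sigma> * (A * q)) (2 * (q * exp (- \<omega> * (t - t1))))"
  unfolding trapped_def
proof
  fix x
  have "0 \<le> margin A \<sigma> b q t1 v t x" by (rule margin_preserved[OF assms])
  moreover have "weight (x - X t - b) \<le> 2 * weight (x - X t - (b + \<sigma> * (A * q)))"
    using \<sigma> Aq_le_1[OF q(2)] A_pos q by (intro weight_recentre) (auto simp: abs_mult)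
  then have "q * exp (- \<omega> * (t - t1)) * weight (x - X t - b) \<le>
      q * exp (- \<omega> * (t - t1)) * (2 * weight (x - X t - (b + \<sigma> * (A * q))))"
    using q by (intro mult_left_mono) auto
  ultimately show "0 \<le> \<sigma> * (u t (x - (b + \<sigma> * (A * q))) - v t x) +
      2 * (q * exp (- \<omega> * (t - t1))) * weight (x - X t - (b + \<sigma> * (A * q)))"
    using moving_shift_limit[OF \<sigma> q(1), of t x b t1 t] unfolding margin_def
    by (simp add: algebra_simps)
qed

lemma peak_shift: "peak y \<le> exp (\<eta> * \<bar>a\<bar>) * peak (y + a)"
proof -
  have "\<eta> * \<bar>y + a\<bar> \<le> \<eta> * (\<bar>a\<bar> + \<bar>y\<bar>)" using \<eta>_pos by (intro mult_left_mono) auto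
  then show ?thesis by (simp add: peak_def exp_add[symmetric] algebra_simps)
qed

text \<open>The price for moving a bound inwards by \<open>d\<close>, linear in \<open>d\<close> and exponentially small away from the front.\<close>

lemma shift_loss:
  "\<exists>C>0. \<forall>\<sigma> t x b b' d. (\<sigma> = 1 \<or> \<sigma> = - 1) \<longrightarrow> 0 \<le> d \<longrightarrow> d \<le> 1 \<longrightarrow> \<bar>b' - b\<bar> \<le> 1 \<longrightarrow>
    \<sigma> * u t (x - b') - C * d * peak (x - X t - b) \<le> \<sigma> * u t (x - (b' - \<sigma> * d))"
proof -
  obtain C where C: "0 < C" "\<And>t x h. 0 \<le> h \<Longrightarrow> h \<le> 1 \<Longrightarrow> u t x - u t (x + h) \<le> C * h * peak (x - X t)"
    using front_increment_decay by blast
  have "\<sigma> * u t (x - b') - C * exp (\<eta> * 2) * d * peak (x - X t - b) \<le> \<sigma> * u t (x - (b' - \<sigma> * d))"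
    if \<sigma>: "\<sigma> = 1 \<or> \<sigma> = - 1" and d: "0 \<le> d" "d \<le> 1" and b: "\<bar>b' - b\<bar> \<le> 1" for \<sigma> t x b b' d
  proof -
    have bound: "C * d * peak (y - X t) \<le> C * exp (\<eta> * 2) * d * peak (x - X t - b)"
      if y: "\<bar>x - b - y\<bar> \<le> 2" for y
    proof -
      have "\<eta> * \<bar>x - b - y\<bar> \<le> \<eta> * 2" using y \<eta>_pos by (intro mult_left_mono) auto
      then have "exp (\<eta> * \<bar>x - b - y\<bar>) * peak (x - X t - b) \<le> exp (\<eta> * 2) * peak (x - X t - b)"
        by (intro mult_right_mono) (auto simp: peak_def)
      moreover have "peak (y - X t) \<le> exp (\<eta> * \<bar>x - b - y\<bar>) * peak (y - X t + (x - b - y))"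
        by (rule peak_shift)
      then have "peak (y - X t) \<le> exp (\<eta> * \<bar>x - b - y\<bar>) * peak (x - X t - b)"
        by (simp add: algebra_simps)
      ultimately have "peak (y - X t) \<le> exp (\<eta> * 2) * peak (x - X t - b)" by linarith
      then have "C * d * peak (y - X t) \<le> C * d * (exp (\<eta> * 2) * peak (x - X t - b))"
        using C(1) d by (intro mult_left_mono) auto
      then show ?thesis by (simp add: mult_ac)
    qed
    show ?thesis using \<sigma>
    proof
      assume s: "\<sigma> = 1"
      have "u t (x - b') - u t (x - b' + d) \<le> C * d * peak (x - b' - X t)" by (rule C(2)[OF d])
      also have "\<dots> \<le> C * exp (\<eta> * 2) * d * peak (x - X t - b)" using b by (intro bound) auto
      finally show ?thesis using s by (simp add: algebra_simps)
    next
      assume s: "\<sigma> = - 1"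
      have "u t (x - b' - d) - u t (x - b' - d + d) \<le> C * d * peak (x - b' - d - X t)" by (rule C(2)[OF d])
      also have "\<dots> \<le> C * exp (\<eta> * 2) * d * peak (x - X t - b)" using b d by (intro bound) auto
      finally show ?thesis using s by (simp add: algebra_simps)
    qed
  qed
  moreover have "0 < C * exp (\<eta> * 2)" using C(1) by simp
  ultimately show ?thesis by blast
qed

text \<open>
  The trade-off behind one contraction step: mass of the margin buys an inward shift, at a price in \<open>q\<close> that is
  small if \<open>\<mu>\<close> is. The factor \<open>2\<close> comes from recentring the weight.
\<close>

definition mass_gain :: "real \<Rightarrow> real \<Rightarrow> real \<Rightarrow> real \<Rightarrow> bool" where
  "mass_gain T G \<mu> \<delta>1 \<longleftrightarrow> (\<forall>\<delta> \<sigma> v t b q p m. 0 \<le> \<delta> \<longrightarrow> \<delta> \<le> \<delta>1 \<longrightarrow> (\<sigma> = 1 \<or> \<sigma> = - 1) \<longrightarrow> sol v t \<longrightarrow>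
    0 \<le> q \<longrightarrow> q \<le> q0 \<longrightarrow> trapped \<sigma> (v t) t b q \<longrightarrow> \<bar>p - X t - b\<bar> \<le> G \<longrightarrow> 0 \<le> m \<longrightarrow> m \<le> G \<longrightarrow>
    m \<le> integral {p - \<rho>..p + \<rho>} (\<lambda>x. \<sigma> * (u t (x - b) - v t x) + q * weight (x - X t - b)) \<longrightarrow>
    trapped \<sigma> (v (t + T)) (t + T) (b + \<sigma> * (A * q) - \<sigma> * (\<delta> * m)) (2 * (q * exp (- \<omega> * T) + \<mu> * (\<delta> * m))))"

lemma mass_gainD:
  "mass_gain T G \<mu> \<delta>1 \<Longrightarrow> 0 \<le> \<delta> \<Longrightarrow> \<delta> \<le> \<delta>1 \<Longrightarrow> \<sigma> = 1 \<or> \<sigma> = - 1 \<Longrightarrow> sol v t \<Longrightarrow>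
    0 \<le> q \<Longrightarrow> q \<le> q0 \<Longrightarrow> trapped \<sigma> (v t) t b q \<Longrightarrow> \<bar>p - X t - b\<bar> \<le> G \<Longrightarrow> 0 \<le> m \<Longrightarrow> m \<le> G \<Longrightarrow>
    m \<le> integral {p - \<rho>..p + \<rho>} (\<lambda>x. \<sigma> * (u t (x - b) - v t x) + q * weight (x - X t - b)) \<Longrightarrow>
    trapped \<sigma> (v (t + T)) (t + T) (b + \<sigma> * (A * q) - \<sigma> * (\<delta> * m)) (2 * (q * exp (- \<omega> * T) + \<mu> * (\<delta> * m)))"
  unfolding mass_gain_def by (elim allE impE) assumption+

text \<open>
  The cost factor \<open>\<mu>\<close> can be prescribed: it determines a radius \<open>M\<close> outside which the loss from shifting is covered by the
  weight, and the spreading of mass over this radius then determines how small \<open>\<delta>\<close> must be.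
\<close>

lemma mass_improves_trap:
  assumes "0 < T" "0 \<le> G" "0 < \<mu>"
  shows "\<exists>\<delta>1>0. mass_gain T G \<mu> \<delta>1"
proof -
  obtain C where C: "0 < C" and loss: "\<And>\<sigma> t x b b' d. (\<sigma> = 1 \<or> \<sigma> = - 1) \<Longrightarrow> 0 \<le> d \<Longrightarrow> d \<le> 1 \<Longrightarrow> \<bar>b' - b\<bar> \<le> 1 \<Longrightarrow>
      \<sigma> * u t (x - b') - C * d * peak (x - X t - b) \<le> \<sigma> * u t (x - (b' - \<sigma> * d))"
    using shift_loss by blast
  \<comment> \<open>Beyond distance \<open>M\<close> the loss \<open>C peak\<close> is at most \<open>\<mu>\<close> times the weight.\<close>
  define M where "M = ln (C / \<mu>) / \<beta>"
  have "exp (- \<beta> * M) = \<mu> / C"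
    using C \<open>0 < \<mu>\<close> \<beta>_pos by (simp add: M_def exp_minus)
  then have M: "C * exp (- \<beta> * M) = \<mu>" using C by simp
  obtain c where c: "0 < c" and spread: "\<And>z s p m x. supersol K z s (s + T) \<Longrightarrow>
      (\<forall>t\<in>{s..s + T}. \<forall>x. 0 \<le> z t x) \<Longrightarrow> 0 \<le> m \<Longrightarrow> m \<le> integral {p - \<rho>..p + \<rho>} (z s) \<Longrightarrow>
      \<bar>x - p\<bar> \<le> \<bar>M\<bar> + cmax * T + G \<Longrightarrow> c * m \<le> z (s + T) x"
    using radius[unfolded spreading_radius_def, THEN conjunct2, rule_format, OF less_imp_le[OF K_pos] \<open>0 < T\<close>,
        of "\<bar>M\<bar> + cmax * T + G"] by auto
  define \<delta>1 where "\<delta>1 = min (c / L) (1 / (G + 1))"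
  have \<delta>1: "0 < \<delta>1" using c L_pos \<open>0 \<le> G\<close> by (simp add: \<delta>1_def)
  have "trapped \<sigma> (v (t1 + T)) (t1 + T) (b + \<sigma> * (A * q) - \<sigma> * (\<delta> * m)) (2 * (q * exp (- \<omega> * T) + \<mu> * (\<delta> * m)))"
    if \<delta>: "0 \<le> \<delta>" "\<delta> \<le> \<delta>1" and \<sigma>: "\<sigma> = 1 \<or> \<sigma> = - 1" and v: "sol v t1" and q: "0 \<le> q" "q \<le> q0"
      and tr: "trapped \<sigma> (v t1) t1 b q" and p: "\<bar>p - X t1 - b\<bar> \<le> G" and m: "0 \<le> m" "m \<le> G"
      and mass: "m \<le> integral {p - \<rho>..p + \<rho>} (\<lambda>x. \<sigma> * (u t1 (x - b) - v t1 x) + q * weight (x - X t1 - b))"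
    for \<delta> \<sigma> v t1 b q p m
    unfolding trapped_def
  proof
    fix x
    define t where "t = t1 + T"
    define z where "z = margin A \<sigma> b q t1 v"
    define d where "d = \<delta> * m"
    define b' where "b' = b + \<sigma> * (A * q)"
    define Q where "Q = q * exp (- \<omega> * T)"
    define g where "g = weight (x - X t - b)"
    have g: "0 < g" by (simp add: g_def weight_pos)
    have t: "t1 \<le> t" using \<open>0 < T\<close> by (simp add: t_def)
    have dG: "\<delta> * m \<le> 1 / (G + 1) * G" using \<delta> m by (intro mult_mono) (auto simp: \<delta>1_def)
    also have "\<dots> \<le> 1" using \<open>0 \<le> G\<close> by simp
    finally have d: "0 \<le> d" "d \<le> 1" using \<delta> m by (auto simp: d_def)
    have b': "\<bar>b' - b\<bar> \<le> 1" using \<sigma> q A_pos Aq_le_1[OF q(2)] by (auto simp: b'_def abs_mult)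
    have S: "supersol K z t1 (t1 + T)"
      using barrier \<sigma> v q unfolding barrier_constants_def z_def by blast
    have nn: "0 \<le> z s x" if "t1 \<le> s" for s x
      unfolding z_def using that by (intro margin_preserved[OF \<sigma> v q tr])
    have "z t1 = (\<lambda>x. \<sigma> * (u t1 (x - b) - v t1 x) + q * weight (x - X t1 - b))"
      by (intro ext) (simp add: z_def margin_def moving_shift_def)
    then have mass': "m \<le> integral {p - \<rho>..p + \<rho>} (z t1)" using mass by simp
    have zle: "z t x \<le> \<sigma> * u t (x - b') - \<sigma> * v t x + Q * g"
      using moving_shift_limit[OF \<sigma> q(1), of t x b t1 t]
      by (simp add: z_def margin_def b'_def Q_def g_def t_def algebra_simps)
    have main: "0 \<le> \<sigma> * (u t (x - (b' - \<sigma> * d)) - v t x) + (Q + \<mu> * d) * g"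
    proof (cases "\<bar>x - X t - b\<bar> \<le> \<bar>M\<bar>")
      case True
      have "\<bar>X t - X t1\<bar> \<le> cmax * T" using X_increment[OF t] X_mono[OF t] by (simp add: t_def)
      then have "\<bar>x - p\<bar> \<le> \<bar>M\<bar> + cmax * T + G" using True p by linarith
      then have "c * m \<le> z t x" unfolding t_def
        using nn by (intro spread[OF S _ m(1) mass']) auto
      moreover have "L * d \<le> c * m"
      proof -
        have "L * \<delta> \<le> L * (c / L)" using \<delta> L_pos by (intro mult_left_mono) (auto simp: \<delta>1_def)
        then have "L * \<delta> * m \<le> c * m" using L_pos m by (intro mult_right_mono) auto
        then show ?thesis by (simp add: d_def)
      qed
      moreover have "\<sigma> * u t (x - b') - L * d \<le> \<sigma> * u t (x - (b' - \<sigma> * d))"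
        using u_lipschitz[of t "x - b'" "x - (b' - \<sigma> * d)"] \<sigma> d by (auto simp: abs_mult)
      moreover have "0 \<le> \<mu> * d * g" using \<open>0 < \<mu>\<close> d g by simp
      ultimately show ?thesis using zle by (simp add: algebra_simps)
    next
      case False
      have "C * peak (x - X t - b) \<le> C * (exp (- \<beta> * M) * g)"
        unfolding g_def using False C by (intro mult_left_mono peak_le_weight) auto
      also have "\<dots> = \<mu> * g" using M by (metis mult.assoc)
      finally have "d * (C * peak (x - X t - b)) \<le> d * (\<mu> * g)" using d by (intro mult_left_mono)
      moreover have "\<sigma> * u t (x - b') - C * d * peak (x - X t - b) \<le> \<sigma> * u t (x - (b' - \<sigma> * d))"
        by (rule loss[OF \<sigma> d b'])
      ultimately show ?thesis using zle nn[OF t, of x] by (simp add: algebra_simps)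
    qed
    have "\<bar>b' - \<sigma> * d - b\<bar> \<le> 2" using b' d \<sigma> by auto
    then have "g \<le> 2 * weight (x - X t - (b' - \<sigma> * d))" unfolding g_def by (rule weight_recentre)
    moreover have "0 \<le> Q + \<mu> * d" using q d \<open>0 < \<mu>\<close> by (simp add: Q_def)
    ultimately have "(Q + \<mu> * d) * g \<le> (Q + \<mu> * d) * (2 * weight (x - X t - (b' - \<sigma> * d)))"
      by (rule mult_left_mono)
    then have "(Q + \<mu> * d) * g \<le> 2 * (Q + \<mu> * d) * weight (x - X t - (b' - \<sigma> * d))"
      by (simp only: mult_ac)
    then show "0 \<le> \<sigma> * (u (t1 + T) (x - (b + \<sigma> * (A * q) - \<sigma> * (\<delta> * m))) - v (t1 + T) x) +
        2 * (q * exp (- \<omega> * T) + \<mu> * (\<delta> * m)) * weight (x - X (t1 + T) - (b + \<sigma> * (A * q) - \<sigma> * (\<delta> * m)))"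
      using main unfolding t_def[symmetric] b'_def[symmetric] d_def[symmetric] Q_def[symmetric]
      by linarith
  qed
  then have "mass_gain T G \<mu> \<delta>1" unfolding mass_gain_def by (intro allI impI)
  then show ?thesis using \<delta>1 by blast
qed

end

section \<open>Contraction of the gap\<close>

context squeezed_front begin

definition confined :: "(real \<Rightarrow> real \<Rightarrow> real) \<Rightarrow> real \<Rightarrow> real \<Rightarrow> real \<Rightarrow> real \<Rightarrow> bool" where
  "confined v t a b q \<longleftrightarrow> trapped 1 (v t) t b q \<and> trapped (- 1) (v t) t a q \<and> a \<le> b \<and> 0 \<le> q \<and> q \<le> q0"

text \<open>
  The quantity that contracts. The factor \<open>8 A\<close> makes \<open>width\<close> absorb the outward drift \<open>2 A q\<close> of the two shifts
  in one step and the enlargement of \<open>q\<close>.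
\<close>

definition width :: "real \<Rightarrow> real \<Rightarrow> real \<Rightarrow> real" where
  "width a b q = b - a + 8 * A * q"

text \<open>
  Nesting of the intervals \<open>[a - width, b + width]\<close>. The intervals \<open>[a, b]\<close> themselves need not be nested, as
  the shifts drift outwards.
\<close>

definition nested :: "real \<Rightarrow> real \<Rightarrow> real \<Rightarrow> real \<Rightarrow> real \<Rightarrow> real \<Rightarrow> bool" where
  "nested a b q a' b' q' \<longleftrightarrow>
    a - width a b q \<le> a' - width a' b' q' \<and> b' + width a' b' q' \<le> b + width a b q"

lemma width_nonneg: "confined v t a b q \<Longrightarrow> 0 \<le> width a b q"
  using A_pos by (simp add: confined_def width_def)

text \<open>
  The two margins add up to at least the difference of the two shifted fronts, which steepness bounds below in a
  window around \<open>X t + a\<close>.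
\<close>

lemma trapped_gap_mass:
  fixes t :: real
  assumes v: "bcont w" and ab: "a \<le> b" "b - a \<le> G" and "0 < G" "0 \<le> q"
    and steep: "\<And>t x h. \<bar>x - X t\<bar> \<le> 2 * \<rho> \<Longrightarrow> 0 \<le> h \<Longrightarrow> h \<le> \<rho> \<Longrightarrow> \<alpha> * h \<le> u t x - u t (x + h)"
    and "0 < \<alpha>"
  defines "I \<equiv> \<lambda>\<sigma> b. integral {X t + a - \<rho>..X t + a + \<rho>} (\<lambda>x. \<sigma> * (u t (x - b) - w x) + q * weight (x - X t - b))"
    and "k \<equiv> \<rho> * (\<alpha> * min 1 (\<rho> / G))"
  shows "k * (b - a) \<le> I 1 b \<or> k * (b - a) \<le> I (- 1) a"
proof -
  define S where "S = {X t + a - \<rho>..X t + a + \<rho>}"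
  define z where "z \<sigma> b x = \<sigma> * (u t (x - b) - w x) + q * weight (x - X t - b)" for \<sigma> b x
  have int: "z \<sigma> b integrable_on S" for \<sigma> b
  proof -
    have "bcont (\<lambda>x. \<sigma> * (u t (x - b) - w x) + q * weight (x - X t - b))"
      using bcont_shift[OF u_bcont[of t], of "- b"] v by (intro bcont_add bcont_scale bcont_diff weight_bcont) auto
    then have "continuous_on UNIV (z \<sigma> b)" unfolding z_def bcont_def by blast
    then show ?thesis unfolding S_def
      by (intro integrable_continuous_interval) (rule continuous_on_subset, auto)
  qed
  have point: "\<alpha> * min 1 (\<rho> / G) * (b - a) \<le> z 1 b x + z (- 1) a x" if x: "x \<in> S" for x
  proof -
    define h where "h = min (b - a) \<rho>"
    have h: "0 \<le> h" "h \<le> \<rho>" "h \<le> b - a" using ab \<rho>_pos by (auto simp: h_def)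
    have "min 1 (\<rho> / G) * (b - a) \<le> h"
    proof -
      have "\<rho> / G * (b - a) \<le> \<rho> / G * G" using ab \<rho>_pos \<open>0 < G\<close> by (intro mult_left_mono) auto
      then have "\<rho> / G * (b - a) \<le> \<rho>" using \<open>0 < G\<close> by simp
      moreover have "min 1 (\<rho> / G) * (b - a) \<le> 1 * (b - a)"
        "min 1 (\<rho> / G) * (b - a) \<le> \<rho> / G * (b - a)" using ab by (intro mult_right_mono; simp)+
      ultimately show ?thesis by (simp add: h_def)
    qed
    then have "\<alpha> * (min 1 (\<rho> / G) * (b - a)) \<le> \<alpha> * h" using \<open>0 < \<alpha>\<close> by simp
    also have "\<dots> \<le> u t (x - a - h) - u t (x - a - h + h)"
      using x h by (intro steep) (auto simp: S_def abs_le_iff)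
    also have "\<dots> \<le> u t (x - b) - u t (x - a)" using h by (auto intro!: u_antimono)
    also have "\<dots> \<le> z 1 b x + z (- 1) a x"
      using weight_pos[of "x - X t - b"] weight_pos[of "x - X t - a"] \<open>0 \<le> q\<close> by (simp add: z_def)
    finally show ?thesis by (simp add: mult.assoc)
  qed
  have "2 * (k * (b - a)) = integral S (\<lambda>x. \<alpha> * min 1 (\<rho> / G) * (b - a))"
    using \<rho>_pos by (simp add: S_def k_def)
  also have "\<dots> \<le> integral S (\<lambda>x. z 1 b x + z (- 1) a x)"
    using point by (intro integral_le integrable_add int) (auto simp: S_def)
  also have "\<dots> = integral S (z 1 b) + integral S (z (- 1) a)"
    by (intro Henstock_Kurzweil_Integration.integral_add int)
  finally have "2 * (k * (b - a)) \<le> I 1 b + I (- 1) a"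
    unfolding I_def S_def z_def by simp
  then show ?thesis by linarith
qed

definition squeezes :: "real \<Rightarrow> real \<Rightarrow> real \<Rightarrow> bool" where
  "squeezes T G \<delta> \<longleftrightarrow> (\<forall>v t a b q. sol v t \<longrightarrow> confined v t a b q \<longrightarrow> b - a \<le> G \<longrightarrow>
    (\<exists>a' b' q'. confined v (t + T) a' b' q' \<and> nested a b q a' b' q' \<and>
       width a' b' q' \<le> (1 - \<delta> / 2) * width a b q))"

text \<open>
  The bound with the larger margin moves inwards, the other one only drifts. The constants make
  \<open>q' = q / 4 + 2 \<mu> \<delta> (b - a)\<close>; the choice of \<open>\<mu>\<close> keeps \<open>q'\<close> below \<open>q0\<close> and lets the second term of \<open>q'\<close> consume at
  most half of the gain \<open>\<delta> (b - a)\<close>.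
\<close>

lemma squeeze_step:
  assumes T: "0 < T" "exp (- \<omega> * T) \<le> 1 / 8" and "0 < G"
  shows "\<exists>\<delta>>0. \<delta> \<le> 1 \<and> squeezes T G \<delta>"
proof -
  obtain \<alpha> where \<alpha>: "0 < \<alpha>" "\<And>t x h. \<bar>x - X t\<bar> \<le> 2 * \<rho> \<Longrightarrow> 0 \<le> h \<Longrightarrow> h \<le> \<rho> \<Longrightarrow> \<alpha> * h \<le> u t x - u t (x + h)"
    using front_steepness[of "2 * \<rho>"] by blast
  define k where "k = \<rho> * (\<alpha> * min 1 (\<rho> / G))"
  have k: "0 < k" using \<alpha>(1) \<rho>_pos \<open>0 < G\<close> by (simp add: k_def)
  define \<mu> where "\<mu> = min (1 / (32 * A)) (q0 / (4 * G))"
  have "\<mu> \<le> 1 / (32 * A)" "\<mu> \<le> q0 / (4 * G)" by (simp_all add: \<mu>_def)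
  then have "32 * A * \<mu> \<le> 1" "4 * G * \<mu> \<le> q0" using A_pos \<open>0 < G\<close> by (simp_all add: field_simps)
  moreover have "0 < \<mu>" using A_pos q0_pos \<open>0 < G\<close> by (simp add: \<mu>_def)
  ultimately have \<mu>: "0 < \<mu>" "32 * A * \<mu> \<le> 1" "4 * G * \<mu> \<le> q0" by simp_all
  define G' where "G' = (1 + k) * G"
  have G': "0 \<le> G'" "G \<le> G'" "k * G \<le> G'" using k \<open>0 < G\<close> by (auto simp: G'_def algebra_simps)
  obtain \<delta>1 where \<delta>1: "0 < \<delta>1" and "mass_gain T G' \<mu> \<delta>1"
    using mass_improves_trap[OF T(1) G'(1) \<mu>(1)] by blast
  note gain = mass_gainD[OF this(2)]
  define \<delta>0 where "\<delta>0 = min \<delta>1 (1 / k)"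
  define \<delta> where "\<delta> = \<delta>0 * k"
  have \<delta>0: "0 < \<delta>0" "\<delta>0 \<le> \<delta>1" using \<delta>1 k by (auto simp: \<delta>0_def)
  have "\<delta>0 * k \<le> 1 / k * k" using k by (intro mult_right_mono) (auto simp: \<delta>0_def)
  then have \<delta>: "0 < \<delta>" "\<delta> \<le> 1" using \<delta>0 k by (auto simp: \<delta>_def)
  have "\<exists>a' b' q'. confined v (t + T) a' b' q' \<and> nested a b q a' b' q' \<and>
       width a' b' q' \<le> (1 - \<delta> / 2) * width a b q"
    if v: "sol v t" and c: "confined v t a b q" and gG: "b - a \<le> G" for v t a b q
  proof -
    define g where "g = b - a"
    define q' where "q' = q / 4 + 2 * \<mu> * (\<delta> * g)"
    have ab: "0 \<le> g" "a \<le> b" and q: "0 \<le> q" "q \<le> q0"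
      and tr: "trapped 1 (v t) t b q" "trapped (- 1) (v t) t a q"
      using c by (auto simp: confined_def g_def)
    have \<delta>g: "0 \<le> \<delta> * g" "\<delta> * g \<le> g" "\<delta> * g \<le> G" using \<delta> ab gG mult_right_mono[of \<delta> 1 g] by (auto simp: g_def)
    have q': "0 \<le> q'" using \<delta>g q \<mu> by (simp add: q'_def)
    have "4 * (\<mu> * (\<delta> * g)) \<le> 4 * (\<mu> * G)" using \<delta>g \<mu>(1) by (intro mult_left_mono) auto
    then have q'q0: "q' \<le> q0" using \<mu>(3) q by (simp add: q'_def algebra_simps)
    have qe: "q * exp (- \<omega> * T) \<le> q / 8" using mult_left_mono[OF T(2) q(1)] by simp
    have m: "\<delta>0 * (k * g) = \<delta> * g" by (simp add: \<delta>_def)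
    have "k * g \<le> k * G" using k gG by (simp add: g_def)
    then have kg: "0 \<le> k * g" "k * g \<le> G'" using k ab(1) G'(3) by (simp, linarith)
    have up: "trapped 1 (v (t + T)) (t + T) (b + A * q) q'"
      and low: "trapped (- 1) (v (t + T)) (t + T) (a - A * q) q'"
    proof -
      have "2 * (q * exp (- \<omega> * T)) \<le> q'" using qe \<delta>g \<mu>(1) by (simp add: q'_def add_increasing2)
      then show "trapped 1 (v (t + T)) (t + T) (b + A * q) q'" "trapped (- 1) (v (t + T)) (t + T) (a - A * q) q'"
        using trapped_propagates[OF _ v q tr(1), of "t + T"] trapped_propagates[OF _ v q tr(2), of "t + T"] T(1)
        by (auto intro: trapped_mono)
    qed
    have q'w: "8 * A * q' \<le> 2 * A * q + \<delta> * g / 2"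
    proof -
      have "(32 * A * \<mu>) * (\<delta> * g) \<le> 1 * (\<delta> * g)" using \<mu>(2) \<delta>g by (intro mult_right_mono)
      then show ?thesis by (simp add: q'_def algebra_simps)
    qed
    have Aq: "0 \<le> A * q" using A_pos q by simp
    have \<delta>Aq: "\<delta> * (A * q) \<le> A * q" using \<delta> Aq mult_right_mono[of \<delta> 1 "A * q"] by simp
    have conclude: "nested a b q a' b' q' \<and> width a' b' q' \<le> (1 - \<delta> / 2) * width a b q \<and> a' \<le> b'"
      if "b' - a' = g - \<delta> * g + 2 * (A * q)" "a - A * q \<le> a'" "b' \<le> b + A * q" for a' b'
    proof (intro conjI)
      have w: "width a' b' q' \<le> g - \<delta> * g / 2 + 4 * (A * q)"
        using that(1) q'w by (simp add: width_def)
      then show "nested a b q a' b' q'"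
        using that \<delta>g Aq unfolding nested_def by (simp add: width_def g_def)
      have "g - \<delta> * g / 2 + 4 * (A * q) \<le> (1 - \<delta> / 2) * (g + 8 * (A * q))"
        using \<delta>Aq by (simp add: algebra_simps)
      then show "width a' b' q' \<le> (1 - \<delta> / 2) * width a b q" using w by (simp add: width_def g_def mult.assoc)
      show "a' \<le> b'" using that(1) \<delta>g Aq by linarith
    qed
    have "bcont (v t)" using v stripD(1)[of v t t t] by (auto simp: sol_def)
    from trapped_gap_mass[OF this ab(2) gG \<open>0 < G\<close> q(1) \<alpha>(2,1), of t]
    have "k * g \<le> integral {X t + a - \<rho>..X t + a + \<rho>} (\<lambda>x. 1 * (u t (x - b) - v t x) + q * weight (x - X t - b)) \<or>
        k * g \<le> integral {X t + a - \<rho>..X t + a + \<rho>} (\<lambda>x. - 1 * (u t (x - a) - v t x) + q * weight (x - X t - a))"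
      unfolding k_def g_def by blast
    then show ?thesis
    proof
      assume mass: "k * g \<le> integral {X t + a - \<rho>..X t + a + \<rho>} (\<lambda>x. 1 * (u t (x - b) - v t x) + q * weight (x - X t - b))"
      have "trapped 1 (v (t + T)) (t + T) (b + 1 * (A * q) - 1 * (\<delta>0 * (k * g)))
          (2 * (q * exp (- \<omega> * T) + \<mu> * (\<delta>0 * (k * g))))"
      proof (rule gain[OF _ \<delta>0(2) _ v q tr(1) _ kg mass])
        show "\<bar>X t + a - X t - b\<bar> \<le> G'" using ab gG G'(2) by (simp add: g_def)
      qed (use \<delta>0 in auto)
      then have "trapped 1 (v (t + T)) (t + T) (b + A * q - \<delta> * g) q'"
        unfolding m mult_1 by (rule trapped_mono) (use qe in \<open>simp add: q'_def\<close>)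
      moreover note conclude[of "b + A * q - \<delta> * g" "a - A * q"]
      ultimately show ?thesis using low q' q'q0 \<delta>g
        by (intro exI[of _ "a - A * q"] exI[of _ "b + A * q - \<delta> * g"] exI[of _ q']) (auto simp: confined_def g_def)
    next
      assume mass: "k * g \<le> integral {X t + a - \<rho>..X t + a + \<rho>} (\<lambda>x. - 1 * (u t (x - a) - v t x) + q * weight (x - X t - a))"
      have "trapped (- 1) (v (t + T)) (t + T) (a + - 1 * (A * q) - - 1 * (\<delta>0 * (k * g)))
          (2 * (q * exp (- \<omega> * T) + \<mu> * (\<delta>0 * (k * g))))"
      proof (rule gain[OF _ \<delta>0(2) _ v q tr(2) _ kg mass])
        show "\<bar>X t + a - X t - a\<bar> \<le> G'" using G' by simp
      qed (use \<delta>0 in auto)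
      then have "trapped (- 1) (v (t + T)) (t + T) (a - A * q + \<delta> * g) (2 * (q * exp (- \<omega> * T) + \<mu> * (\<delta> * g)))"
        unfolding m by simp
      then have "trapped (- 1) (v (t + T)) (t + T) (a - A * q + \<delta> * g) q'"
        by (rule trapped_mono) (use qe in \<open>simp add: q'_def\<close>)
      moreover note conclude[of "b + A * q" "a - A * q + \<delta> * g"]
      ultimately show ?thesis using up q' q'q0 \<delta>g
        by (intro exI[of _ "a - A * q + \<delta> * g"] exI[of _ "b + A * q"] exI[of _ q']) (auto simp: confined_def g_def)
    qed
  qed
  then have "squeezes T G \<delta>" unfolding squeezes_def by (intro allI impI)
  then show ?thesis using \<delta> by blast
qed

lemma confined_sequence:
  assumes T: "0 < T" and "0 < \<delta>" "\<delta> \<le> 1"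
    and step: "squeezes T G \<delta>"
    and v: "sol v t" and c: "confined v t a b q" and G: "width a b q \<le> G"
  obtains as bs qs where "\<And>n. confined v (t + real n * T) (as n) (bs n) (qs n)"
    "\<And>n. nested (as n) (bs n) (qs n) (as (Suc n)) (bs (Suc n)) (qs (Suc n))"
    "\<And>n. width (as n) (bs n) (qs n) \<le> (1 - \<delta> / 2) ^ n * width a b q"
proof -
  define P where "P n s = (case s of (a', b', q') \<Rightarrow> confined v (t + real n * T) a' b' q' \<and>
    width a' b' q' \<le> (1 - \<delta> / 2) ^ n * width a b q)" for n :: nat and s
  define N where "N s s' = (case s of (a, b, q) \<Rightarrow> case s' of (a', b', q') \<Rightarrow> nested a b q a' b' q')" for s s'
  have "\<exists>F. \<forall>n. P n (F n) \<and> N (F n) (F (Suc n))"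
  proof (rule dependent_nat_choice)
    show "\<exists>s. P 0 s" using c by (intro exI[of _ "(a, b, q)"]) (simp add: P_def)
    fix s n assume "P n s"
    then obtain a' b' q' where s: "s = (a', b', q')" and c': "confined v (t + real n * T) a' b' q'"
      and w: "width a' b' q' \<le> (1 - \<delta> / 2) ^ n * width a b q"
      by (cases s) (auto simp: P_def)
    have "(1 - \<delta> / 2) ^ n * width a b q \<le> 1 * width a b q"
      using assms(2,3) width_nonneg[OF c] by (intro mult_right_mono power_le_one) auto
    then have "width a' b' q' \<le> G" using w G by simp
    moreover have "0 \<le> 8 * A * q'" using c' A_pos by (simp add: confined_def)
    ultimately have "b' - a' \<le> G" unfolding width_def by linarith
    moreover have "sol v (t + real n * T)" using v T by (intro sol_later[OF v]) auto
    ultimately obtain a'' b'' q'' where n: "confined v (t + real n * T + T) a'' b'' q''"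
      "nested a' b' q' a'' b'' q''" "width a'' b'' q'' \<le> (1 - \<delta> / 2) * width a' b' q'"
      using step c' unfolding squeezes_def by blast
    have "(1 - \<delta> / 2) * width a' b' q' \<le> (1 - \<delta> / 2) * ((1 - \<delta> / 2) ^ n * width a b q)"
      using w assms(3) by (intro mult_left_mono) auto
    then have "P (Suc n) (a'', b'', q'')" using n by (simp add: P_def algebra_simps)
    then show "\<exists>s'. P (Suc n) s' \<and> N s s'" using n(2) by (auto simp: N_def s intro!: exI[of _ "(a'', b'', q'')"])
  qed
  then obtain F where F: "\<And>n. P n (F n)" "\<And>n. N (F n) (F (Suc n))" by blast
  show ?thesis
  proof (rule that[of "\<lambda>n. fst (F n)" "\<lambda>n. fst (snd (F n))" "\<lambda>n. snd (snd (F n))"])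
    show "confined v (t + real n * T) (fst (F n)) (fst (snd (F n))) (snd (snd (F n)))"
      "width (fst (F n)) (fst (snd (F n))) (snd (snd (F n))) \<le> (1 - \<delta> / 2) ^ n * width a b q" for n
      using F(1)[of n] by (auto simp: P_def case_prod_beta)
    show "nested (fst (F n)) (fst (snd (F n))) (snd (snd (F n)))
        (fst (F (Suc n))) (fst (snd (F (Suc n)))) (snd (snd (F (Suc n))))" for n
      using F(2)[of n] by (auto simp: N_def case_prod_beta)
  qed
qed

lemma nested_limit:
  fixes as bs qs :: "nat \<Rightarrow> real"
  assumes c: "\<And>n. as n \<le> bs n" and w0: "\<And>n. 0 \<le> width (as n) (bs n) (qs n)"
    and nest: "\<And>n. nested (as n) (bs n) (qs n) (as (Suc n)) (bs (Suc n)) (qs (Suc n))"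
  shows "\<exists>\<zeta>. \<forall>n. as n - width (as n) (bs n) (qs n) \<le> \<zeta> \<and> \<zeta> \<le> bs n + width (as n) (bs n) (qs n)"
proof -
  define l where "l n = as n - width (as n) (bs n) (qs n)" for n
  define r where "r n = bs n + width (as n) (bs n) (qs n)" for n
  have "incseq l" using nest by (intro incseq_SucI) (simp add: l_def nested_def)
  moreover have "decseq r" using nest by (intro decseq_SucI) (simp add: r_def nested_def)
  moreover have "l n \<le> r n" for n using c[of n] w0[of n] by (simp add: l_def r_def)
  ultimately have lr: "l m \<le> r n" for m n
    using incseqD[of l m "max m n"] decseqD[of r n "max m n"] by (meson max.cobounded1 max.cobounded2 order_trans)
  have "l n \<le> Sup (range l) \<and> Sup (range l) \<le> r n" for n
    using lr by (auto intro!: cSup_upper cSup_least bdd_aboveI[of _ "r 0"])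
  then show ?thesis unfolding l_def r_def by blast
qed

lemma confined_bounds:
  assumes v: "sol v t" and c: "confined v t a b q" and s: "t \<le> s"
  shows "v s x \<le> u s (x - (b + A * q)) + 2 * q" "u s (x - (a - A * q)) - 2 * q \<le> v s x"
proof -
  have q: "0 \<le> q" "q \<le> q0" and tr: "trapped 1 (v t) t b q" "trapped (- 1) (v t) t a q"
    using c by (auto simp: confined_def)
  have "2 * (q * exp (- \<omega> * (s - t))) * weight y \<le> 2 * q" for y
  proof -
    have "exp (- \<omega> * (s - t)) * weight y \<le> 1 * 1"
      using s \<omega>_pos weight_pos[of y] by (intro mult_mono weight_le_1) auto
    then have "2 * q * (exp (- \<omega> * (s - t)) * weight y) \<le> 2 * q * 1" using q by (intro mult_left_mono) auto
    then show ?thesis by (simp add: mult_ac)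
  qed
  note B = this[of "x - X s - (b + A * q)"] this[of "x - X s - (a - A * q)"]
  show "v s x \<le> u s (x - (b + A * q)) + 2 * q"
    using trapped_propagates[OF _ v q tr(1) s] B(1) unfolding trapped_def by (auto dest!: spec[of _ x])
  show "u s (x - (a - A * q)) - 2 * q \<le> v s x"
    using trapped_propagates[OF _ v q tr(2) s] B(2) unfolding trapped_def by (auto dest!: spec[of _ x])
qed

text \<open>A nested interval of shifts gives a bound uniform in \<open>x\<close>, since the front is Lipschitz.\<close>

lemma confined_distance:
  assumes v: "sol v t" and c: "confined v t a b q" and s: "t \<le> s"
    and \<zeta>: "a - width a b q \<le> \<zeta>" "\<zeta> \<le> b + width a b q"
  shows "\<bar>v s x - u s (x - \<zeta>)\<bar> \<le> (3 * L + 1 / (4 * A)) * width a b q"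
proof -
  have q: "0 \<le> q" and ab: "a \<le> b" using c by (auto simp: confined_def)
  have Aq: "0 \<le> A * q" using A_pos q by simp
  have w: "b - a + 8 * (A * q) = width a b q" by (simp add: width_def)
  have lip: "\<bar>u s (x - y) - u s (x - \<zeta>)\<bar> \<le> 3 * L * width a b q" if "\<bar>y - \<zeta>\<bar> \<le> 3 * width a b q" for y
  proof -
    have "\<bar>u s (x - y) - u s (x - \<zeta>)\<bar> \<le> L * \<bar>x - y - (x - \<zeta>)\<bar>" by (rule u_lipschitz)
    also have "\<dots> \<le> L * (3 * width a b q)" using that L_pos by (intro mult_left_mono) auto
    finally show ?thesis by simp
  qed
  have 1: "\<bar>b + A * q - \<zeta>\<bar> \<le> 3 * width a b q" "\<bar>a - A * q - \<zeta>\<bar> \<le> 3 * width a b q"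
    using \<zeta> w Aq ab by linarith+
  have "2 * q \<le> 1 / (4 * A) * width a b q"
    using w ab A_pos by (simp add: field_simps)
  then show ?thesis
    using confined_bounds[OF v c s, of x] lip[OF 1(1)] lip[OF 1(2)] by (simp add: algebra_simps)
qed

text \<open>The rate depends only on the bound \<open>G\<close> for the initial width, not on the solution.\<close>

lemma converges_from_gap:
  assumes "0 < G"
  shows "\<exists>r>0. \<exists>C>0. \<forall>v t a b q. sol v t \<longrightarrow> confined v t a b q \<longrightarrow> width a b q \<le> G \<longrightarrow>
    (\<exists>\<zeta>. \<forall>s\<ge>t. \<forall>x. \<bar>v s x - u s (x - \<zeta>)\<bar> \<le> C * exp (- r * (s - t)))"
proof -
  define T where "T = ln 8 / \<omega>"
  have T: "0 < T" "exp (- \<omega> * T) \<le> 1 / 8" using \<omega>_pos by (auto simp: T_def exp_minus)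
  obtain \<delta> where \<delta>: "0 < \<delta>" "\<delta> \<le> 1" and step: "squeezes T G \<delta>"
    using squeeze_step[OF T assms] by blast
  define lam where "lam = 1 - \<delta> / 2"
  have lam: "0 < lam" "lam < 1" using \<delta> by (auto simp: lam_def)
  define r where "r = - ln lam / T"
  have r: "0 < r" "exp (- r * T) = lam" using lam T(1) by (auto simp: r_def divide_neg_pos)
  define C where "C = (3 * L + 1 / (4 * A)) * G / lam"
  have LA: "0 < 3 * L + 1 / (4 * A)" using L_pos A_pos by (simp add: add_pos_pos)
  have C: "0 < C" using LA assms lam by (simp add: C_def)
  have "\<exists>\<zeta>. \<forall>s\<ge>t. \<forall>x. \<bar>v s x - u s (x - \<zeta>)\<bar> \<le> C * exp (- r * (s - t))"
    if v: "sol v t" and c: "confined v t a b q" and w: "width a b q \<le> G" for v t a b q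
  proof -
    obtain as bs qs where sq: "\<And>n. confined v (t + real n * T) (as n) (bs n) (qs n)"
      "\<And>n. nested (as n) (bs n) (qs n) (as (Suc n)) (bs (Suc n)) (qs (Suc n))"
      "\<And>n. width (as n) (bs n) (qs n) \<le> lam ^ n * width a b q"
      by (rule confined_sequence[OF T(1) \<delta> step v c w]) (rule that, simp_all add: lam_def)
    obtain \<zeta> where \<zeta>: "\<And>n. as n - width (as n) (bs n) (qs n) \<le> \<zeta>" "\<And>n. \<zeta> \<le> bs n + width (as n) (bs n) (qs n)"
    proof -
      have "as n \<le> bs n" for n using sq(1)[of n] by (simp add: confined_def)
      then show ?thesis
        using nested_limit[of as bs qs, OF _ width_nonneg[OF sq(1)] sq(2)] that by blast
    qed
    have "\<bar>v s x - u s (x - \<zeta>)\<bar> \<le> C * exp (- r * (s - t))" if s: "t \<le> s" for s x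
    proof -
      define n where "n = nat \<lfloor>(s - t) / T\<rfloor>"
      have "0 \<le> (s - t) / T" using s T(1) by simp
      then have "real n \<le> (s - t) / T" "(s - t) / T < real n + 1" unfolding n_def by linarith+
      then have n: "t + real n * T \<le> s" "s - t \<le> (real n + 1) * T" using T(1) by (auto simp: field_simps)
      have "lam ^ Suc n = exp (- r * ((real n + 1) * T))"
        unfolding r(2)[symmetric] by (simp only: exp_of_nat_mult[symmetric] of_nat_Suc) (simp add: mult_ac add.commute)
      also have "\<dots> \<le> exp (- r * (s - t))" using n(2) r(1) by simp
      finally have "lam ^ n \<le> exp (- r * (s - t)) / lam" using lam by (simp add: field_simps)
      then have "lam ^ n * width a b q \<le> exp (- r * (s - t)) / lam * G"
        using w width_nonneg[OF c] lam by (intro mult_mono) auto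
      then have wn: "width (as n) (bs n) (qs n) \<le> exp (- r * (s - t)) / lam * G" using sq(3)[of n] by linarith
      have "\<bar>v s x - u s (x - \<zeta>)\<bar> \<le> (3 * L + 1 / (4 * A)) * width (as n) (bs n) (qs n)"
        using T(1) by (intro confined_distance[OF sol_later[OF v] sq(1) n(1) \<zeta>]) auto
      also have "\<dots> \<le> (3 * L + 1 / (4 * A)) * (exp (- r * (s - t)) / lam * G)"
        using wn LA by (intro mult_left_mono) auto
      also have "\<dots> = C * exp (- r * (s - t))" by (simp add: C_def mult_ac)
      finally show ?thesis .
    qed
    then show ?thesis by blast
  qed
  then show ?thesis using r(1) C by blast
qed

lemma gap_becomes_small:
  assumes v: "sol v t" and c: "confined v t a b q"
  shows "\<exists>t'\<ge>t. \<exists>a' b' q'. confined v t' a' b' q' \<and> width a' b' q' \<le> 1"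
proof -
  define G where "G = width a b q + 1"
  have G: "0 < G" "width a b q \<le> G" using width_nonneg[OF c] by (auto simp: G_def)
  define T where "T = ln 8 / \<omega>"
  have T: "0 < T" "exp (- \<omega> * T) \<le> 1 / 8" using \<omega>_pos by (auto simp: T_def exp_minus)
  obtain \<delta> where \<delta>: "0 < \<delta>" "\<delta> \<le> 1" and step: "squeezes T G \<delta>"
    using squeeze_step[OF T G(1)] by blast
  obtain as bs qs where sq: "\<And>n. confined v (t + real n * T) (as n) (bs n) (qs n)"
    "\<And>n. width (as n) (bs n) (qs n) \<le> (1 - \<delta> / 2) ^ n * width a b q"
    by (rule confined_sequence[OF T(1) \<delta> step v c G(2)]) (rule that)
  obtain n where n: "(1 - \<delta> / 2) ^ n < 1 / G"
    using real_arch_pow_inv[of "1 / G" "1 - \<delta> / 2"] G \<delta> by auto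
  have "(1 - \<delta> / 2) ^ n * width a b q \<le> 1 / G * G"
    using n G width_nonneg[OF c] \<delta> by (intro mult_mono) auto
  then have "width (as n) (bs n) (qs n) \<le> 1" using sq(2)[of n] G by simp
  moreover have "t \<le> t + real n * T" using T by simp
  ultimately show ?thesis using sq(1) by blast
qed

text \<open>
  Waiting until the width is at most \<open>1\<close> makes the rate independent of the solution; the waiting time only enters the
  constant \<open>C\<close>, as solution and front differ by at most \<open>3\<close> meanwhile.
\<close>

lemma stability_of_confined:
  "\<exists>r>0. \<forall>v t a b q. sol v t \<longrightarrow> confined v t a b q \<longrightarrow>
    (\<exists>C>0. \<exists>\<zeta>. \<forall>s\<ge>t. \<forall>x. \<bar>v s x - u s (x - \<zeta>)\<bar> \<le> C * exp (- r * (s - t)))"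
proof -
  obtain r C where r: "0 < r" and C: "0 < C" and conv: "\<And>v t a b q. sol v t \<Longrightarrow> confined v t a b q \<Longrightarrow> width a b q \<le> 1 \<Longrightarrow>
      \<exists>\<zeta>. \<forall>s\<ge>t. \<forall>x. \<bar>v s x - u s (x - \<zeta>)\<bar> \<le> C * exp (- r * (s - t))"
    using converges_from_gap[of 1] by auto
  have "\<exists>C>0. \<exists>\<zeta>. \<forall>s\<ge>t. \<forall>x. \<bar>v s x - u s (x - \<zeta>)\<bar> \<le> C * exp (- r * (s - t))"
    if v: "sol v t" and c: "confined v t a b q" for v t a b q
  proof -
    obtain t' a' b' q' where t': "t \<le> t'" "confined v t' a' b' q'" "width a' b' q' \<le> 1"
      using gap_becomes_small[OF v c] by blast
    obtain \<zeta> where \<zeta>: "\<And>s x. t' \<le> s \<Longrightarrow> \<bar>v s x - u s (x - \<zeta>)\<bar> \<le> C * exp (- r * (s - t'))"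
      using conv[OF sol_later[OF v t'(1)] t'(2,3)] by blast
    have "\<bar>v s x - u s (x - \<zeta>)\<bar> \<le> (C + 3) * exp (r * (t' - t)) * exp (- r * (s - t))" if s: "t \<le> s" for s x
    proof -
      have e: "exp (r * (t' - t)) * exp (- r * (s - t)) = exp (- r * (s - t'))"
        by (simp add: exp_add[symmetric] algebra_simps)
      show ?thesis
      proof (cases "t' \<le> s")
        case True
        have "C * exp (- r * (s - t')) \<le> (C + 3) * exp (- r * (s - t'))" by (intro mult_right_mono) auto
        then show ?thesis using \<zeta>[OF True, of x] unfolding mult.assoc e by linarith
      next
        case False
        have "q \<le> 1" "0 \<le> q" using c q0_le_1 by (auto simp: confined_def)
        then have "\<bar>v s x - u s (x - \<zeta>)\<bar> \<le> 3"
          using confined_bounds[OF v c s, of x] u_range[of s "x - (b + A * q)"]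
            u_range[of s "x - (a - A * q)"] u_range[of s "x - \<zeta>"] by linarith
        also have "3 \<le> (C + 3) * 1" using C by simp
        also have "\<dots> \<le> (C + 3) * exp (- r * (s - t'))"
          using False r C by (intro mult_left_mono) (auto simp: mult_nonneg_nonpos)
        finally show ?thesis unfolding mult.assoc e .
      qed
    qed
    then show ?thesis using C by (intro exI[of _ "(C + 3) * exp (r * (t' - t))"]) auto
  qed
  then show ?thesis using r by blast
qed

section \<open>Trapping the initial datum\<close>

text \<open>The front decays at least like \<open>exp (- 2 \<beta> y)\<close>, which leaves a factor \<open>exp (- \<beta> y)\<close> to beat the constant \<open>q0\<close>.\<close>

lemma u_below_weight: "\<exists>R>0. \<forall>t y. R \<le> y - X t \<longrightarrow> u t y \<le> q0 * weight (y - X t)"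
proof -
  define R where "R = 2 * hp + \<bar>ln q0\<bar> / \<beta>"
  have R: "hp \<le> R" "0 < R" using decay_pos \<beta>_pos by (auto simp: R_def add_pos_nonneg)
  have "u t y \<le> q0 * weight (y - X t)" if y: "R \<le> y - X t" for t y
  proof -
    define \<xi> where "\<xi> = y - X t"
    have "u t y \<le> exp (- cp * (\<xi> - hp))" using y u_bounds[of t] R by (simp add: front_bounds_def \<xi>_def)
    also have "\<dots> \<le> exp (- (2 * \<beta>) * (\<xi> - hp))"
    proof -
      have "(2 * \<beta>) * (\<xi> - hp) \<le> cp * (\<xi> - hp)"
        using y R \<eta>_cp by (intro mult_right_mono) (auto simp: \<xi>_def \<beta>_def)
      then show ?thesis by simp
    qed
    also have "\<dots> \<le> exp (ln q0 - \<beta> * \<xi>)"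
    proof -
      have "\<beta> * (2 * hp + \<bar>ln q0\<bar> / \<beta>) \<le> \<beta> * \<xi>" using y \<beta>_pos by (intro mult_left_mono) (auto simp: \<xi>_def R_def)
      moreover have "\<beta> * (2 * hp + \<bar>ln q0\<bar> / \<beta>) = 2 * \<beta> * hp + \<bar>ln q0\<bar>" using \<beta>_pos by (simp add: field_simps)
      ultimately have "2 * \<beta> * hp + \<bar>ln q0\<bar> \<le> \<beta> * \<xi>" by simp
      then show ?thesis by (simp add: algebra_simps)
    qed
    also have "\<dots> = q0 * weight \<xi>"
      using y R q0_pos by (simp add: weight_nonneg \<xi>_def exp_diff exp_minus divide_inverse)
    finally show ?thesis by (simp add: \<xi>_def)
  qed
  then show ?thesis using R by blast
qed

text \<open>Shifted far enough to the left, the front is below \<open>q0\<close> times the weight wherever \<open>g\<close> is not yet close to \<open>1\<close>.\<close>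

lemma initially_trapped_below:
  assumes g: "\<And>x. 0 \<le> g x" and lim: "(g \<longlongrightarrow> 1) at_bot"
  shows "\<exists>a. trapped (- 1) g t a q0"
proof -
  obtain R where R: "0 < R" "\<And>t y. R \<le> y - X t \<Longrightarrow> u t y \<le> q0 * weight (y - X t)"
    using u_below_weight by blast
  have "\<forall>\<^sub>F x in at_bot. 1 - q0 * weight R < g x"
    using q0_pos weight_pos by (intro order_tendstoD(1)[OF lim]) auto
  then obtain l where l: "\<And>x. x \<le> l \<Longrightarrow> 1 - q0 * weight R < g x" by (auto simp: eventually_at_bot_linorder)
  define a where "a = l - X t - R"
  have "0 \<le> - 1 * (u t (x - a) - g x) + q0 * weight (x - X t - a)" for x
  proof (cases "R \<le> x - a - X t")
    case True
    then show ?thesis using R(2)[OF True] g[of x] by (simp add: diff_diff_eq2 algebra_simps)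
  next
    case False
    then have "x \<le> l" by (simp add: a_def)
    moreover have "q0 * weight R \<le> q0 * weight (x - X t - a)"
      using False q0_pos by (intro mult_left_mono weight_antimono) auto
    ultimately show ?thesis using l[of x] u_range(2)[of t "x - a"] by simp
  qed
  then show ?thesis unfolding trapped_def by blast
qed

text \<open>
  Shifted far enough to the right, the front is above \<open>1 - q0\<close> on a half-line, beyond which the exponential error is
  covered by \<open>q0\<close> times the weight because \<open>\<beta> \<le> \<beta>0\<close>.
\<close>

lemma initially_trapped_above:
  assumes g: "\<And>x. g x \<le> 1" and "\<beta> \<le> \<beta>0" and "0 < C"
    and close: "\<And>x. g x \<le> u t x + C * exp (- \<beta>0 * (x - X t))"
  shows "\<exists>b\<ge>a. trapped 1 g t b q0"
proof -
  obtain M where M: "0 < M" "\<And>t x. x - X t \<le> - M \<Longrightarrow> 1 - q0 \<le> u t x"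
    using front_limits[OF q0_pos] by blast
  have \<beta>0: "0 < \<beta>0" using \<beta>_pos \<open>\<beta> \<le> \<beta>0\<close> by simp
  define b where "b = max (max a 0) (ln (C * exp (\<beta>0 * M) / q0) / \<beta>0)"
  have b: "a \<le> b" "0 \<le> b" "ln (C * exp (\<beta>0 * M) / q0) / \<beta>0 \<le> b" by (auto simp: b_def)
  then have "ln (C * exp (\<beta>0 * M) / q0) \<le> \<beta>0 * b" using \<beta>0 by (simp add: field_simps)
  then have "C * exp (\<beta>0 * M) / q0 \<le> exp (\<beta>0 * b)"
    using \<open>0 < C\<close> q0_pos by (metis exp_gt_zero exp_le_cancel_iff exp_ln mult_pos_pos zero_less_divide_iff)
  then have Cq: "C * exp (\<beta>0 * M) * exp (- \<beta>0 * b) \<le> q0"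
    using q0_pos by (simp add: exp_minus field_simps)
  have "0 \<le> 1 * (u t (x - b) - g x) + q0 * weight (x - X t - b)" for x
  proof (cases "x - b - X t \<le> - M")
    case True
    then have "weight (x - X t - b) = 1" using M(1) by (intro weight_neg) auto
    then show ?thesis using M(2)[OF True] g[of x] by simp
  next
    case False
    define \<xi> where "\<xi> = x - X t - b"
    have "exp (- \<beta>0 * \<xi>) \<le> exp (\<beta>0 * M) * weight \<xi>"
    proof (cases "0 \<le> \<xi>")
      case True
      have "exp (- \<beta>0 * \<xi>) \<le> weight \<xi>" using True \<open>\<beta> \<le> \<beta>0\<close> by (simp add: weight_nonneg mult_right_mono)
      also have "weight \<xi> \<le> exp (\<beta>0 * M) * weight \<xi>" using \<beta>0 M(1) weight_pos[of \<xi>] by simp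
      finally show ?thesis .
    next
      case neg: False
      have "\<beta>0 * (- \<xi>) \<le> \<beta>0 * M" using False \<beta>0 by (intro mult_left_mono) (auto simp: \<xi>_def)
      then show ?thesis using neg by (simp add: weight_neg)
    qed
    then have "C * exp (- \<beta>0 * b) * exp (- \<beta>0 * \<xi>) \<le> C * exp (- \<beta>0 * b) * (exp (\<beta>0 * M) * weight \<xi>)"
      using \<open>0 < C\<close> by (intro mult_left_mono) auto
    also have "\<dots> = (C * exp (\<beta>0 * M) * exp (- \<beta>0 * b)) * weight \<xi>" by (simp add: mult_ac)
    also have "\<dots> \<le> q0 * weight \<xi>" using Cq weight_pos[of \<xi>] by (intro mult_right_mono) auto
    also have "C * exp (- \<beta>0 * b) * exp (- \<beta>0 * \<xi>) = C * exp (- \<beta>0 * (x - X t))"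
      unfolding mult.assoc exp_add[symmetric] by (simp add: \<xi>_def algebra_simps)
    finally have "C * exp (- \<beta>0 * (x - X t)) \<le> q0 * weight \<xi>" .
    moreover have "u t x \<le> u t (x - b)" using b by (intro u_antimono) auto
    ultimately show ?thesis using close[of x] by (simp add: \<xi>_def)
  qed
  then show ?thesis using b(1) unfolding trapped_def by blast
qed

end


section \<open>Stability of the transition front\<close>

lemma dispersal_kernel_is_kernel:
  assumes "dispersal_kernel J" shows "kernel J"
proof
  show "continuous_on UNIV J"
    using assms by (auto simp: dispersal_kernel_def intro: C1_differentiable_imp_continuous_on)
qed (use assms in \<open>auto simp: dispersal_kernel_def\<close>)

text \<open>
  The mean value theorem turns the bounds on \<open>f\<^sub>u\<close> into difference bounds. As \<open>f\<close> vanishes on the negative axis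
  and at \<open>0\<close>, the Lipschitz bound extends to all real arguments.
\<close>

lemma ignition_nonlinearity_bounds:
  assumes "ignition_nonlinearity f \<theta> fmin"
  obtains K \<theta>\<^sub>1 \<kappa> where "0 < K" "\<And>t w w'. \<bar>f t w - f t w'\<bar> \<le> K * \<bar>w - w'\<bar>"
    "\<And>t w. w \<le> \<theta> \<Longrightarrow> f t w = 0"
    "\<And>t w w'. \<theta>\<^sub>1 \<le> w' \<Longrightarrow> w' \<le> w \<Longrightarrow> w \<le> 2 \<Longrightarrow> f t w - f t w' \<le> - \<kappa> * (w - w')"
    "0 < \<theta>" "\<theta>\<^sub>1 < 1" "0 < \<kappa>"
proof -
  note hyps = assms[unfolded ignition_nonlinearity_def]
  have "0 < \<theta> \<and> \<theta> < 1" using hyps by (elim conjE) (intro conjI)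
  then have \<theta>: "0 < \<theta>" "\<theta> < 1" by simp_all
  have fneg: "\<forall>t. \<forall>w<0. f t w = 0" using hyps by (elim conjE)
  obtain fmax where fm: "\<forall>w\<in>{0..\<theta>} \<union> {1}. fmin w = 0 \<and> fmax w = 0"
      "\<forall>t. \<forall>w\<in>{0..1}. fmin w \<le> f t w \<and> f t w \<le> fmax w"
    using hyps by (elim conjE exE) (rule that; assumption)
  obtain ft fu where deriv: "\<forall>t. \<forall>w\<ge>0. ((\<lambda>(t, w). f t w) has_derivative (\<lambda>(h, k). ft t w * h + fu t w * k))
        (at (t, w) within UNIV \<times> {0..})"
    and bdd: "bdd_above ((\<lambda>(t, w). \<bar>fu t w\<bar>) ` (UNIV \<times> {0..}))"
    and neg: "\<exists>\<theta>' \<beta>'. \<theta> < \<theta>' \<and> \<theta>' < 1 \<and> 0 < \<beta>' \<and> (\<forall>t. \<forall>w\<in>{\<theta>'..2}. fu t w \<le> - \<beta>')"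
  proof -
    from hyps have "\<exists>ft fu. (\<forall>t. \<forall>w\<ge>0. ((\<lambda>(t, w). f t w) has_derivative (\<lambda>(h, k). ft t w * h + fu t w * k))
        (at (t, w) within UNIV \<times> {0..})) \<and> bdd_above ((\<lambda>(t, w). \<bar>fu t w\<bar>) ` (UNIV \<times> {0..})) \<and>
        (\<exists>\<theta>' \<beta>'. \<theta> < \<theta>' \<and> \<theta>' < 1 \<and> 0 < \<beta>' \<and> (\<forall>t. \<forall>w\<in>{\<theta>'..2}. fu t w \<le> - \<beta>'))"
      by (elim conjE) (elim exE conjE, intro exI conjI; assumption)
    then show ?thesis using that by blast
  qed
  have zero: "f t w = 0" if "w \<le> \<theta>" for t w
  proof (cases "w < 0")
    case False
    then have "w \<in> {0..\<theta>} \<union> {1}" "w \<in> {0..1}" using that \<theta> by auto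
    from fm(1)[rule_format, OF this(1)] fm(2)[rule_format, OF this(2), of t] show ?thesis by linarith
  qed (use fneg in auto)
  have dfu: "(f t has_real_derivative fu t w) (at w within {0..})" if "0 \<le> w" for t w
  proof -
    have "((\<lambda>x. (t, x)) has_derivative (\<lambda>k. (0, k))) (at w within {0..})"
      by (auto intro!: derivative_eq_intros)
    moreover have "((\<lambda>(t, w). f t w) has_derivative (\<lambda>(h, k). ft t w * h + fu t w * k))
        (at (t, w) within (\<lambda>x. (t, x)) ` {0..})"
      using deriv[rule_format, OF that, of t] by (rule has_derivative_subset) auto
    ultimately have "((\<lambda>x. (\<lambda>(t, w). f t w) (t, x)) has_derivative
        (\<lambda>k. (\<lambda>(h, k). ft t w * h + fu t w * k) (0, k))) (at w within {0..})"
      by (rule has_derivative_in_compose[of "\<lambda>x. (t, x)"])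
    then show ?thesis by (simp add: has_field_derivative_def)
  qed
  obtain B where B: "\<And>t w. 0 \<le> w \<Longrightarrow> \<bar>fu t w\<bar> \<le> B"
    using bdd by (auto simp: bdd_above_def)
  define K where "K = B + 1"
  have "0 \<le> B" using B[of 0 0] by linarith
  have lip0: "\<bar>f t w - f t w'\<bar> \<le> K * \<bar>w - w'\<bar>" if "0 \<le> w" "0 \<le> w'" for t w w'
  proof -
    have "norm (f t w - f t w') \<le> B * norm (w - w')"
      using that B dfu by (intro field_differentiable_bound[of "{0..}" "f t" "fu t"]) auto
    then show ?thesis by (simp add: K_def algebra_simps add_increasing)
  qed
  have lip: "\<bar>f t w - f t w'\<bar> \<le> K * \<bar>w - w'\<bar>" for t w w'
  proof -
    have clip: "f t y = f t (max y 0)" for y using zero[of y t] zero[of 0 t] \<theta> by (cases "y < 0") (auto simp: max_def)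
    have "\<bar>f t w - f t w'\<bar> \<le> K * \<bar>max w 0 - max w' 0\<bar>"
      unfolding clip[of w] clip[of w'] by (rule lip0) auto
    also have "\<dots> \<le> K * \<bar>w - w'\<bar>" using \<open>0 \<le> B\<close> by (intro mult_left_mono) (auto simp: K_def)
    finally show ?thesis .
  qed
  obtain \<theta>\<^sub>1 \<kappa> where \<kappa>: "\<theta> < \<theta>\<^sub>1" "\<theta>\<^sub>1 < 1" "0 < \<kappa>" "\<And>t w. \<theta>\<^sub>1 \<le> w \<Longrightarrow> w \<le> 2 \<Longrightarrow> fu t w \<le> - \<kappa>"
    using neg by auto
  have dec: "f t w - f t w' \<le> - \<kappa> * (w - w')" if "\<theta>\<^sub>1 \<le> w'" "w' \<le> w" "w \<le> 2" for t w w'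
  proof (cases "w' = w")
    case False
    then have "w' < w" using that by simp
    moreover have "DERIV (f t) x :> fu t x" if "w' \<le> x" "x \<le> w" for x
    proof -
      have "0 < x" using that \<open>\<theta>\<^sub>1 \<le> w'\<close> \<kappa> \<theta> by simp
      then have "at x within {0..} = at x" by (intro at_within_interior) simp
      then show ?thesis using dfu[of x t] \<open>0 < x\<close> by simp
    qed
    ultimately obtain z where z: "w' < z" "z < w" "f t w - f t w' = (w - w') * fu t z"
      using MVT2[of w' w "f t" "fu t"] by blast
    have "fu t z \<le> - \<kappa>" using z that by (intro \<kappa>(4)) auto
    then have "(w - w') * fu t z \<le> (w - w') * - \<kappa>" using that by (intro mult_left_mono) auto
    then show ?thesis using z by (simp add: mult.commute)
  qed simp
  have "0 < K" using \<open>0 \<le> B\<close> by (simp add: K_def)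
  then show thesis by (rule that[of K \<theta>\<^sub>1 \<kappa>]) (fact lip zero dec \<theta>(1) \<kappa>(2) \<kappa>(3))+
qed

lemma decreasing_strictly_between:
  fixes g :: "real \<Rightarrow> real"
  assumes dec: "\<And>x y. x < y \<Longrightarrow> g y < g x" and lim: "(g \<longlongrightarrow> 1) at_bot" "(g \<longlongrightarrow> 0) at_top"
  shows "0 < g x" "g x < 1"
proof -
  have "\<forall>\<^sub>F y in at_bot. g (x - 1) \<le> g y"
    unfolding eventually_at_bot_linorder by (intro exI[of _ "x - 2"] allI impI less_imp_le dec) auto
  then have "g (x - 1) \<le> 1" by (intro tendsto_lowerbound[OF lim(1)]) auto
  then show "g x < 1" using dec[of "x - 1" x] by simp
  have "\<forall>\<^sub>F y in at_top. g y \<le> g (x + 1)"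
    unfolding eventually_at_top_linorder by (intro exI[of _ "x + 2"] allI impI less_imp_le dec) auto
  then have "0 \<le> g (x + 1)" by (intro tendsto_upperbound[OF lim(2)]) auto
  then show "0 < g x" using dec[of x "x + 1"] by simp
qed

text \<open>
  Uniform boundedness on compact time intervals follows from continuity in the supremum norm by a bisection
  argument.
\<close>

lemma (in front) cauchy_solution_sol:
  assumes "cauchy_solution J f t0 u0 v" shows "sol v t0"
  unfolding sol_def
proof (intro conjI allI impI)
  have S: "v t \<in> Cb_unif" "uniform_limit UNIV v (v t) (at t within {t0..})"
    "((\<lambda>s. v s x) has_real_derivative conv J (v t) x - v t x + f t (v t x)) (at t within {t0..})"
    if "t0 \<le> t" for t x
    using assms that by (auto simp: cauchy_solution_def solution_on_def)
  show "((\<lambda>s. v s x) has_real_derivative conv J (v t) x - v t x + f t (v t x)) (at t within {t0..})"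
    if "t0 \<le> t" for t x using S(3)[OF that] .
  fix b
  have "\<exists>B. \<forall>t x. t0 \<le> t \<longrightarrow> t \<le> b \<longrightarrow> \<bar>v t x\<bar> \<le> B"
  proof (cases "t0 \<le> b")
    case True
    show ?thesis
    proof -
      define P where "P c d = (\<exists>B. \<forall>t x. c \<le> t \<longrightarrow> t \<le> d \<longrightarrow> t0 \<le> t \<longrightarrow> \<bar>v t x\<bar> \<le> B)" for c d
      have "P t0 b"
      proof (rule Bolzano[OF True])
        fix c d e assume "P c d" "P d e"
        then obtain B1 B2 where B: "\<forall>t x. c \<le> t \<longrightarrow> t \<le> d \<longrightarrow> t0 \<le> t \<longrightarrow> \<bar>v t x\<bar> \<le> B1"
          "\<forall>t x. d \<le> t \<longrightarrow> t \<le> e \<longrightarrow> t0 \<le> t \<longrightarrow> \<bar>v t x\<bar> \<le> B2" unfolding P_def by blast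
        show "P c e" unfolding P_def
        proof (intro exI[of _ "max B1 B2"] allI impI)
          fix t x assume "c \<le> t" "t \<le> e" "t0 \<le> t"
          then show "\<bar>v t x\<bar> \<le> max B1 B2"
            using B(1)[rule_format, of t x] B(2)[rule_format, of t x] by (cases "t \<le> d") auto
        qed
      next
        fix s assume s: "t0 \<le> s" "s \<le> b"
        obtain B where B: "\<And>x. \<bar>v s x\<bar> \<le> B" using S(1)[OF s(1)] by (auto simp: Cb_unif_def bounded_iff)
        have "\<forall>\<^sub>F \<tau> in at s within {t0..}. \<forall>x\<in>UNIV. dist (v \<tau> x) (v s x) < 1"
          using S(2)[OF s(1)] by (rule uniform_limitD) simp
        then obtain d where d: "0 < d" "\<And>\<tau> x. t0 \<le> \<tau> \<Longrightarrow> \<tau> \<noteq> s \<Longrightarrow> dist \<tau> s < d \<Longrightarrow> dist (v \<tau> x) (v s x) < 1"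
          unfolding eventually_at by auto
        have near: "\<bar>v \<tau> x\<bar> \<le> B + 1" if "t0 \<le> \<tau>" "\<bar>\<tau> - s\<bar> < d" for \<tau> x
        proof (cases "\<tau> = s")
          case False
          then show ?thesis using d(2)[of \<tau> x] B[of x] that by (simp add: dist_real_def)
        qed (use B[of x] in simp)
        show "\<exists>d>0. \<forall>c e. c \<le> s \<and> s \<le> e \<and> e - c < d \<longrightarrow> P c e"
        proof (intro exI[of _ d] conjI allI impI d(1))
          fix c e assume "c \<le> s \<and> s \<le> e \<and> e - c < d"
          then show "P c e" unfolding P_def by (intro exI[of _ "B + 1"] allI impI near) auto
        qed
      qed
      then show ?thesis by (auto simp: P_def)
    qed
  qed auto
  then obtain B where B: "\<And>t x. t0 \<le> t \<Longrightarrow> t \<le> b \<Longrightarrow> \<bar>v t x\<bar> \<le> B" by blast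
  show "strip v t0 b"
  proof (rule stripI[of _ _ _ B])
    show "bcont (v t)" if "t0 \<le> t" for t
      using S(1)[OF that] by (simp add: bcont_def Cb_unif_def uniformly_continuous_imp_continuous)
    have "continuous_on {t0..} (\<lambda>t. v t x)" for x
      by (rule DERIV_continuous_on) (use S(3) in simp)
    then show "continuous_on {t0..b} (\<lambda>t. v t x)" for x by (rule continuous_on_subset) auto
  qed (rule B)
qed

theorem theorem1p5:
  fixes J fmin X :: "real \<Rightarrow> real" and f u :: "real \<Rightarrow> real \<Rightarrow> real" and \<theta> \<beta>0 :: real
  assumes "dispersal_kernel J"
    and "ignition_nonlinearity f \<theta> fmin"
    and "constructed_front J f \<theta> fmin u X"
    and "\<beta>0 > 0"
  shows "\<exists>r>0. \<forall>t0 u0 v.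
    u0 \<in> Cb_unif \<and> range u0 \<subseteq> {0..1} \<and> (u0 \<longlongrightarrow> 1) at_bot \<and>
    (\<exists>C>0. \<forall>x. \<bar>u0 x - u t0 x\<bar> \<le> C * exp (- \<beta>0 * (x - X t0))) \<and>
    cauchy_solution J f t0 u0 v \<longrightarrow>
    (\<exists>C>0. \<exists>\<zeta>. \<forall>t\<ge>t0. (SUP x. \<bar>v t x - u t (x - \<zeta>)\<bar>) \<le> C * exp (- r * (t - t0)))"
proof -
  interpret kernel J using assms(1) by (rule dispersal_kernel_is_kernel)
  obtain K \<theta>\<^sub>1 \<kappa> where F: "0 < K" "\<And>t w w'. \<bar>f t w - f t w'\<bar> \<le> K * \<bar>w - w'\<bar>"
    "\<And>t w. w \<le> \<theta> \<Longrightarrow> f t w = 0"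
    "\<And>t w w'. \<theta>\<^sub>1 \<le> w' \<Longrightarrow> w' \<le> w \<Longrightarrow> w \<le> 2 \<Longrightarrow> f t w - f t w' \<le> - \<kappa> * (w - w')"
    "0 < \<theta>" "\<theta>\<^sub>1 < 1" "0 < \<kappa>"
    using ignition_nonlinearity_bounds[OF assms(2)] by blast
  obtain \<phi> cmin cmax cm cp hm hp us Xs where
      approx: "approximating_solutions J f \<theta> \<phi> cmin cmax cm cp hm hp us Xs"
      and front: "transition_front J f u" and dec: "\<forall>t x x'. x < x' \<longrightarrow> u t x' < u t x"
      and lip: "\<exists>L. \<forall>t. L-lipschitz_on UNIV (u t)" and X: "X C1_differentiable_on UNIV"
      and speed: "\<forall>t. deriv X t \<in> {cmin..cmax}" and bounds: "\<forall>t. front_bounds cm cp hm hp (u t) (X t)"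
  proof -
    from assms(3)[unfolded constructed_front_def] show ?thesis
      by (elim exE conjE) (rule that; (assumption | (intro exI; assumption)))
  qed
  have "0 < cmin \<and> 0 < cm \<and> 0 < cp \<and> 0 < hm \<and> 0 < hp"
    using approx unfolding approximating_solutions_def by (elim conjE) (intro conjI)
  then have pos: "0 < cmin" "0 < cm" "0 < cp" "0 < hm" "0 < hp" by simp_all
  obtain L0 where "\<And>t. L0-lipschitz_on UNIV (u t)" using lip by blast
  then have L: "0 \<le> L0" "\<And>t x y. \<bar>u t x - u t y\<bar> \<le> L0 * \<bar>x - y\<bar>"
    by (auto simp: lipschitz_on_def dist_real_def)
  obtain \<rho> where \<rho>: "spreading_radius \<rho>" using spreading_radius_exists by blast
  have fr: "front J f u X K (L0 + 1) \<theta> \<theta>\<^sub>1 \<kappa> cmin cmax cm cp hm hp \<rho>"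
  proof (intro front.intro front_axioms.intro kernel_axioms F pos \<rho>)
    show "bcont (u t)" for t
      using front by (auto simp: transition_front_def solution_on_def bcont_def Cb_unif_def uniformly_continuous_imp_continuous)
    show "((\<lambda>s. u s x) has_real_derivative conv J (u t) x - u t x + f t (u t x)) (at t)" for t x
      using front by (auto simp: transition_front_def solution_on_def)
    show "0 < u t x" "u t x < 1" for t x
      using front dec by (auto simp: transition_front_def intro: decreasing_strictly_between[of "u t"])
    show "\<bar>u t x - u t y\<bar> \<le> (L0 + 1) * \<bar>x - y\<bar>" for t x y
      using L(2)[of t x y] by (simp add: algebra_simps add_increasing)
    show "(X has_real_derivative deriv X t) (at t)" for t
      using X by (auto simp: C1_differentiable_on_eq DERIV_deriv_iff_real_differentiable)
  qed (use L dec speed bounds in auto)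
  interpret front J f u X K "L0 + 1" \<theta> \<theta>\<^sub>1 \<kappa> cmin cmax cm cp hm hp \<rho> by (rule fr)
  obtain \<eta> \<omega> where w: "0 < \<eta>" "\<eta> \<le> 1/4" "\<eta> \<le> cp" "\<eta> / 2 \<le> \<beta>0" "0 < \<omega>" "\<omega> \<le> \<kappa>"
    "laplace \<eta> - 1 \<le> \<eta> * cmin" "laplace (\<eta> / 2) - 1 + \<omega> \<le> \<eta> / 2 * cmin" "laplace \<eta> - 1 + \<eta> * cmax \<le> \<kappa>"
    using weights_exist[OF assms(4)] by blast
  interpret weighted_front J f u X K "L0 + 1" \<theta> \<theta>\<^sub>1 \<kappa> cmin cmax cm cp hm hp \<rho> \<eta> "\<eta> / 2" \<omega>
    by unfold_locales (use w in auto)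
  obtain A q0 where "barrier_constants A q0" using barrier_constants_exist by blast
  then interpret squeezed_front J f u X K "L0 + 1" \<theta> \<theta>\<^sub>1 \<kappa> cmin cmax cm cp hm hp \<rho> \<eta> "\<eta> / 2" \<omega> A q0
    by unfold_locales
  obtain r where r: "0 < r" and stable: "\<And>v t a b q. sol v t \<Longrightarrow> confined v t a b q \<Longrightarrow>
      \<exists>C>0. \<exists>\<zeta>. \<forall>s\<ge>t. \<forall>x. \<bar>v s x - u s (x - \<zeta>)\<bar> \<le> C * exp (- r * (s - t))"
    using stability_of_confined by blast
  show ?thesis
  proof (rule exI[of _ r], rule conjI[OF r], intro allI impI)
    fix t0 u0 v
    assume H: "u0 \<in> Cb_unif \<and> range u0 \<subseteq> {0..1} \<and> (u0 \<longlongrightarrow> 1) at_bot \<and>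
      (\<exists>C>0. \<forall>x. \<bar>u0 x - u t0 x\<bar> \<le> C * exp (- \<beta>0 * (x - X t0))) \<and> cauchy_solution J f t0 u0 v"
    then have cs: "cauchy_solution J f t0 u0 v" and lim: "(u0 \<longlongrightarrow> 1) at_bot" and "range u0 \<subseteq> {0..1}"
      and ex: "\<exists>C>0. \<forall>x. \<bar>u0 x - u t0 x\<bar> \<le> C * exp (- \<beta>0 * (x - X t0))"
      by simp_all
    from cs have v: "sol v t0" by (rule cauchy_solution_sol)
    from cs have v0: "v t0 = u0" by (simp add: cauchy_solution_def)
    have "u0 x \<in> {0..1}" for x using \<open>range u0 \<subseteq> {0..1}\<close> by blast
    then have range: "0 \<le> u0 x" "u0 x \<le> 1" for x by simp_all
    from ex obtain C where C: "0 < C" "\<And>x. \<bar>u0 x - u t0 x\<bar> \<le> C * exp (- \<beta>0 * (x - X t0))" by blast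
    from initially_trapped_below[OF range(1) lim] obtain a where a: "trapped (- 1) u0 t0 a q0" by blast
    have "u0 x \<le> u t0 x + C * exp (- \<beta>0 * (x - X t0))" for x using C(2)[of x] by linarith
    from initially_trapped_above[OF range(2) w(4) C(1) this, of a]
    obtain b where "a \<le> b" "trapped 1 u0 t0 b q0" by blast
    then have "confined v t0 a b q0" using a v0 q0_pos by (simp add: confined_def)
    from stable[OF v this]
    obtain C' \<zeta> where C': "0 < C'" "\<And>s x. t0 \<le> s \<Longrightarrow> \<bar>v s x - u s (x - \<zeta>)\<bar> \<le> C' * exp (- r * (s - t0))"
      by blast
    show "\<exists>C>0. \<exists>\<zeta>. \<forall>t\<ge>t0. (SUP x. \<bar>v t x - u t (x - \<zeta>)\<bar>) \<le> C * exp (- r * (t - t0))"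
    proof (rule exI[of _ C'], rule conjI[OF C'(1)], rule exI[of _ \<zeta>], intro allI impI)
      fix t assume "t0 \<le> t"
      show "(SUP x. \<bar>v t x - u t (x - \<zeta>)\<bar>) \<le> C' * exp (- r * (t - t0))"
        by (rule cSUP_least) (simp, rule C'(2)[OF \<open>t0 \<le> t\<close>])
    qed
  qed
qed

end
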